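(* Let $(R,\mathfrak m)$ be a noetherian local ring and $I$ an ideal of $R$ such that $0=H^2_I(R)=H^3_I(R)=\dots$, i.e. $H^i_I(R)=0$ for all $i\ge 2$. Then $$\operatorname{ara}(I)\le 1\iff \operatorname{Ass}_R\bigl(D(H^1_I(R))\bigr)\text{ satisfies prime avoidance}.$$
   Context: Rings are commutative with unit. $H^i_I(R)$ denotes the $i$-th local cohomology module of $R$ supported in $I$. The arithmetic rank of $I$ is $\operatorname{ara}(I):=\min\{l\in\mathbb N\mid \exists r_1,\dots,r_l\in R:\ \sqrt I=\sqrt{(r_1,\dots,r_l)R}\}$. $E:=E_R(R/\mathfrak m)$ is the $R$-injective hull of $R/\mathfrak m$ and $D(M):=\operatorname{Hom}_R(M,E)$ is the Matlis dual of an $R$-module $M$. For a (not necessarily finitely generated) $R$-module $M$, $\operatorname{Ass}_R(M)$ is the set of prime ideals of the form $\operatorname{ann}_R(m)$ with $m\in M$. A subset $X\subseteq\operatorname{Spec}(R)$ satisfies prime avoidance if, for every ideal $J$ of $R$, $J\subseteq\bigcup_{\mathfrak p\in X}\mathfrak p$ implies that there exists $\mathfrak p_0\in X$ with $J\subseteq\mathfrak p_0$. *)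

theory Defs
  imports "HOL-Algebra.Algebra"
begin

section \<open>Rings and ideals\<close>

definition local_ring :: "('a, 'k) ring_scheme \<Rightarrow> 'a set \<Rightarrow> bool" where
  "local_ring R \<mm> \<longleftrightarrow>
     cring R \<and> maximalideal \<mm> R \<and> (\<forall>\<nn>. maximalideal \<nn> R \<longrightarrow> \<nn> = \<mm>)"

definition ideal_radical :: "('a, 'k) ring_scheme \<Rightarrow> 'a set \<Rightarrow> 'a set" where
  "ideal_radical R I = {a \<in> carrier R. \<exists>n::nat. a [^]\<^bsub>R\<^esub> n \<in> I}"

text \<open>For non-noetherian rings the set of admissible lengths may be empty, and then the value is
  unspecified.\<close>

definition arithmetic_rank :: "('a, 'k) ring_scheme \<Rightarrow> 'a set \<Rightarrow> nat" where
  "arithmetic_rank R I =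
     (LEAST l. \<exists>rs. length rs = l \<and> set rs \<subseteq> carrier R
        \<and> ideal_radical R I = ideal_radical R (genideal R (set rs)))"

definition satisfies_prime_avoidance :: "('a, 'k) ring_scheme \<Rightarrow> 'a set set \<Rightarrow> bool" where
  "satisfies_prime_avoidance R S \<longleftrightarrow>
     (\<forall>J. ideal J R \<longrightarrow> J \<subseteq> \<Union>S \<longrightarrow> (\<exists>\<pp>\<in>S. J \<subseteq> \<pp>))"


section \<open>Modules\<close>

text \<open>Module records inherit the fields \<open>mult\<close> and \<open>one\<close> from ring records. The locale
  \<^locale>\<open>module\<close> ignores them, so they are left undefined in the constructions below.\<close>

definition module_homs ::
  "('a, 'k) ring_scheme \<Rightarrow> ('a, 'b, 'x) module_scheme \<Rightarrow> ('a, 'c, 'y) module_scheme \<Rightarrow> ('b \<Rightarrow> 'c) set" where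
  "module_homs R M N =
     {f \<in> hom (add_monoid M) (add_monoid N).
        \<forall>r\<in>carrier R. \<forall>x\<in>carrier M. f (r \<odot>\<^bsub>M\<^esub> x) = r \<odot>\<^bsub>N\<^esub> f x}"

definition regular_module :: "('a, 'k) ring_scheme \<Rightarrow> ('a, 'a) module" where
  "regular_module R =
     \<lparr>carrier = carrier R, monoid.mult = monoid.mult R, one = one R,
      ring.zero = ring.zero R, ring.add = ring.add R, smult = monoid.mult R\<rparr>"

definition quotient_module ::
  "('a, 'b, 'x) module_scheme \<Rightarrow> 'b set \<Rightarrow> ('a, 'b set) module" where
  "quotient_module M N =
     \<lparr>carrier = a_rcosets\<^bsub>M\<^esub> N, monoid.mult = undefined, one = undefined,
      ring.zero = N, ring.add = set_add M, smult = (\<lambda>r C. \<Union>x\<in>C. N +>\<^bsub>M\<^esub> (r \<odot>\<^bsub>M\<^esub> x))\<rparr>"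

text \<open>Homomorphisms are cut off outside the carrier of the source, so that equality of elements of
  \<open>Hom\<^sub>R(M, N)\<close> is equality of maps on \<open>M\<close>.\<close>

definition hom_module ::
  "('a, 'k) ring_scheme \<Rightarrow> ('a, 'b, 'x) module_scheme \<Rightarrow> ('a, 'c, 'y) module_scheme \<Rightarrow> ('a, 'b \<Rightarrow> 'c) module" where
  "hom_module R M N =
     \<lparr>carrier = module_homs R M N \<inter> extensional (carrier M), monoid.mult = undefined, one = undefined,
      ring.zero = (\<lambda>x\<in>carrier M. \<zero>\<^bsub>N\<^esub>),
      ring.add = (\<lambda>f g. \<lambda>x\<in>carrier M. f x \<oplus>\<^bsub>N\<^esub> g x),
      smult = (\<lambda>r f. \<lambda>x\<in>carrier M. r \<odot>\<^bsub>N\<^esub> f x)\<rparr>"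

definition annihilator :: "('a, 'k) ring_scheme \<Rightarrow> ('a, 'b, 'x) module_scheme \<Rightarrow> 'b \<Rightarrow> 'a set" where
  "annihilator R M m = {r \<in> carrier R. r \<odot>\<^bsub>M\<^esub> m = \<zero>\<^bsub>M\<^esub>}"

definition associated_primes :: "('a, 'k) ring_scheme \<Rightarrow> ('a, 'b, 'x) module_scheme \<Rightarrow> 'a set set" where
  "associated_primes R M = {\<pp>. primeideal \<pp> R \<and> (\<exists>m\<in>carrier M. \<pp> = annihilator R M m)}"


section \<open>Injective modules, injective hulls and injective resolutions\<close>

text \<open>The definition cannot quantify over modules on all types. The modules \<open>M\<close> and \<open>N\<close> range over
  those whose carrier lives in the type of \<open>R\<close>; by Baer's criterion this is no restriction, see
  \<open>injective_module_extend\<close> below, where the types of \<open>M\<close> and \<open>N\<close> are arbitrary.\<close>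

definition injective_module :: "('a, 'k) ring_scheme \<Rightarrow> ('a, 'b, 'x) module_scheme \<Rightarrow> bool" where
  "injective_module R E \<longleftrightarrow> module R E \<and>
     (\<forall>(M :: ('a, 'a) module) (N :: ('a, 'a) module) f g.
        module R M \<longrightarrow> module R N \<longrightarrow>
        f \<in> module_homs R M N \<longrightarrow> inj_on f (carrier M) \<longrightarrow> g \<in> module_homs R M E \<longrightarrow>
          (\<exists>h\<in>module_homs R N E. \<forall>x\<in>carrier M. h (f x) = g x))"

lemma module_regular_submodule:
  assumes "cring R" "ideal A R"
  shows "module R ((regular_module R)\<lparr>carrier := A\<rparr>)"
proof -
  interpret cring R by fact
  interpret A: ideal A R by fact
  show ?thesis
  proof (rule moduleI)
    show "abelian_group ((regular_module R)\<lparr>carrier := A\<rparr>)"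
    proof (rule abelian_groupI)
      fix x assume x: "x \<in> carrier ((regular_module R)\<lparr>carrier := A\<rparr>)"
      have "\<ominus>\<^bsub>R\<^esub> x \<in> A" using x by (simp add: A.a_inv_closed)
      moreover have "\<ominus>\<^bsub>R\<^esub> x \<oplus>\<^bsub>R\<^esub> x = \<zero>\<^bsub>R\<^esub>" using x A.a_Hcarr by (simp add: l_neg)
      ultimately show "\<exists>y\<in>carrier ((regular_module R)\<lparr>carrier := A\<rparr>).
          y \<oplus>\<^bsub>(regular_module R)\<lparr>carrier := A\<rparr>\<^esub> x = \<zero>\<^bsub>(regular_module R)\<lparr>carrier := A\<rparr>\<^esub>"
        by (auto simp: regular_module_def)
    qed (auto simp: regular_module_def a_ac A.a_Hcarr)
  qed (auto simp: regular_module_def A.I_l_closed A.a_Hcarr l_distr r_distr m_assoc assms)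
qed

lemma module_homsD:
  assumes "f \<in> module_homs R M N"
  shows "x \<in> carrier M \<Longrightarrow> f x \<in> carrier N"
    and "x \<in> carrier M \<Longrightarrow> y \<in> carrier M \<Longrightarrow> f (x \<oplus>\<^bsub>M\<^esub> y) = f x \<oplus>\<^bsub>N\<^esub> f y"
    and "r \<in> carrier R \<Longrightarrow> x \<in> carrier M \<Longrightarrow> f (r \<odot>\<^bsub>M\<^esub> x) = r \<odot>\<^bsub>N\<^esub> f x"
  using assms by (auto simp: module_homs_def hom_def)

lemma module_homsI:
  assumes "\<And>x. x \<in> carrier M \<Longrightarrow> f x \<in> carrier N"
    and "\<And>x y. x \<in> carrier M \<Longrightarrow> y \<in> carrier M \<Longrightarrow> f (x \<oplus>\<^bsub>M\<^esub> y) = f x \<oplus>\<^bsub>N\<^esub> f y"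
    and "\<And>r x. r \<in> carrier R \<Longrightarrow> x \<in> carrier M \<Longrightarrow> f (r \<odot>\<^bsub>M\<^esub> x) = r \<odot>\<^bsub>N\<^esub> f x"
  shows "f \<in> module_homs R M N"
  using assms by (auto simp: module_homs_def hom_def)

theorem injective_module_extend:
  fixes M :: "('a, 'm, 'x) module_scheme" and N :: "('a, 'n, 'y) module_scheme"
  assumes inj: "injective_module R E" and M: "module R M" and N: "module R N"
    and f: "f \<in> module_homs R M N" "inj_on f (carrier M)" and g: "g \<in> module_homs R M E"
  shows "\<exists>h\<in>module_homs R N E. \<forall>x\<in>carrier M. h (f x) = g x"
proof -
  have E: "module R E" using inj by (simp add: injective_module_def)
  interpret M: module R M by fact
  interpret N: module R N by fact
  interpret E: module R E by fact
  note fD = module_homsD[OF f(1)] and gD = module_homsD[OF g]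
  define P where "P G \<longleftrightarrow> G \<subseteq> carrier N \<times> carrier E \<and> (\<lambda>x. (f x, g x)) ` carrier M \<subseteq> G
      \<and> (\<forall>u v u' v'. (u, v) \<in> G \<longrightarrow> (u', v') \<in> G \<longrightarrow> (u \<oplus>\<^bsub>N\<^esub> u', v \<oplus>\<^bsub>E\<^esub> v') \<in> G)
      \<and> (\<forall>r u v. r \<in> carrier R \<longrightarrow> (u, v) \<in> G \<longrightarrow> (r \<odot>\<^bsub>N\<^esub> u, r \<odot>\<^bsub>E\<^esub> v) \<in> G)
      \<and> (\<forall>v. (\<zero>\<^bsub>N\<^esub>, v) \<in> G \<longrightarrow> v = \<zero>\<^bsub>E\<^esub>)" for G
  have f0: "f \<zero>\<^bsub>M\<^esub> = \<zero>\<^bsub>N\<^esub>"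
    using fD(3)[of "\<zero>\<^bsub>R\<^esub>" "\<zero>\<^bsub>M\<^esub>"] fD(1) by simp
  have g0: "g \<zero>\<^bsub>M\<^esub> = \<zero>\<^bsub>E\<^esub>"
    using gD(3)[of "\<zero>\<^bsub>R\<^esub>" "\<zero>\<^bsub>M\<^esub>"] gD(1) by simp
  define G0 where "G0 = (\<lambda>x. (f x, g x)) ` carrier M"
  have P0: "P G0"
    unfolding P_def
  proof (intro conjI allI impI)
    fix u v u' v' assume "(u, v) \<in> G0" "(u', v') \<in> G0"
    then obtain x y where "x \<in> carrier M" "u = f x" "v = g x" "y \<in> carrier M" "u' = f y" "v' = g y"
      by (auto simp: G0_def)
    then show "(u \<oplus>\<^bsub>N\<^esub> u', v \<oplus>\<^bsub>E\<^esub> v') \<in> G0"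
      unfolding G0_def by (intro image_eqI[of _ _ "x \<oplus>\<^bsub>M\<^esub> y"]) (auto simp: fD gD)
  next
    fix r u v assume "r \<in> carrier R" "(u, v) \<in> G0"
    then obtain x where "x \<in> carrier M" "u = f x" "v = g x" by (auto simp: G0_def)
    then show "(r \<odot>\<^bsub>N\<^esub> u, r \<odot>\<^bsub>E\<^esub> v) \<in> G0"
      unfolding G0_def using \<open>r \<in> carrier R\<close>
      by (intro image_eqI[of _ _ "r \<odot>\<^bsub>M\<^esub> x"]) (auto simp: fD gD)
  next
    fix v assume "(\<zero>\<^bsub>N\<^esub>, v) \<in> G0"
    then obtain x where x: "x \<in> carrier M" "f x = \<zero>\<^bsub>N\<^esub>" "v = g x" by (auto simp: G0_def)
    then have "x = \<zero>\<^bsub>M\<^esub>" using inj_onD[OF f(2), of x "\<zero>\<^bsub>M\<^esub>"] f0 by simp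
    then show "v = \<zero>\<^bsub>E\<^esub>" using x g0 by simp
  qed (auto simp: G0_def fD gD)
  have "\<exists>G\<in>Collect P. \<forall>H\<in>Collect P. G \<subseteq> H \<longrightarrow> H = G"
  proof (rule subset_Zorn_nonempty)
    show "Collect P \<noteq> {}" using P0 by blast
  next
    fix \<C> assume ne: "\<C> \<noteq> {}" and "subset.chain (Collect P) \<C>"
    then have C: "\<And>H. H \<in> \<C> \<Longrightarrow> P H" and ch: "\<And>H K. H \<in> \<C> \<Longrightarrow> K \<in> \<C> \<Longrightarrow> H \<subseteq> K \<or> K \<subseteq> H"
      by (auto simp: subset_chain_def)
    have "P (\<Union>\<C>)"
      unfolding P_def
    proof (intro conjI allI impI)
      fix u v u' v' assume "(u, v) \<in> \<Union>\<C>" "(u', v') \<in> \<Union>\<C>"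
      then obtain H where "H \<in> \<C>" "(u, v) \<in> H" "(u', v') \<in> H" using ch by blast
      then show "(u \<oplus>\<^bsub>N\<^esub> u', v \<oplus>\<^bsub>E\<^esub> v') \<in> \<Union>\<C>" using C[of H] unfolding P_def by blast
    next
      show "\<Union>\<C> \<subseteq> carrier N \<times> carrier E" using C unfolding P_def by blast
      show "(\<lambda>x. (f x, g x)) ` carrier M \<subseteq> \<Union>\<C>" using C ne unfolding P_def by blast
    next
      fix r u v assume "r \<in> carrier R" "(u, v) \<in> \<Union>\<C>"
      then show "(r \<odot>\<^bsub>N\<^esub> u, r \<odot>\<^bsub>E\<^esub> v) \<in> \<Union>\<C>" using C unfolding P_def by blast
    next
      fix v assume "(\<zero>\<^bsub>N\<^esub>, v) \<in> \<Union>\<C>"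
      then show "v = \<zero>\<^bsub>E\<^esub>" using C unfolding P_def by blast
    qed
    then show "\<Union>\<C> \<in> Collect P" by simp
  qed
  then obtain G where PG: "P G" and max: "\<And>H. P H \<Longrightarrow> G \<subseteq> H \<Longrightarrow> H = G" by blast
  have Gc: "u \<in> carrier N" "v \<in> carrier E" if "(u, v) \<in> G" for u v
    using PG that unfolding P_def by blast+
  have Gadd: "(u \<oplus>\<^bsub>N\<^esub> u', v \<oplus>\<^bsub>E\<^esub> v') \<in> G" if "(u, v) \<in> G" "(u', v') \<in> G" for u v u' v'
    using PG that unfolding P_def by blast
  have Gsm: "(r \<odot>\<^bsub>N\<^esub> u, r \<odot>\<^bsub>E\<^esub> v) \<in> G" if "r \<in> carrier R" "(u, v) \<in> G" for r u v
    using PG that unfolding P_def by blast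
  have Gf: "(f x, g x) \<in> G" if "x \<in> carrier M" for x
    using PG that unfolding P_def by blast
  have G0: "v = \<zero>\<^bsub>E\<^esub>" if "(\<zero>\<^bsub>N\<^esub>, v) \<in> G" for v
    using PG that unfolding P_def by blast
  have Gz: "(\<zero>\<^bsub>N\<^esub>, \<zero>\<^bsub>E\<^esub>) \<in> G" using Gf[of "\<zero>\<^bsub>M\<^esub>"] f0 g0 by simp
  have Gneg: "(\<ominus>\<^bsub>N\<^esub> u, \<ominus>\<^bsub>E\<^esub> v) \<in> G" if "(u, v) \<in> G" for u v
    using Gsm[of "\<ominus>\<^bsub>R\<^esub> \<one>\<^bsub>R\<^esub>", OF _ that] Gc[OF that]
    by (simp add: N.smult_l_minus E.smult_l_minus)
  have Guniq: "v = v'" if "(u, v) \<in> G" "(u, v') \<in> G" for u v v'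
  proof -
    have "(u \<oplus>\<^bsub>N\<^esub> \<ominus>\<^bsub>N\<^esub> u, v \<oplus>\<^bsub>E\<^esub> \<ominus>\<^bsub>E\<^esub> v') \<in> G" using that Gadd Gneg by blast
    then have "v \<oplus>\<^bsub>E\<^esub> \<ominus>\<^bsub>E\<^esub> v' = \<zero>\<^bsub>E\<^esub>" using Gc that G0 by (simp add: N.r_neg)
    then show ?thesis using Gc that
      by (metis E.M.a_inv_closed E.M.minus_equality E.M.minus_minus)
  qed
  have total: "\<exists>v. (b, v) \<in> G" if b: "b \<in> carrier N" for b
  proof -
    define A where "A = {r \<in> carrier R. \<exists>v. (r \<odot>\<^bsub>N\<^esub> b, v) \<in> G}"
    define \<phi> where "\<phi> r = (THE v. (r \<odot>\<^bsub>N\<^esub> b, v) \<in> G)" for r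
    have \<phi>I: "\<phi> r = v" if "(r \<odot>\<^bsub>N\<^esub> b, v) \<in> G" for r v
      unfolding \<phi>_def using that Guniq by blast
    have \<phi>G: "(r \<odot>\<^bsub>N\<^esub> b, \<phi> r) \<in> G" if "r \<in> A" for r
      using that \<phi>I unfolding A_def by auto
    have Aadd: "r \<oplus>\<^bsub>R\<^esub> s \<in> A \<and> \<phi> (r \<oplus>\<^bsub>R\<^esub> s) = \<phi> r \<oplus>\<^bsub>E\<^esub> \<phi> s" if "r \<in> A" "s \<in> A" for r s
    proof -
      have rs: "r \<in> carrier R" "s \<in> carrier R" using that by (auto simp: A_def)
      have "((r \<oplus>\<^bsub>R\<^esub> s) \<odot>\<^bsub>N\<^esub> b, \<phi> r \<oplus>\<^bsub>E\<^esub> \<phi> s) \<in> G"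
        using Gadd[OF \<phi>G[OF that(1)] \<phi>G[OF that(2)]] rs b by (simp add: N.smult_l_distr)
      then show ?thesis using rs \<phi>I by (auto simp: A_def)
    qed
    have Asm: "r \<otimes>\<^bsub>R\<^esub> s \<in> A \<and> \<phi> (r \<otimes>\<^bsub>R\<^esub> s) = r \<odot>\<^bsub>E\<^esub> \<phi> s" if "r \<in> carrier R" "s \<in> A" for r s
    proof -
      have s: "s \<in> carrier R" using that by (auto simp: A_def)
      have "((r \<otimes>\<^bsub>R\<^esub> s) \<odot>\<^bsub>N\<^esub> b, r \<odot>\<^bsub>E\<^esub> \<phi> s) \<in> G"
        using Gsm[OF that(1) \<phi>G[OF that(2)]] that s b by (simp add: N.smult_assoc1)
      then show ?thesis using s that \<phi>I by (auto simp: A_def)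
    qed
    have A0: "\<zero>\<^bsub>R\<^esub> \<in> A" using Gz b by (auto simp: A_def)
    have Aneg: "\<ominus>\<^bsub>R\<^esub> s \<in> A" if "s \<in> A" for s
    proof -
      have "\<ominus>\<^bsub>R\<^esub> s = \<ominus>\<^bsub>R\<^esub> \<one>\<^bsub>R\<^esub> \<otimes>\<^bsub>R\<^esub> s" using that by (simp add: A_def M.R.l_minus)
      then show ?thesis using Asm[OF _ that, of "\<ominus>\<^bsub>R\<^esub> \<one>\<^bsub>R\<^esub>"] by simp
    qed
    have "ideal A R"
    proof (rule idealI)
      show "ring R" by (rule M.R.ring_axioms)
      show "subgroup A (add_monoid R)"
        using Aadd A0 Aneg unfolding subgroup_def by (auto simp: A_def a_inv_def)
      show "r \<otimes>\<^bsub>R\<^esub> s \<in> A" if "s \<in> A" "r \<in> carrier R" for s r using Asm that by blast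
      show "s \<otimes>\<^bsub>R\<^esub> r \<in> A" if "s \<in> A" "r \<in> carrier R" for s r
        using Asm[of r s] that M.R.m_comm[of r s] by (auto simp: A_def)
    qed
    let ?A = "(regular_module R)\<lparr>carrier := A\<rparr>"
    have mA: "module R ?A"
      by (rule module_regular_submodule[OF M.R.is_cring \<open>ideal A R\<close>])
    have "ideal (carrier R) R" by (rule M.R.oneideal)
    then have mR: "module R (regular_module R)"
      using module_regular_submodule[OF M.R.is_cring, of "carrier R"] by (simp add: regular_module_def)
    have i: "(\<lambda>x. x) \<in> module_homs R ?A (regular_module R)"
      by (rule module_homsI) (auto simp: regular_module_def A_def)
    have \<phi>: "\<phi> \<in> module_homs R ?A E"
      by (rule module_homsI) (use Aadd Asm Gc(2)[OF \<phi>G] in \<open>auto simp: regular_module_def\<close>)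
    have "\<exists>h\<in>module_homs R (regular_module R) E. \<forall>x\<in>carrier ?A. h x = \<phi> x"
      using inj mA mR i \<phi> unfolding injective_module_def by (auto simp: inj_on_def)
    then obtain h where h: "h \<in> module_homs R (regular_module R) E" and hA: "\<And>r. r \<in> A \<Longrightarrow> h r = \<phi> r"
      by auto
    define e where "e = h \<one>\<^bsub>R\<^esub>"
    have e: "e \<in> carrier E" using module_homsD(1)[OF h, of "\<one>\<^bsub>R\<^esub>"] by (simp add: e_def regular_module_def)
    have hr: "h r = r \<odot>\<^bsub>E\<^esub> e" if "r \<in> carrier R" for r
      using module_homsD(3)[OF h that, of "\<one>\<^bsub>R\<^esub>"] that by (simp add: e_def regular_module_def)
    define G' where "G' = {(u \<oplus>\<^bsub>N\<^esub> r \<odot>\<^bsub>N\<^esub> b, v \<oplus>\<^bsub>E\<^esub> r \<odot>\<^bsub>E\<^esub> e) | u v r. (u, v) \<in> G \<and> r \<in> carrier R}"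
    have G'I: "(u \<oplus>\<^bsub>N\<^esub> r \<odot>\<^bsub>N\<^esub> b, v \<oplus>\<^bsub>E\<^esub> r \<odot>\<^bsub>E\<^esub> e) \<in> G'" if "(u, v) \<in> G" "r \<in> carrier R" for u v r
      using that unfolding G'_def by blast
    have GG': "G \<subseteq> G'"
    proof clarify
      fix u v assume uv: "(u, v) \<in> G"
      show "(u, v) \<in> G'" using G'I[OF uv, of "\<zero>\<^bsub>R\<^esub>"] Gc[OF uv] b e by simp
    qed
    have "P G'"
      unfolding P_def
    proof (intro conjI allI impI)
      show "G' \<subseteq> carrier N \<times> carrier E" using Gc b e unfolding G'_def by auto
      show "(\<lambda>x. (f x, g x)) ` carrier M \<subseteq> G'" using Gf GG' by auto
    next
      fix u v u' v' assume "(u, v) \<in> G'" "(u', v') \<in> G'"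
      then obtain p q r p' q' r' where
        1: "(p, q) \<in> G" "r \<in> carrier R" "(p', q') \<in> G" "r' \<in> carrier R" and
        2: "u = p \<oplus>\<^bsub>N\<^esub> r \<odot>\<^bsub>N\<^esub> b" "v = q \<oplus>\<^bsub>E\<^esub> r \<odot>\<^bsub>E\<^esub> e"
           "u' = p' \<oplus>\<^bsub>N\<^esub> r' \<odot>\<^bsub>N\<^esub> b" "v' = q' \<oplus>\<^bsub>E\<^esub> r' \<odot>\<^bsub>E\<^esub> e"
        unfolding G'_def by blast
      have "u \<oplus>\<^bsub>N\<^esub> u' = (p \<oplus>\<^bsub>N\<^esub> p') \<oplus>\<^bsub>N\<^esub> (r \<oplus>\<^bsub>R\<^esub> r') \<odot>\<^bsub>N\<^esub> b"
        using 1 Gc b unfolding 2 by (simp add: N.smult_l_distr N.M.a_ac)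
      moreover have "v \<oplus>\<^bsub>E\<^esub> v' = (q \<oplus>\<^bsub>E\<^esub> q') \<oplus>\<^bsub>E\<^esub> (r \<oplus>\<^bsub>R\<^esub> r') \<odot>\<^bsub>E\<^esub> e"
        using 1 Gc e unfolding 2 by (simp add: E.smult_l_distr E.M.a_ac)
      ultimately show "(u \<oplus>\<^bsub>N\<^esub> u', v \<oplus>\<^bsub>E\<^esub> v') \<in> G'"
        using G'I[OF Gadd[OF 1(1,3)], of "r \<oplus>\<^bsub>R\<^esub> r'"] 1 by simp
    next
      fix s u v assume s: "s \<in> carrier R" and "(u, v) \<in> G'"
      then obtain p q r where 1: "(p, q) \<in> G" "r \<in> carrier R" and
        2: "u = p \<oplus>\<^bsub>N\<^esub> r \<odot>\<^bsub>N\<^esub> b" "v = q \<oplus>\<^bsub>E\<^esub> r \<odot>\<^bsub>E\<^esub> e"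
        unfolding G'_def by blast
      have "s \<odot>\<^bsub>N\<^esub> u = s \<odot>\<^bsub>N\<^esub> p \<oplus>\<^bsub>N\<^esub> (s \<otimes>\<^bsub>R\<^esub> r) \<odot>\<^bsub>N\<^esub> b"
        using 1 s Gc b unfolding 2 by (simp add: N.smult_r_distr N.smult_assoc1)
      moreover have "s \<odot>\<^bsub>E\<^esub> v = s \<odot>\<^bsub>E\<^esub> q \<oplus>\<^bsub>E\<^esub> (s \<otimes>\<^bsub>R\<^esub> r) \<odot>\<^bsub>E\<^esub> e"
        using 1 s Gc e unfolding 2 by (simp add: E.smult_r_distr E.smult_assoc1)
      ultimately show "(s \<odot>\<^bsub>N\<^esub> u, s \<odot>\<^bsub>E\<^esub> v) \<in> G'"
        using G'I[OF Gsm[OF s 1(1)], of "s \<otimes>\<^bsub>R\<^esub> r"] 1 s by simp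
    next
      fix w assume "(\<zero>\<^bsub>N\<^esub>, w) \<in> G'"
      then obtain u v r where 1: "(u, v) \<in> G" "r \<in> carrier R" and
        z: "u \<oplus>\<^bsub>N\<^esub> r \<odot>\<^bsub>N\<^esub> b = \<zero>\<^bsub>N\<^esub>" and w: "w = v \<oplus>\<^bsub>E\<^esub> r \<odot>\<^bsub>E\<^esub> e"
        unfolding G'_def by auto
      have u: "u \<in> carrier N" and v: "v \<in> carrier E" using Gc 1 by auto
      have "r \<odot>\<^bsub>N\<^esub> b = \<ominus>\<^bsub>N\<^esub> u"
        using z u b 1 by (metis N.M.a_comm N.M.minus_equality N.smult_closed)
      then have *: "(r \<odot>\<^bsub>N\<^esub> b, \<ominus>\<^bsub>E\<^esub> v) \<in> G" using Gneg[OF 1(1)] by simp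
      then have "r \<in> A" "\<phi> r = \<ominus>\<^bsub>E\<^esub> v" using 1 \<phi>I by (auto simp: A_def)
      then have "r \<odot>\<^bsub>E\<^esub> e = \<ominus>\<^bsub>E\<^esub> v" using hA hr 1 by metis
      then show "w = \<zero>\<^bsub>E\<^esub>" using w v by (simp add: E.M.r_neg)
    qed
    then have "G' = G" using max GG' by blast
    moreover have "(b, e) \<in> G'" using G'I[OF Gz, of "\<one>\<^bsub>R\<^esub>"] b e by simp
    ultimately show ?thesis by blast
  qed
  define h where "h b = (THE v. (b, v) \<in> G)" for b
  have hI: "h b = v" if "(b, v) \<in> G" for b v
    unfolding h_def using that Guniq by blast
  have hG: "(b, h b) \<in> G" if "b \<in> carrier N" for b
    using total[OF that] hI by auto
  have "h \<in> module_homs R N E"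
  proof (rule module_homsI)
    fix x y assume "x \<in> carrier N" "y \<in> carrier N"
    then show "h (x \<oplus>\<^bsub>N\<^esub> y) = h x \<oplus>\<^bsub>E\<^esub> h y" by (intro hI Gadd hG)
  next
    fix r x assume "r \<in> carrier R" "x \<in> carrier N"
    then show "h (r \<odot>\<^bsub>N\<^esub> x) = r \<odot>\<^bsub>E\<^esub> h x" by (intro hI Gsm hG)
  next
    fix x assume "x \<in> carrier N"
    then show "h x \<in> carrier E" using hG Gc by blast
  qed
  moreover have "h (f x) = g x" if "x \<in> carrier M" for x using hI Gf that by blast
  ultimately show ?thesis by blast
qed

definition injective_hull ::
  "('a, 'k) ring_scheme \<Rightarrow> ('a, 'b, 'x) module_scheme \<Rightarrow> ('b \<Rightarrow> 'c) \<Rightarrow> ('a, 'c, 'y) module_scheme \<Rightarrow> bool" where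
  "injective_hull R M \<iota> E \<longleftrightarrow>
     injective_module R E \<and> \<iota> \<in> module_homs R M E \<and> inj_on \<iota> (carrier M) \<and>
     (\<forall>U. submodule U R E \<longrightarrow> U \<inter> \<iota> ` carrier M = {\<zero>\<^bsub>E\<^esub>} \<longrightarrow> U = {\<zero>\<^bsub>E\<^esub>})"

definition injective_resolution ::
  "('a, 'k) ring_scheme \<Rightarrow> ('a, 'b, 'x) module_scheme \<Rightarrow> ('b \<Rightarrow> 'c)
     \<Rightarrow> (nat \<Rightarrow> ('a, 'c, 'y) module_scheme) \<Rightarrow> (nat \<Rightarrow> 'c \<Rightarrow> 'c) \<Rightarrow> bool" where
  "injective_resolution R M \<epsilon> Q d \<longleftrightarrow>
     (\<forall>i. injective_module R (Q i)) \<and>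
     \<epsilon> \<in> module_homs R M (Q 0) \<and> (\<forall>i. d i \<in> module_homs R (Q i) (Q (Suc i))) \<and>
     inj_on \<epsilon> (carrier M) \<and>
     {x \<in> carrier (Q 0). d 0 x = \<zero>\<^bsub>Q 1\<^esub>} = \<epsilon> ` carrier M \<and>
     (\<forall>i. {x \<in> carrier (Q (Suc i)). d (Suc i) x = \<zero>\<^bsub>Q (Suc (Suc i))\<^esub>} = d i ` carrier (Q i))"


section \<open>Local cohomology and Matlis duality\<close>

text \<open>The \<open>I\<close>-torsion functor \<open>\<Gamma>\<^sub>I\<close>; the power is taken in the monoid of ideals of \<open>R\<close>.\<close>

definition torsion_part ::
  "('a, 'k) ring_scheme \<Rightarrow> 'a set \<Rightarrow> ('a, 'b, 'x) module_scheme \<Rightarrow> 'b set" where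
  "torsion_part R I M =
     {x \<in> carrier M. \<exists>n::nat. \<forall>r \<in> I [^]\<^bsub>ideals_set R\<^esub> n. r \<odot>\<^bsub>M\<^esub> x = \<zero>\<^bsub>M\<^esub>}"

text \<open>If \<open>(Q, d)\<close> is an injective resolution of \<open>M\<close>, this is the \<open>i\<close>-th right derived functor of
  \<open>\<Gamma>\<^sub>I\<close> at \<open>M\<close>, i.e. the \<open>i\<close>-th cohomology of the complex \<open>\<Gamma>\<^sub>I(Q)\<close>.\<close>

definition local_cohomology ::
  "('a, 'k) ring_scheme \<Rightarrow> 'a set \<Rightarrow> (nat \<Rightarrow> ('a, 'b, 'x) module_scheme) \<Rightarrow> (nat \<Rightarrow> 'b \<Rightarrow> 'b)
     \<Rightarrow> nat \<Rightarrow> ('a, 'b set) module" where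
  "local_cohomology R I Q d i =
     quotient_module
       ((Q i)\<lparr>carrier := {x \<in> torsion_part R I (Q i). d i x = \<zero>\<^bsub>Q (Suc i)\<^esub>}\<rparr>)
       (case i of 0 \<Rightarrow> {\<zero>\<^bsub>Q 0\<^esub>} | Suc j \<Rightarrow> d j ` torsion_part R I (Q j))"

definition zero_module :: "('a, 'b, 'x) module_scheme \<Rightarrow> bool" where
  "zero_module M \<longleftrightarrow> carrier M = {\<zero>\<^bsub>M\<^esub>}"

text \<open>\<open>E\<close> is meant to be an injective hull of the residue field.\<close>

abbreviation matlis_dual ::
  "('a, 'k) ring_scheme \<Rightarrow> ('a, 'c, 'y) module_scheme \<Rightarrow> ('a, 'b, 'x) module_scheme \<Rightarrow> ('a, 'b \<Rightarrow> 'c) module" where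
  "matlis_dual R E M \<equiv> hom_module R M E"

end

(* Let H be the first local cohomology module of R, D(H) its Matlis dual, and S the ideal transform
   of R with respect to I, so that H is the cokernel of R -> S.

   The vanishing hypothesis gives 1 in I S (Serre's criterion): modulo torsion, the injective
   resolution of R becomes a resolution of S, the Koszul complex of generators of I is exact on each
   term of it, and a chase through the resulting double complex shows that the Koszul complex of S
   is exact at its last term. Hence H = I H, so no nonzero element of D(H) is killed by I, i.e. I is
   contained in no associated prime of D(H). Under prime avoidance some r in I is a nonzerodivisor
   on D(H), so H = r H and S = r S + R. Together with 1 in I S, and since 1 - c is a unit for c in I,
   this gives 1 in r S, so a power of I lies in (r).

   Conversely let I and (x) have the same radical. Then x H = H, so x is a nonzerodivisor on D(H),
   and no power of x lies in an ideal J contained in the union of the associated primes of D(H).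
   Now "1/x" shows that J H is different from H, so some nonzero element of D(H) is killed by J; an
   associated prime containing its annihilator contains J. *)

theory Submission
  imports Defs
begin

section \<open>Noetherian and local rings\<close>

text \<open>Neither the ring \<open>S\<close> nor the quotients of the resolution by torsion are
  formed. The ideal transform is handled through a submodule \<open>W\<close> of \<open>Q 0\<close>,
  with identities read modulo the torsion parts \<open>T i\<close>. Products in \<open>S\<close>
  therefore exist only as a relation, and the claim that one lies in \<open>I S\<close> takes the
  form: every submodule containing \<open>T 0\<close> and all \<open>a w\<close> with
  \<open>a\<close> in \<open>I\<close>, \<open>w\<close> in \<open>W\<close> contains
  \<open>\<epsilon> \<one>\<close>. Each use of it consists in choosing such a submodule. Exactness
  of the Koszul complexes rests on one property of injective modules over a noetherian ring:
  multiplication by \<open>a\<close> is surjective up to \<open>a\<close>-power torsion. Asking also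
  that the quotient be killed by whatever kills the dividend lets this property survive in torsion
  submodules, which makes an induction over the generators possible. The passage between
  \<open>H\<close> and \<open>D(H)\<close> uses that \<open>E\<close> separates points from
  submodules: if \<open>y\<close> is not in \<open>r H\<close>, some functional kills
  \<open>r H\<close> but not \<open>y\<close>, and is itself killed by \<open>r\<close>.\<close>

lemma (in noetherian_ring) ideal_family_has_maximal:
  assumes "\<F> \<noteq> {}" "\<And>J. J \<in> \<F> \<Longrightarrow> ideal J R"
  obtains J where "J \<in> \<F>" "\<And>K. K \<in> \<F> \<Longrightarrow> J \<subseteq> K \<Longrightarrow> K = J"
proof -
  have "\<exists>J\<in>\<F>. \<forall>K\<in>\<F>. J \<subseteq> K \<longrightarrow> K = J"
  proof (rule subset_Zorn_nonempty[OF assms(1)])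
    fix C assume C: "C \<noteq> {}" "subset.chain \<F> C"
    then have "subset.chain {I. ideal I R} C"
      using assms(2) by (auto simp: subset_chain_def)
    then have "\<Union>C \<in> C" using ideal_chain_is_trivial C by blast
    then show "\<Union>C \<in> \<F>" using C by (auto simp: subset_chain_def)
  qed
  then show thesis using that by blast
qed

lemma (in noetherian_ring) ascending_ideals_stabilize:
  fixes J :: "nat \<Rightarrow> 'a set"
  assumes "\<And>n. ideal (J n) R" "\<And>n. J n \<subseteq> J (Suc n)"
  shows "\<exists>N. \<forall>n\<ge>N. J n = J N"
proof -
  obtain K where K: "K \<in> range J" "\<And>L. L \<in> range J \<Longrightarrow> K \<subseteq> L \<Longrightarrow> L = K"
    by (rule ideal_family_has_maximal[of "range J"]) (use assms in auto)
  then obtain N where N: "K = J N" by blast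
  have "J n = J N" if "n \<ge> N" for n
    using K N lift_Suc_mono_le[of J, OF assms(2) that] by blast
  then show ?thesis by blast
qed

lemma (in noetherian_ring) proper_ideal_subset_maximal:
  assumes "ideal J R" "J \<noteq> carrier R"
  obtains \<nn> where "maximalideal \<nn> R" "J \<subseteq> \<nn>"
proof -
  obtain \<nn> where n: "\<nn> \<in> {K. ideal K R \<and> J \<subseteq> K \<and> K \<noteq> carrier R}"
    and max: "\<And>K. K \<in> {K. ideal K R \<and> J \<subseteq> K \<and> K \<noteq> carrier R} \<Longrightarrow> \<nn> \<subseteq> K \<Longrightarrow> K = \<nn>"
    by (rule ideal_family_has_maximal[of "{K. ideal K R \<and> J \<subseteq> K \<and> K \<noteq> carrier R}"])
      (use assms in auto)
  have "maximalideal \<nn> R"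
  proof (rule maximalidealI)
    show "K = \<nn> \<or> K = carrier R" if "ideal K R" "\<nn> \<subseteq> K" "K \<subseteq> carrier R" for K
      using max[of K] n that by blast
  qed (use n in auto)
  then show thesis using n that by blast
qed

lemma local_ring_proper_ideal:
  assumes "noetherian_ring R" "local_ring R \<mm>" "ideal J R" "J \<noteq> carrier R"
  shows "J \<subseteq> \<mm>"
proof -
  interpret noetherian_ring R by fact
  show ?thesis
    using proper_ideal_subset_maximal[OF assms(3,4)] assms(2) by (metis local_ring_def)
qed

lemma local_ring_Units:
  assumes "noetherian_ring R" "local_ring R \<mm>" "a \<in> carrier R" "a \<notin> \<mm>"
  shows "a \<in> Units R"
proof -
  interpret cring R using assms by (simp add: local_ring_def)
  have "PIdl\<^bsub>R\<^esub> a = carrier R"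
    using local_ring_proper_ideal[OF assms(1,2) cgenideal_ideal[OF assms(3)]]
      cgenideal_self[OF assms(3)] assms(4) by blast
  then have "\<one>\<^bsub>R\<^esub> \<in> PIdl\<^bsub>R\<^esub> a" by simp
  then obtain b where "b \<in> carrier R" "\<one>\<^bsub>R\<^esub> = b \<otimes>\<^bsub>R\<^esub> a" by (auto simp: cgenideal_def)
  then show ?thesis using assms(3) by (auto simp: Units_def intro!: bexI[of _ b] simp: m_comm)
qed

section \<open>Modules, torsion and homomorphisms\<close>

lemma (in abelian_group) diff_eq_zero_iff [simp]:
  assumes "x \<in> carrier G" "y \<in> carrier G"
  shows "x \<ominus> y = \<zero> \<longleftrightarrow> x = y"
proof
  assume "x \<ominus> y = \<zero>"
  then have "(x \<ominus> y) \<oplus> y = y" using assms by simp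
  then show "x = y" using assms by (simp add: a_minus_def a_assoc l_neg)
qed (use assms in \<open>simp add: a_minus_def r_neg\<close>)

context module
begin

lemma smult_r_diff:
  "\<lbrakk>a \<in> carrier R; x \<in> carrier M; y \<in> carrier M\<rbrakk> \<Longrightarrow> a \<odot>\<^bsub>M\<^esub> (x \<ominus>\<^bsub>M\<^esub> y) = a \<odot>\<^bsub>M\<^esub> x \<ominus>\<^bsub>M\<^esub> a \<odot>\<^bsub>M\<^esub> y"
  by (simp add: a_minus_def smult_r_distr smult_r_minus)

lemma smult_l_diff:
  "\<lbrakk>a \<in> carrier R; b \<in> carrier R; x \<in> carrier M\<rbrakk> \<Longrightarrow> (a \<ominus> b) \<odot>\<^bsub>M\<^esub> x = a \<odot>\<^bsub>M\<^esub> x \<ominus>\<^bsub>M\<^esub> b \<odot>\<^bsub>M\<^esub> x"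
  by (simp add: a_minus_def smult_l_distr smult_l_minus)

lemma smult_left_commute:
  "\<lbrakk>a \<in> carrier R; b \<in> carrier R; x \<in> carrier M\<rbrakk> \<Longrightarrow> a \<odot>\<^bsub>M\<^esub> (b \<odot>\<^bsub>M\<^esub> x) = b \<odot>\<^bsub>M\<^esub> (a \<odot>\<^bsub>M\<^esub> x)"
  using m_comm smult_assoc1 by metis

lemma pow_smult_mono:
  assumes "a \<in> carrier R" "x \<in> carrier M" "a [^] (k::nat) \<odot>\<^bsub>M\<^esub> x = \<zero>\<^bsub>M\<^esub>" "k \<le> n"
  shows "a [^] n \<odot>\<^bsub>M\<^esub> x = \<zero>\<^bsub>M\<^esub>"
proof -
  have "a [^] n = a [^] (n - k) \<otimes> a [^] k" using assms by (simp add: nat_pow_mult)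
  then show ?thesis using assms by (simp add: smult_assoc1)
qed

text \<open>Splitting off one factor \<open>a + b\<close> replaces \<open>x\<close> by
  \<open>a x\<close> and \<open>b x\<close>, each of which lowers one of the two exponents; no
  binomial expansion is needed.\<close>

lemma pow_add_smult_eq_zero:
  assumes ab: "a \<in> carrier R" "b \<in> carrier R"
  shows "x \<in> carrier M \<Longrightarrow> a [^] (k::nat) \<odot>\<^bsub>M\<^esub> x = \<zero>\<^bsub>M\<^esub> \<Longrightarrow> b [^] (l::nat) \<odot>\<^bsub>M\<^esub> x = \<zero>\<^bsub>M\<^esub> \<Longrightarrow>
    (a \<oplus> b) [^] (k + l) \<odot>\<^bsub>M\<^esub> x = \<zero>\<^bsub>M\<^esub>"
proof (induction "k + l" arbitrary: k l x)
  case 0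
  then show ?case by simp
next
  case (Suc n)
  show ?case
  proof (cases "k = 0 \<or> l = 0")
    case True
    then have "x = \<zero>\<^bsub>M\<^esub>" using Suc.prems by auto
    then show ?thesis using ab by simp
  next
    case False
    then obtain k' l' where kl: "k = Suc k'" "l = Suc l'" by (metis not0_implies_Suc)
    have ax: "(a \<oplus> b) [^] n \<odot>\<^bsub>M\<^esub> (a \<odot>\<^bsub>M\<^esub> x) = \<zero>\<^bsub>M\<^esub>"
    proof -
      have "a [^] k' \<odot>\<^bsub>M\<^esub> (a \<odot>\<^bsub>M\<^esub> x) = \<zero>\<^bsub>M\<^esub>"
        using Suc.prems ab kl by (simp add: smult_assoc1[symmetric])
      moreover have "b [^] l \<odot>\<^bsub>M\<^esub> (a \<odot>\<^bsub>M\<^esub> x) = \<zero>\<^bsub>M\<^esub>"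
        using Suc.prems ab by (subst smult_left_commute) auto
      moreover have "n = k' + l" using Suc.hyps(2) kl by simp
      ultimately show ?thesis
        using Suc.hyps(1)[of k' l "a \<odot>\<^bsub>M\<^esub> x"] Suc.prems(1) ab by simp
    qed
    have bx: "(a \<oplus> b) [^] n \<odot>\<^bsub>M\<^esub> (b \<odot>\<^bsub>M\<^esub> x) = \<zero>\<^bsub>M\<^esub>"
    proof -
      have "b [^] l' \<odot>\<^bsub>M\<^esub> (b \<odot>\<^bsub>M\<^esub> x) = \<zero>\<^bsub>M\<^esub>"
        using Suc.prems ab kl by (simp add: smult_assoc1[symmetric])
      moreover have "a [^] k \<odot>\<^bsub>M\<^esub> (b \<odot>\<^bsub>M\<^esub> x) = \<zero>\<^bsub>M\<^esub>"
        using Suc.prems ab by (subst smult_left_commute) auto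
      moreover have "n = k + l'" using Suc.hyps(2) kl by simp
      ultimately show ?thesis
        using Suc.hyps(1)[of k l' "b \<odot>\<^bsub>M\<^esub> x"] Suc.prems(1) ab by simp
    qed
    have "(a \<oplus> b) [^] (k + l) \<odot>\<^bsub>M\<^esub> x = (a \<oplus> b) [^] n \<odot>\<^bsub>M\<^esub> (a \<odot>\<^bsub>M\<^esub> x \<oplus>\<^bsub>M\<^esub> b \<odot>\<^bsub>M\<^esub> x)"
      using Suc.prems(1) ab Suc.hyps(2)[symmetric] by (simp add: smult_assoc1 smult_l_distr)
    then show ?thesis using ax bx Suc.prems(1) ab by (simp add: smult_r_distr)
  qed
qed

lemma submodule_zero: "submodule N R M \<Longrightarrow> \<zero>\<^bsub>M\<^esub> \<in> N"
  by (metis submodule_def subgroup.one_closed monoid.simps(2) ring.simps(1))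

lemma submodule_diff: "submodule N R M \<Longrightarrow> x \<in> N \<Longrightarrow> y \<in> N \<Longrightarrow> x \<ominus>\<^bsub>M\<^esub> y \<in> N"
  by (simp add: a_minus_def submoduleE)

lemma submodule_restrict:
  assumes "submodule N R M"
  shows "module R (M\<lparr>carrier := N\<rparr>)"
  using assms module_axioms by (rule submodule.submodule_is_module)

end

text \<open>The exponent may depend on \<open>a\<close>, so that torsion can be tested on generators
  (\<open>tors_genideal\<close>) and split one element at a time (\<open>tors_insert\<close>). Over
  a noetherian ring and for an ideal \<open>A\<close> this is the torsion functor, see
  \<open>torsion_part_eq_tors\<close>.\<close>

definition tors :: "('a, 'k) ring_scheme \<Rightarrow> 'a set \<Rightarrow> ('a, 'b, 'x) module_scheme \<Rightarrow> 'b set" where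
  "tors R A M = {x \<in> carrier M. \<forall>a\<in>A. \<exists>n::nat. a [^]\<^bsub>R\<^esub> n \<odot>\<^bsub>M\<^esub> x = \<zero>\<^bsub>M\<^esub>}"

context module
begin

lemma tors_submodule:
  assumes A: "A \<subseteq> carrier R"
  shows "submodule (tors R A M) R M"
proof (rule submoduleI)
  show "tors R A M \<subseteq> carrier M" by (auto simp: tors_def)
  show "\<zero>\<^bsub>M\<^esub> \<in> tors R A M" using A by (auto simp: tors_def)
  show "\<ominus>\<^bsub>M\<^esub> x \<in> tors R A M" if x: "x \<in> tors R A M" for x
    unfolding tors_def
  proof (intro CollectI conjI ballI)
    show "\<ominus>\<^bsub>M\<^esub> x \<in> carrier M" using x by (simp add: tors_def)
    fix a assume a: "a \<in> A"
    then obtain n :: nat where "a [^] n \<odot>\<^bsub>M\<^esub> x = \<zero>\<^bsub>M\<^esub>" using x by (auto simp: tors_def)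
    then have "a [^] n \<odot>\<^bsub>M\<^esub> (\<ominus>\<^bsub>M\<^esub> x) = \<zero>\<^bsub>M\<^esub>"
      using x A a by (subst smult_r_minus) (auto simp: tors_def)
    then show "\<exists>n::nat. a [^] n \<odot>\<^bsub>M\<^esub> (\<ominus>\<^bsub>M\<^esub> x) = \<zero>\<^bsub>M\<^esub>" ..
  qed
next
  fix x y assume x: "x \<in> tors R A M" and y: "y \<in> tors R A M"
  show "x \<oplus>\<^bsub>M\<^esub> y \<in> tors R A M"
    unfolding tors_def
  proof (intro CollectI conjI ballI)
    show "x \<oplus>\<^bsub>M\<^esub> y \<in> carrier M" using x y by (simp add: tors_def)
    fix a assume a: "a \<in> A"
    then obtain n k :: nat where *: "a [^] n \<odot>\<^bsub>M\<^esub> x = \<zero>\<^bsub>M\<^esub>" "a [^] k \<odot>\<^bsub>M\<^esub> y = \<zero>\<^bsub>M\<^esub>"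
      using x y unfolding tors_def by blast
    have c: "x \<in> carrier M" "y \<in> carrier M" "a \<in> carrier R" using x y a A by (auto simp: tors_def)
    have "a [^] (n + k) \<odot>\<^bsub>M\<^esub> (x \<oplus>\<^bsub>M\<^esub> y) = \<zero>\<^bsub>M\<^esub>"
      using c pow_smult_mono[OF c(3,1) *(1), of "n + k"] pow_smult_mono[OF c(3,2) *(2), of "n + k"]
      by (simp add: smult_r_distr)
    then show "\<exists>n::nat. a [^] n \<odot>\<^bsub>M\<^esub> (x \<oplus>\<^bsub>M\<^esub> y) = \<zero>\<^bsub>M\<^esub>" ..
  qed
next
  fix r x assume r: "r \<in> carrier R" and x: "x \<in> tors R A M"
  show "r \<odot>\<^bsub>M\<^esub> x \<in> tors R A M"
    unfolding tors_def
  proof (intro CollectI conjI ballI)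
    show "r \<odot>\<^bsub>M\<^esub> x \<in> carrier M" using r x by (simp add: tors_def)
    fix a assume a: "a \<in> A"
    then obtain n :: nat where "a [^] n \<odot>\<^bsub>M\<^esub> x = \<zero>\<^bsub>M\<^esub>" using x by (auto simp: tors_def)
    then have "a [^] n \<odot>\<^bsub>M\<^esub> (r \<odot>\<^bsub>M\<^esub> x) = \<zero>\<^bsub>M\<^esub>"
      using x A a r by (subst smult_left_commute) (auto simp: tors_def)
    then show "\<exists>n::nat. a [^] n \<odot>\<^bsub>M\<^esub> (r \<odot>\<^bsub>M\<^esub> x) = \<zero>\<^bsub>M\<^esub>" ..
  qed
qed

text \<open>This is the radical of the annihilator of \<open>x\<close>. Containing a set, it
  contains the ideal generated by it, which is how torsion comes to depend only on
  generators.\<close>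

lemma nilpotent_on_ideal:
  assumes x: "x \<in> carrier M"
  shows "ideal {a \<in> carrier R. \<exists>n::nat. a [^] n \<odot>\<^bsub>M\<^esub> x = \<zero>\<^bsub>M\<^esub>} R" (is "ideal ?J R")
proof -
  have sm: "r \<otimes> s \<in> ?J" if s: "s \<in> ?J" and r: "r \<in> carrier R" for r s
  proof -
    obtain n :: nat where n: "s [^] n \<odot>\<^bsub>M\<^esub> x = \<zero>\<^bsub>M\<^esub>" using s by blast
    have "(r \<otimes> s) [^] n \<odot>\<^bsub>M\<^esub> x = r [^] n \<odot>\<^bsub>M\<^esub> (s [^] n \<odot>\<^bsub>M\<^esub> x)"
      using r s x by (simp add: nat_pow_distrib smult_assoc1)
    then show ?thesis using n r s by auto
  qed
  show ?thesis
  proof (rule idealI)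
    show "ring R" by (rule R.ring_axioms)
    show "subgroup ?J (add_monoid R)"
    proof (rule R.add.subgroupI)
      show "?J \<subseteq> carrier R" by blast
      have "\<zero> \<in> ?J" using x by (auto intro!: exI[of _ "1::nat"])
      then show "?J \<noteq> {}" by blast
      show "\<ominus> a \<in> ?J" if "a \<in> ?J" for a
        using sm[OF that, of "\<ominus> \<one>"] that by (simp add: R.l_minus)
      show "a \<oplus> b \<in> ?J" if "a \<in> ?J" "b \<in> ?J" for a b
        using that pow_add_smult_eq_zero[OF _ _ x] by blast
    qed
    show "r \<otimes> s \<in> ?J" if "s \<in> ?J" "r \<in> carrier R" for r s using sm that by blast
    show "s \<otimes> r \<in> ?J" if "s \<in> ?J" "r \<in> carrier R" for r s
      using sm[of s r] that m_comm[of s r] by auto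
  qed
qed

lemma tors_genideal:
  assumes A: "A \<subseteq> carrier R"
  shows "tors R (genideal R A) M = tors R A M"
proof
  show "tors R (genideal R A) M \<subseteq> tors R A M"
    using R.genideal_self[OF A] by (auto simp: tors_def)
  show "tors R A M \<subseteq> tors R (genideal R A) M"
  proof
    fix x assume x: "x \<in> tors R A M"
    then have "A \<subseteq> {a \<in> carrier R. \<exists>n::nat. a [^] n \<odot>\<^bsub>M\<^esub> x = \<zero>\<^bsub>M\<^esub>}"
      using A by (auto simp: tors_def)
    then have "genideal R A \<subseteq> {a \<in> carrier R. \<exists>n::nat. a [^] n \<odot>\<^bsub>M\<^esub> x = \<zero>\<^bsub>M\<^esub>}"
      using x by (intro R.genideal_minimal nilpotent_on_ideal) (auto simp: tors_def)
    then show "x \<in> tors R (genideal R A) M" using x by (auto simp: tors_def)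
  qed
qed

text \<open>The colon ideal \<open>(N : x)\<close>. Besides annihilators it yields the ideal of
  denominators of an element of the ideal transform in \<open>exists_product\<close>.\<close>

lemma annihilator_ideal:
  assumes N: "submodule N R M" and x: "x \<in> carrier M"
  shows "ideal {r \<in> carrier R. r \<odot>\<^bsub>M\<^esub> x \<in> N} R" (is "ideal ?J R")
proof (rule idealI)
  show "ring R" by (rule R.ring_axioms)
  have sm: "r \<otimes> s \<in> ?J" if "s \<in> ?J" "r \<in> carrier R" for r s
    using that x submoduleE(4)[OF N] by (simp add: smult_assoc1)
  show "subgroup ?J (add_monoid R)"
  proof (rule R.add.subgroupI)
    show "?J \<subseteq> carrier R" by blast
    have "\<zero> \<in> ?J" using x submodule_zero[OF N] by simp
    then show "?J \<noteq> {}" by blast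
    show "\<ominus> a \<in> ?J" if "a \<in> ?J" for a
      using that x submoduleE(3)[OF N] by (simp add: smult_l_minus)
    show "a \<oplus> b \<in> ?J" if "a \<in> ?J" "b \<in> ?J" for a b
      using that x submoduleE(5)[OF N] by (simp add: smult_l_distr)
  qed
  show "r \<otimes> s \<in> ?J" if "s \<in> ?J" "r \<in> carrier R" for r s using sm that by blast
  show "s \<otimes> r \<in> ?J" if "s \<in> ?J" "r \<in> carrier R" for r s
    using sm[of s r] that m_comm[of s r] by auto
qed

lemma zero_submodule: "submodule {\<zero>\<^bsub>M\<^esub>} R M"
  by (rule submoduleI) auto

end

section \<open>Powers of ideals and the torsion functor\<close>

lemma (in cring) ideals_set_pow_Suc:
  "I [^]\<^bsub>ideals_set R\<^esub> Suc n = ideal_prod R (I [^]\<^bsub>ideals_set R\<^esub> n) I"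
  by (simp add: nat_pow_def ideals_set_def)

lemma (in cring) ideals_set_pow_ideal:
  "ideal I R \<Longrightarrow> ideal (I [^]\<^bsub>ideals_set R\<^esub> (n::nat)) R"
proof (induction n)
  case 0
  then show ?case by (simp add: nat_pow_def ideals_set_def oneideal)
next
  case (Suc n)
  then show ?case by (simp only: ideals_set_pow_Suc) (simp add: ideal_prod_is_ideal)
qed

lemma (in cring) pow_mem_ideals_set_pow:
  assumes "ideal I R" "a \<in> I"
  shows "a [^] n \<in> I [^]\<^bsub>ideals_set R\<^esub> (n::nat)"
proof (induction n)
  case 0
  then show ?case by (simp add: nat_pow_def ideals_set_def)
next
  case (Suc n)
  then show ?case using assms by (simp only: ideals_set_pow_Suc nat_pow_Suc ideal_prod.prod)
qed

text \<open>Makes the exponents uniform without choosing generators. A counterexample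
  \<open>x\<close> with maximal annihilator has \<open>a x\<close> killed by a power of
  \<open>I\<close> for every \<open>a\<close> in \<open>I\<close>, and the ascending chain condition
  bounds these powers simultaneously.\<close>

lemma torsion_part_eq_tors:
  fixes R (structure)
  assumes "noetherian_ring R" "module R M" "ideal I R"
  shows "torsion_part R I M = tors R I M"
proof
  interpret noetherian_ring R by fact
  interpret module R M by fact
  interpret I: ideal I R by fact
  let ?P = "\<lambda>n::nat. I [^]\<^bsub>ideals_set R\<^esub> n"
  note Pid = ideals_set_pow_ideal[OF assms(3)]
  show "torsion_part R I M \<subseteq> tors R I M"
    using pow_mem_ideals_set_pow[OF assms(3)] unfolding torsion_part_def tors_def by blast
  define Z where "Z = torsion_part R I M"
  define ann where "ann x = {r \<in> carrier R. r \<odot>\<^bsub>M\<^esub> x \<in> {\<zero>\<^bsub>M\<^esub>}}" for x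
  have ann_id: "ideal (ann x) R" if "x \<in> carrier M" for x
    unfolding ann_def by (rule annihilator_ideal[OF zero_submodule that])
  have Psub: "?P n \<subseteq> carrier R" for n
    using Pid[of n] by (meson ideal.Icarr subsetI)
  show "tors R I M \<subseteq> torsion_part R I M"
  proof (rule ccontr)
    assume "\<not> tors R I M \<subseteq> torsion_part R I M"
    then obtain J where J: "J \<in> ann ` (tors R I M - Z)"
      and max: "\<And>K. K \<in> ann ` (tors R I M - Z) \<Longrightarrow> J \<subseteq> K \<Longrightarrow> K = J"
      by (rule_tac ideal_family_has_maximal[of "ann ` (tors R I M - Z)"])
        (auto simp: Z_def tors_def intro: ann_id)
    then obtain x where x: "x \<in> tors R I M" "x \<notin> Z" "J = ann x" by blast
    have xc: "x \<in> carrier M" using x by (simp add: tors_def)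
    have aZ: "a \<odot>\<^bsub>M\<^esub> x \<in> Z" if a: "a \<in> I" for a
    proof (rule ccontr)
      assume "a \<odot>\<^bsub>M\<^esub> x \<notin> Z"
      moreover have "a \<odot>\<^bsub>M\<^esub> x \<in> tors R I M"
        using submoduleE(4)[OF tors_submodule] x a I.a_subset by blast
      moreover have "ann x \<subseteq> ann (a \<odot>\<^bsub>M\<^esub> x)"
        using xc a I.a_Hcarr by (auto simp: ann_def smult_left_commute[of _ a])
      ultimately have eq: "ann (a \<odot>\<^bsub>M\<^esub> x) = ann x" using max x by blast
      obtain n :: nat where "a [^] n \<odot>\<^bsub>M\<^esub> x = \<zero>\<^bsub>M\<^esub>" using x a by (auto simp: tors_def)
      then have "x = \<zero>\<^bsub>M\<^esub>"
      proof (induction n)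
        case (Suc n)
        then have "a [^] n \<in> ann (a \<odot>\<^bsub>M\<^esub> x)" using a xc I.a_Hcarr
          by (simp add: ann_def smult_assoc1)
        then have "a [^] n \<in> ann x" using eq by blast
        then have "a [^] n \<odot>\<^bsub>M\<^esub> x = \<zero>\<^bsub>M\<^esub>" by (simp add: ann_def)
        then show ?case by (rule Suc.IH)
      qed (use xc in simp)
      then have "r \<odot>\<^bsub>M\<^esub> x = \<zero>\<^bsub>M\<^esub>" if "r \<in> ?P 0" for r
        using subsetD[OF Psub that] by simp
      then have "\<forall>r\<in>?P 0. r \<odot>\<^bsub>M\<^esub> x = \<zero>\<^bsub>M\<^esub>" by blast
      then have "x \<in> Z" using xc unfolding Z_def torsion_part_def by blast
      then show False using x by blast
    qed
    define K where "K n = {a \<in> carrier R. \<forall>r\<in>?P n. r \<odot>\<^bsub>M\<^esub> (a \<odot>\<^bsub>M\<^esub> x) = \<zero>\<^bsub>M\<^esub>}" for n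
    have Pne: "?P n \<noteq> {}" for n
      using additive_subgroup.zero_closed[OF ideal.axioms(1)[OF Pid[of n]]] by blast
    have K: "K n = (\<Inter>r\<in>?P n. {a \<in> carrier R. a \<odot>\<^bsub>M\<^esub> (r \<odot>\<^bsub>M\<^esub> x) \<in> {\<zero>\<^bsub>M\<^esub>}})" for n
    proof -
      have "r \<odot>\<^bsub>M\<^esub> (a \<odot>\<^bsub>M\<^esub> x) = a \<odot>\<^bsub>M\<^esub> (r \<odot>\<^bsub>M\<^esub> x)" if "a \<in> carrier R" "r \<in> ?P n" for a r
        using that xc subsetD[OF Psub] by (intro smult_left_commute) auto
      then have "K n = {a \<in> carrier R. \<forall>r\<in>?P n. a \<odot>\<^bsub>M\<^esub> (r \<odot>\<^bsub>M\<^esub> x) = \<zero>\<^bsub>M\<^esub>}"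
        unfolding K_def by (intro Collect_cong conj_cong ball_cong) auto
      then show ?thesis using Pne[of n] by blast
    qed
    have Kid: "ideal (K n) R" for n
      unfolding K
    proof (rule i_Intersect)
      show "ideal J R" if J: "J \<in> (\<lambda>r. {a \<in> carrier R. a \<odot>\<^bsub>M\<^esub> (r \<odot>\<^bsub>M\<^esub> x) \<in> {\<zero>\<^bsub>M\<^esub>}}) ` ?P n" for J
      proof -
        obtain r where r: "r \<in> ?P n" and J: "J = {a \<in> carrier R. a \<odot>\<^bsub>M\<^esub> (r \<odot>\<^bsub>M\<^esub> x) \<in> {\<zero>\<^bsub>M\<^esub>}}"
          using J by blast
        have "r \<odot>\<^bsub>M\<^esub> x \<in> carrier M" using r Psub xc by blast
        then show ?thesis unfolding J by (rule annihilator_ideal[OF zero_submodule])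
      qed
      show "(\<lambda>r. {a \<in> carrier R. a \<odot>\<^bsub>M\<^esub> (r \<odot>\<^bsub>M\<^esub> x) \<in> {\<zero>\<^bsub>M\<^esub>}}) ` ?P n \<noteq> {}"
        using Pne[of n] by blast
    qed
    have "?P (Suc n) \<subseteq> ?P n" for n
      using ideal_prod_inter[OF Pid assms(3), of n] unfolding ideals_set_pow_Suc by blast
    then have Ksub: "K n \<subseteq> K (Suc n)" for n unfolding K_def by blast
    \<comment> \<open>By \<open>aZ\<close> each \<open>a\<close> in \<open>I\<close> lies in some
      \<open>K n\<close>, hence in the stable value \<open>K N\<close>; so the power of
      \<open>I\<close> with exponent \<open>N + 1\<close> kills \<open>x\<close>.\<close>
    obtain N where N: "\<forall>n\<ge>N. K n = K N" using ascending_ideals_stabilize[of K, OF Kid Ksub] by blast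
    have IK: "I \<subseteq> K N"
    proof
      fix a assume a: "a \<in> I"
      then obtain n where "a \<in> K n"
        using aZ[OF a] I.a_Hcarr unfolding K_def Z_def torsion_part_def by blast
      moreover have "K n \<subseteq> K (max n N)" by (rule lift_Suc_mono_le[of K, OF Ksub]) simp
      moreover have "K (max n N) = K N" using N max.cobounded2[of N n] by blast
      ultimately show "a \<in> K N" by blast
    qed
    have "r \<in> carrier R \<and> r \<odot>\<^bsub>M\<^esub> x = \<zero>\<^bsub>M\<^esub>" if "r \<in> ideal_prod R (?P N) I" for r
      using that
    proof (induction rule: ideal_prod.induct)
      case (prod i j)
      then have "i \<odot>\<^bsub>M\<^esub> (j \<odot>\<^bsub>M\<^esub> x) = \<zero>\<^bsub>M\<^esub>" using IK unfolding K_def by blast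
      moreover have "i \<in> carrier R" "j \<in> carrier R" using prod Psub I.a_Hcarr by blast+
      ultimately show ?case using xc by (simp add: smult_assoc1)
    next
      case (sum s1 s2)
      then show ?case using xc by (simp add: smult_l_distr)
    qed
    then have "\<forall>r\<in>?P (Suc N). r \<odot>\<^bsub>M\<^esub> x = \<zero>\<^bsub>M\<^esub>" unfolding ideals_set_pow_Suc by blast
    then have "x \<in> torsion_part R I M"
      using xc unfolding torsion_part_def by blast
    then show False using x by (simp add: Z_def)
  qed
qed

section \<open>Injective modules\<close>

lemma module_regular: "cring R \<Longrightarrow> module R (regular_module R)"
  using module_regular_submodule[OF _ ring.oneideal[OF cring.axioms(1)]]
  by (simp add: regular_module_def)

text \<open>An extension of the map from the ideal \<open>A\<close> to all of \<open>R\<close> is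
  determined by the image of one, which is the element \<open>e\<close>.\<close>

lemma injective_module_baer:
  assumes inj: "injective_module R E" and A: "ideal A R"
    and "\<And>a. a \<in> A \<Longrightarrow> \<phi> a \<in> carrier E"
    and "\<And>a b. a \<in> A \<Longrightarrow> b \<in> A \<Longrightarrow> \<phi> (a \<oplus>\<^bsub>R\<^esub> b) = \<phi> a \<oplus>\<^bsub>E\<^esub> \<phi> b"
    and "\<And>r a. r \<in> carrier R \<Longrightarrow> a \<in> A \<Longrightarrow> \<phi> (r \<otimes>\<^bsub>R\<^esub> a) = r \<odot>\<^bsub>E\<^esub> \<phi> a"
  shows "\<exists>e\<in>carrier E. \<forall>a\<in>A. \<phi> a = a \<odot>\<^bsub>E\<^esub> e"
proof -
  have "module R E" using inj by (simp add: injective_module_def)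
  interpret module R E by fact
  interpret A: ideal A R by fact
  let ?A = "(regular_module R)\<lparr>carrier := A\<rparr>"
  have "(\<lambda>x. x) \<in> module_homs R ?A (regular_module R)"
    by (rule module_homsI) (auto simp: regular_module_def A.a_Hcarr)
  moreover have "\<phi> \<in> module_homs R ?A E"
    by (rule module_homsI) (use assms in \<open>auto simp: regular_module_def\<close>)
  ultimately have "\<exists>h\<in>module_homs R (regular_module R) E. \<forall>x\<in>carrier ?A. h x = \<phi> x"
    using inj module_regular_submodule[OF R.is_cring A] module_regular[OF R.is_cring]
    unfolding injective_module_def by (auto simp: inj_on_def)
  then obtain h where h: "h \<in> module_homs R (regular_module R) E" and hA: "\<And>r. r \<in> A \<Longrightarrow> h r = \<phi> r"
    by auto
  show ?thesis
  proof (rule bexI, rule ballI)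
    show "h \<one>\<^bsub>R\<^esub> \<in> carrier E"
      using module_homsD(1)[OF h, of "\<one>\<^bsub>R\<^esub>"] by (simp add: regular_module_def)
    show "\<phi> a = a \<odot>\<^bsub>E\<^esub> h \<one>\<^bsub>R\<^esub>" if "a \<in> A" for a
      using module_homsD(3)[OF h, of a "\<one>\<^bsub>R\<^esub>"] that hA[OF that] A.a_Hcarr
      by (simp add: regular_module_def)
  qed
qed

text \<open>Division by \<open>a\<close> up to \<open>a\<close>-power torsion, an elementwise form
  of surjectivity of the map to the localization at \<open>a\<close>. The clause on annihilators
  passes to torsion parts, and with \<open>r = 1\<close> it forces \<open>q' = 0\<close> for
  \<open>q = 0\<close>, so that dividing a cochain entry by entry does not enlarge its
  support.\<close>

definition almost_divisible :: "('a, 'k) ring_scheme \<Rightarrow> ('a, 'b, 'x) module_scheme \<Rightarrow> 'b set \<Rightarrow> bool" where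
  "almost_divisible R M N \<longleftrightarrow> (\<forall>q\<in>N. \<forall>a\<in>carrier R. \<exists>q'\<in>N.
     (\<forall>r\<in>carrier R. r \<odot>\<^bsub>M\<^esub> q = \<zero>\<^bsub>M\<^esub> \<longrightarrow> r \<odot>\<^bsub>M\<^esub> q' = \<zero>\<^bsub>M\<^esub>) \<and>
     (\<exists>n::nat. a [^]\<^bsub>R\<^esub> n \<odot>\<^bsub>M\<^esub> (a \<odot>\<^bsub>M\<^esub> q' \<ominus>\<^bsub>M\<^esub> q) = \<zero>\<^bsub>M\<^esub>))"

text \<open>With \<open>J = ann q\<close> and \<open>N\<close> such that \<open>(J : a\<^sup>N) = (J : a\<^sup>N\<^sup>+\<^sup>1)\<close>, the map
  \<open>a\<^sup>N\<^sup>+\<^sup>1 r + j \<mapsto> a\<^sup>N r q\<close> on the ideal \<open>(a\<^sup>N\<^sup>+\<^sup>1) + J\<close> is well defined.\<close>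

lemma injective_module_almost_divisible:
  fixes R (structure)
  assumes noeth: "noetherian_ring R" and inj: "injective_module R E"
  shows "almost_divisible R E (carrier E)"
  unfolding almost_divisible_def
proof (intro ballI)
  fix q a assume q: "q \<in> carrier E" and a: "a \<in> carrier R"
  have "module R E" using inj by (simp add: injective_module_def)
  interpret module R E by fact
  interpret noetherian_ring R by fact
  define J where "J = {r \<in> carrier R. r \<odot>\<^bsub>E\<^esub> q \<in> {\<zero>\<^bsub>E\<^esub>}}"
  have J: "ideal J R" unfolding J_def by (rule annihilator_ideal[OF zero_submodule q])
  define C where "C n = {r \<in> carrier R. r \<odot>\<^bsub>E\<^esub> (a [^] n \<odot>\<^bsub>E\<^esub> q) \<in> {\<zero>\<^bsub>E\<^esub>}}" for n :: nat
  have C: "ideal (C n) R" for n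
    unfolding C_def by (rule annihilator_ideal[OF zero_submodule]) (use q a in simp)
  have Csuc: "C n \<subseteq> C (Suc n)" for n
  proof
    fix r assume r: "r \<in> C n"
    have "r \<odot>\<^bsub>E\<^esub> (a [^] Suc n \<odot>\<^bsub>E\<^esub> q) = a \<odot>\<^bsub>E\<^esub> (r \<odot>\<^bsub>E\<^esub> (a [^] n \<odot>\<^bsub>E\<^esub> q))"
    proof -
      have "a [^] Suc n \<odot>\<^bsub>E\<^esub> q = a \<odot>\<^bsub>E\<^esub> (a [^] n \<odot>\<^bsub>E\<^esub> q)"
        using a q by (subst nat_pow_Suc2) (auto simp: smult_assoc1)
      then show ?thesis using smult_left_commute[of r a] r a q by (simp add: C_def)
    qed
    then show "r \<in> C (Suc n)" using r a by (simp add: C_def)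
  qed
  obtain N where N: "\<forall>n\<ge>N. C n = C N" using ascending_ideals_stabilize[of C, OF C Csuc] by blast
  then have CN: "C (Suc N) = C N" using le_SucI[OF le_refl, of N] by blast
  define A where "A = PIdl (a [^] Suc N) <+>\<^bsub>R\<^esub> J"
  have A: "ideal A R" unfolding A_def using add_ideals cgenideal_ideal J a by simp
  have Jc: "j \<in> carrier R" "j \<odot>\<^bsub>E\<^esub> q = \<zero>\<^bsub>E\<^esub>" if "j \<in> J" for j using that by (auto simp: J_def)
  have Aiff: "c \<in> A \<longleftrightarrow> (\<exists>r\<in>carrier R. \<exists>j\<in>J. c = r \<otimes> a [^] Suc N \<oplus> j)" for c
    by (auto simp: A_def set_add_def' cgenideal_def)
  define \<phi> where "\<phi> c = (THE e. \<exists>r\<in>carrier R. \<exists>j\<in>J. c = r \<otimes> a [^] Suc N \<oplus> j \<and> e = r \<odot>\<^bsub>E\<^esub> (a [^] N \<odot>\<^bsub>E\<^esub> q))" for c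
  have wd: "r \<odot>\<^bsub>E\<^esub> (a [^] N \<odot>\<^bsub>E\<^esub> q) = s \<odot>\<^bsub>E\<^esub> (a [^] N \<odot>\<^bsub>E\<^esub> q)"
    if eq: "r \<otimes> a [^] Suc N \<oplus> j = s \<otimes> a [^] Suc N \<oplus> k" and c: "r \<in> carrier R" "s \<in> carrier R" "j \<in> J" "k \<in> J"
    for r s j k
  proof -
    \<comment> \<open>Applied to \<open>q\<close>, the summands \<open>j\<close> and
      \<open>k\<close> vanish; so \<open>r - s\<close> lies in \<open>C (Suc N)\<close>, which
      equals \<open>C N\<close>.\<close>
    have "(r \<otimes> a [^] Suc N \<oplus> j) \<odot>\<^bsub>E\<^esub> q = (s \<otimes> a [^] Suc N \<oplus> k) \<odot>\<^bsub>E\<^esub> q" using eq by simp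
    then have "r \<odot>\<^bsub>E\<^esub> (a [^] Suc N \<odot>\<^bsub>E\<^esub> q) = s \<odot>\<^bsub>E\<^esub> (a [^] Suc N \<odot>\<^bsub>E\<^esub> q)"
      using c Jc a q by (simp add: smult_l_distr smult_assoc1 del: nat_pow_Suc)
    then have "(r \<ominus> s) \<in> C (Suc N)" using c a q by (simp add: C_def smult_l_diff del: nat_pow_Suc)
    then have "(r \<ominus> s) \<in> C N" using CN by simp
    then show ?thesis using c a q by (simp add: C_def smult_l_diff)
  qed
  have \<phi>: "\<phi> (r \<otimes> a [^] Suc N \<oplus> j) = r \<odot>\<^bsub>E\<^esub> (a [^] N \<odot>\<^bsub>E\<^esub> q)" if "r \<in> carrier R" "j \<in> J" for r j
    unfolding \<phi>_def
  proof (rule the_equality)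
    show "\<exists>r'\<in>carrier R. \<exists>k\<in>J. r \<otimes> a [^] Suc N \<oplus> j = r' \<otimes> a [^] Suc N \<oplus> k \<and>
        r \<odot>\<^bsub>E\<^esub> (a [^] N \<odot>\<^bsub>E\<^esub> q) = r' \<odot>\<^bsub>E\<^esub> (a [^] N \<odot>\<^bsub>E\<^esub> q)"
      using that by blast
  next
    fix e
    assume "\<exists>r'\<in>carrier R. \<exists>k\<in>J. r \<otimes> a [^] Suc N \<oplus> j = r' \<otimes> a [^] Suc N \<oplus> k \<and>
        e = r' \<odot>\<^bsub>E\<^esub> (a [^] N \<odot>\<^bsub>E\<^esub> q)"
    then obtain r' k where "r' \<in> carrier R" "k \<in> J" "r \<otimes> a [^] Suc N \<oplus> j = r' \<otimes> a [^] Suc N \<oplus> k"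
      "e = r' \<odot>\<^bsub>E\<^esub> (a [^] N \<odot>\<^bsub>E\<^esub> q)" by blast
    then show "e = r \<odot>\<^bsub>E\<^esub> (a [^] N \<odot>\<^bsub>E\<^esub> q)" using wd[of r j r' k] that by simp
  qed
  have "\<exists>e\<in>carrier E. \<forall>c\<in>A. \<phi> c = c \<odot>\<^bsub>E\<^esub> e"
  proof (rule injective_module_baer[OF inj A, of \<phi>])
    fix c assume "c \<in> A"
    then show "\<phi> c \<in> carrier E" using \<phi> a q unfolding Aiff by auto
  next
    fix c c' assume "c \<in> A" "c' \<in> A"
    then obtain r j s k where *: "r \<in> carrier R" "j \<in> J" "c = r \<otimes> a [^] Suc N \<oplus> j"
      "s \<in> carrier R" "k \<in> J" "c' = s \<otimes> a [^] Suc N \<oplus> k" unfolding Aiff by blast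
    then have "c \<oplus> c' = (r \<oplus> s) \<otimes> a [^] Suc N \<oplus> (j \<oplus> k)"
      using a Jc by (simp add: l_distr R.a_ac del: nat_pow_Suc)
    moreover have "j \<oplus> k \<in> J" using * by (intro additive_subgroup.a_closed[OF ideal.axioms(1)[OF J]])
    ultimately show "\<phi> (c \<oplus> c') = \<phi> c \<oplus>\<^bsub>E\<^esub> \<phi> c'"
      using * a q \<phi> by (simp add: smult_l_distr del: nat_pow_Suc)
  next
    fix t c assume t: "t \<in> carrier R" and "c \<in> A"
    then obtain r j where *: "r \<in> carrier R" "j \<in> J" "c = r \<otimes> a [^] Suc N \<oplus> j" unfolding Aiff by blast
    then have "t \<otimes> c = (t \<otimes> r) \<otimes> a [^] Suc N \<oplus> t \<otimes> j"
      using a Jc t by (simp add: r_distr m_assoc del: nat_pow_Suc)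
    moreover have "t \<otimes> j \<in> J" using * J t by (simp add: ideal.I_l_closed)
    ultimately show "\<phi> (t \<otimes> c) = t \<odot>\<^bsub>E\<^esub> \<phi> c"
      using * a q t \<phi> by (simp add: smult_assoc1 del: nat_pow_Suc)
  qed
  then obtain e where e: "e \<in> carrier E" and ea: "\<And>c. c \<in> A \<Longrightarrow> \<phi> c = c \<odot>\<^bsub>E\<^esub> e" by blast
  show "\<exists>q'\<in>carrier E. (\<forall>r\<in>carrier R. r \<odot>\<^bsub>E\<^esub> q = \<zero>\<^bsub>E\<^esub> \<longrightarrow> r \<odot>\<^bsub>E\<^esub> q' = \<zero>\<^bsub>E\<^esub>) \<and>
     (\<exists>n::nat. a [^] n \<odot>\<^bsub>E\<^esub> (a \<odot>\<^bsub>E\<^esub> q' \<ominus>\<^bsub>E\<^esub> q) = \<zero>\<^bsub>E\<^esub>)"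
  proof (rule bexI[OF _ e], rule conjI, intro ballI impI)
    fix r assume r: "r \<in> carrier R" "r \<odot>\<^bsub>E\<^esub> q = \<zero>\<^bsub>E\<^esub>"
    then have rJ: "r \<in> J" by (simp add: J_def)
    \<comment> \<open>Elements of \<open>J\<close> have coefficient zero at \<open>a^(N+1)\<close>,
      so \<open>\<phi>\<close> vanishes on \<open>J\<close>; this gives the clause on
      annihilators.\<close>
    have eq: "\<zero> \<otimes> a [^] Suc N \<oplus> r = r" using a r by simp
    then have "r \<in> A" unfolding Aiff using rJ by (intro bexI[of _ "\<zero>"] bexI[of _ r]) auto
    then have "r \<odot>\<^bsub>E\<^esub> e = \<phi> r" using ea by simp
    also have "\<dots> = \<zero>\<^bsub>E\<^esub>" using \<phi>[OF _ rJ, of "\<zero>"] eq a q by (simp del: nat_pow_Suc)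
    finally show "r \<odot>\<^bsub>E\<^esub> e = \<zero>\<^bsub>E\<^esub>" .
  next
    have "a [^] N \<odot>\<^bsub>E\<^esub> (a \<odot>\<^bsub>E\<^esub> e \<ominus>\<^bsub>E\<^esub> q) = \<zero>\<^bsub>E\<^esub>"
    proof -
      have J0: "\<zero> \<in> J" using q by (simp add: J_def)
      have eq: "\<one> \<otimes> a [^] Suc N \<oplus> \<zero> = a [^] Suc N" using a by simp
      then have "a [^] Suc N \<in> A" unfolding Aiff using J0 by (intro bexI[of _ "\<one>"] bexI[of _ "\<zero>"]) auto
      then have "\<phi> (a [^] Suc N) = a [^] Suc N \<odot>\<^bsub>E\<^esub> e" by (rule ea)
      then have "a [^] N \<odot>\<^bsub>E\<^esub> q = a [^] Suc N \<odot>\<^bsub>E\<^esub> e"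
        using \<phi>[OF _ J0, of "\<one>"] eq a q by (simp del: nat_pow_Suc)
      then have "a [^] N \<odot>\<^bsub>E\<^esub> q = a [^] N \<odot>\<^bsub>E\<^esub> (a \<odot>\<^bsub>E\<^esub> e)" using a e by (simp add: smult_assoc1)
      then show ?thesis
        using a e q by (simp add: smult_r_diff)
    qed
    then show "\<exists>n::nat. a [^] n \<odot>\<^bsub>E\<^esub> (a \<odot>\<^bsub>E\<^esub> e \<ominus>\<^bsub>E\<^esub> q) = \<zero>\<^bsub>E\<^esub>" ..
  qed
qed

section \<open>Associated primes, quotient modules and Matlis duals\<close>

text \<open>Among the annihilators of nonzero elements that contain
  \<open>annihilator R M x\<close>, a maximal one is prime: if \<open>b y\<close> is nonzero, its
  annihilator contains that of \<open>y\<close> and hence equals it.\<close>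

lemma exists_associated_prime:
  fixes R (structure)
  assumes "noetherian_ring R" "module R M" "x \<in> carrier M" "x \<noteq> \<zero>\<^bsub>M\<^esub>"
  obtains \<pp> where "\<pp> \<in> associated_primes R M" "annihilator R M x \<subseteq> \<pp>"
proof -
  interpret noetherian_ring R by fact
  interpret module R M by fact
  define F where "F = {annihilator R M y | y. y \<in> carrier M \<and> y \<noteq> \<zero>\<^bsub>M\<^esub> \<and> annihilator R M x \<subseteq> annihilator R M y}"
  have id: "ideal (annihilator R M y) R" if "y \<in> carrier M" for y
    using annihilator_ideal[OF zero_submodule that] by (simp add: annihilator_def)
  obtain \<pp> where "\<pp> \<in> F" and max: "\<And>K. K \<in> F \<Longrightarrow> \<pp> \<subseteq> K \<Longrightarrow> K = \<pp>"
    by (rule ideal_family_has_maximal[of F]) (use assms id in \<open>auto simp: F_def\<close>)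
  then obtain y where y: "y \<in> carrier M" "y \<noteq> \<zero>\<^bsub>M\<^esub>" "annihilator R M x \<subseteq> annihilator R M y"
    and p: "\<pp> = annihilator R M y" unfolding F_def by blast
  have "primeideal \<pp> R"
  proof (rule primeidealI)
    show "ideal \<pp> R" using id y p by simp
    show "cring R" by (rule R.is_cring)
    have "\<one> \<notin> \<pp>" using y by (simp add: p annihilator_def)
    then show "carrier R \<noteq> \<pp>" by blast
    fix a b assume ab: "a \<in> carrier R" "b \<in> carrier R" "a \<otimes> b \<in> \<pp>"
    show "a \<in> \<pp> \<or> b \<in> \<pp>"
    proof (rule disjCI)
      assume "b \<notin> \<pp>"
      then have "b \<odot>\<^bsub>M\<^esub> y \<noteq> \<zero>\<^bsub>M\<^esub>" using ab by (simp add: p annihilator_def)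
      moreover have sub: "\<pp> \<subseteq> annihilator R M (b \<odot>\<^bsub>M\<^esub> y)"
        using y ab by (auto simp: p annihilator_def smult_left_commute[of _ b])
      ultimately have "annihilator R M (b \<odot>\<^bsub>M\<^esub> y) \<in> F"
        using y ab unfolding F_def p by blast
      then have "annihilator R M (b \<odot>\<^bsub>M\<^esub> y) = \<pp>" using max sub by blast
      moreover have "a \<in> annihilator R M (b \<odot>\<^bsub>M\<^esub> y)"
        using ab y by (simp add: p annihilator_def smult_assoc1)
      ultimately show "a \<in> \<pp>" by blast
    qed
  qed
  then have "\<pp> \<in> associated_primes R M" using y p unfolding associated_primes_def by blast
  then show thesis using that y p by blast
qed

section \<open>Modules of homomorphisms and quotient modules\<close>

lemma module_homs_zero:
  assumes "module R M" "module R N" "f \<in> module_homs R M N"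
  shows "f \<zero>\<^bsub>M\<^esub> = \<zero>\<^bsub>N\<^esub>"
proof -
  interpret M: module R M by fact
  interpret N: module R N by fact
  show ?thesis
    using module_homsD(3)[OF assms(3), of "\<zero>\<^bsub>R\<^esub>" "\<zero>\<^bsub>M\<^esub>"] module_homsD(1)[OF assms(3)] by simp
qed

lemma module_homs_minus:
  assumes "module R M" "module R N" "f \<in> module_homs R M N" "x \<in> carrier M"
  shows "f (\<ominus>\<^bsub>M\<^esub> x) = \<ominus>\<^bsub>N\<^esub> f x"
proof -
  interpret M: module R M by fact
  interpret N: module R N by fact
  show ?thesis
    using module_homsD(3)[OF assms(3), of "\<ominus>\<^bsub>R\<^esub> \<one>\<^bsub>R\<^esub>" x] module_homsD(1)[OF assms(3)] assms(4)
    by (simp add: M.smult_l_minus N.smult_l_minus)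
qed

lemma module_homs_diff:
  assumes "module R M" "module R N" "f \<in> module_homs R M N" "x \<in> carrier M" "y \<in> carrier M"
  shows "f (x \<ominus>\<^bsub>M\<^esub> y) = f x \<ominus>\<^bsub>N\<^esub> f y"
proof -
  interpret M: module R M by fact
  interpret N: module R N by fact
  show ?thesis
    using module_homsD(2)[OF assms(3,4), of "\<ominus>\<^bsub>M\<^esub> y"] module_homs_minus[OF assms(1-3)] assms(4,5)
    by (simp add: a_minus_def)
qed

lemma module_hom_module:
  assumes "module R M" "module R N"
  shows "module R (hom_module R M N)"
proof -
  interpret M: module R M by fact
  interpret N: module R N by fact
  let ?H = "hom_module R M N"
  have mem: "f \<in> carrier ?H \<longleftrightarrow> f \<in> module_homs R M N \<and> f \<in> extensional (carrier M)" for f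
    by (simp add: hom_module_def)
  have ext: "f = g" if "f \<in> carrier ?H" "g \<in> carrier ?H" "\<And>x. x \<in> carrier M \<Longrightarrow> f x = g x" for f g
    using that by (auto simp: mem intro: extensionalityI)
  have cl: "f x \<in> carrier N" if "f \<in> carrier ?H" "x \<in> carrier M" for f x
    using that module_homsD(1) by (fastforce simp: mem)
  have ad: "f (x \<oplus>\<^bsub>M\<^esub> y) = f x \<oplus>\<^bsub>N\<^esub> f y" if "f \<in> carrier ?H" "x \<in> carrier M" "y \<in> carrier M" for f x y
    using that module_homsD(2) by (fastforce simp: mem)
  have sm: "f (r \<odot>\<^bsub>M\<^esub> x) = r \<odot>\<^bsub>N\<^esub> f x" if "f \<in> carrier ?H" "r \<in> carrier R" "x \<in> carrier M" for f r x
    using that module_homsD(3) by (fastforce simp: mem)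
  have add: "(f \<oplus>\<^bsub>?H\<^esub> g) = (\<lambda>x\<in>carrier M. f x \<oplus>\<^bsub>N\<^esub> g x)" for f g by (simp add: hom_module_def)
  have smu: "r \<odot>\<^bsub>?H\<^esub> f = (\<lambda>x\<in>carrier M. r \<odot>\<^bsub>N\<^esub> f x)" for r f by (simp add: hom_module_def)
  have zer: "\<zero>\<^bsub>?H\<^esub> = (\<lambda>x\<in>carrier M. \<zero>\<^bsub>N\<^esub>)" by (simp add: hom_module_def)
  have add_c: "f \<oplus>\<^bsub>?H\<^esub> g \<in> carrier ?H" if "f \<in> carrier ?H" "g \<in> carrier ?H" for f g
    unfolding mem
    by (auto simp: add cl[OF that(1)] cl[OF that(2)] ad[OF that(1)] ad[OF that(2)] sm[OF that(1)] sm[OF that(2)]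
        N.smult_r_distr N.M.a_ac intro!: module_homsI)
  have smu_c: "r \<odot>\<^bsub>?H\<^esub> f \<in> carrier ?H" if "r \<in> carrier R" "f \<in> carrier ?H" for f r
    unfolding mem
    using that by (auto simp: smu cl[OF that(2)] ad[OF that(2)] sm[OF that(2)]
        N.smult_r_distr N.smult_left_commute[of r] intro!: module_homsI)
  have zer_c: "\<zero>\<^bsub>?H\<^esub> \<in> carrier ?H"
    unfolding mem by (auto simp: zer intro!: module_homsI)
  have app: "(f \<oplus>\<^bsub>?H\<^esub> g) x = f x \<oplus>\<^bsub>N\<^esub> g x" "(r \<odot>\<^bsub>?H\<^esub> f) x = r \<odot>\<^bsub>N\<^esub> f x" "\<zero>\<^bsub>?H\<^esub> x = \<zero>\<^bsub>N\<^esub>"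
    if "x \<in> carrier M" for f g r x
    using that by (simp_all add: add smu zer)
  note cls = add_c smu_c zer_c
  show ?thesis
  proof (rule moduleI)
    show "cring R" by (rule M.R.is_cring)
    show "abelian_group ?H"
    proof (rule abelian_groupI)
      fix f assume f: "f \<in> carrier ?H"
      have "(\<ominus>\<^bsub>R\<^esub> \<one>\<^bsub>R\<^esub> \<odot>\<^bsub>?H\<^esub> f) \<oplus>\<^bsub>?H\<^esub> f = \<zero>\<^bsub>?H\<^esub>"
        by (rule ext) (simp_all add: cls f app cl N.smult_l_minus N.M.l_neg)
      then show "\<exists>g\<in>carrier ?H. g \<oplus>\<^bsub>?H\<^esub> f = \<zero>\<^bsub>?H\<^esub>"
        using smu_c[OF _ f, of "\<ominus>\<^bsub>R\<^esub> \<one>\<^bsub>R\<^esub>"] by blast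
      show "\<zero>\<^bsub>?H\<^esub> \<oplus>\<^bsub>?H\<^esub> f = f"
        by (rule ext) (simp_all add: cls f app cl)
      fix g assume g: "g \<in> carrier ?H"
      show "f \<oplus>\<^bsub>?H\<^esub> g = g \<oplus>\<^bsub>?H\<^esub> f"
        by (rule ext) (simp_all add: cls f g app cl N.M.a_comm)
      fix h assume h: "h \<in> carrier ?H"
      show "f \<oplus>\<^bsub>?H\<^esub> g \<oplus>\<^bsub>?H\<^esub> h = f \<oplus>\<^bsub>?H\<^esub> (g \<oplus>\<^bsub>?H\<^esub> h)"
        by (rule ext) (simp_all add: cls f g h app cl N.M.a_assoc)
    qed (simp_all add: cls)
  next
    fix r f assume r: "r \<in> carrier R" and f: "f \<in> carrier ?H"
    show "r \<odot>\<^bsub>?H\<^esub> f \<in> carrier ?H" by (rule smu_c[OF r f])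
    fix g assume g: "g \<in> carrier ?H"
    show "r \<odot>\<^bsub>?H\<^esub> (f \<oplus>\<^bsub>?H\<^esub> g) = r \<odot>\<^bsub>?H\<^esub> f \<oplus>\<^bsub>?H\<^esub> r \<odot>\<^bsub>?H\<^esub> g"
      by (rule ext) (simp_all add: cls r f g app cl N.smult_r_distr)
  next
    fix f assume f: "f \<in> carrier ?H"
    show "\<one>\<^bsub>R\<^esub> \<odot>\<^bsub>?H\<^esub> f = f"
      by (rule ext) (simp_all add: cls f app cl)
  next
    fix r s f assume r: "r \<in> carrier R" "s \<in> carrier R" and f: "f \<in> carrier ?H"
    show "(r \<oplus>\<^bsub>R\<^esub> s) \<odot>\<^bsub>?H\<^esub> f = r \<odot>\<^bsub>?H\<^esub> f \<oplus>\<^bsub>?H\<^esub> s \<odot>\<^bsub>?H\<^esub> f"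
      by (rule ext) (simp_all add: cls r f app cl N.smult_l_distr)
    show "(r \<otimes>\<^bsub>R\<^esub> s) \<odot>\<^bsub>?H\<^esub> f = r \<odot>\<^bsub>?H\<^esub> (s \<odot>\<^bsub>?H\<^esub> f)"
      by (rule ext) (simp_all add: cls r f app cl N.smult_assoc1)
  qed
qed

lemma hom_module_zero_iff:
  assumes "f \<in> carrier (hom_module R M N)"
  shows "f = \<zero>\<^bsub>hom_module R M N\<^esub> \<longleftrightarrow> (\<forall>x\<in>carrier M. f x = \<zero>\<^bsub>N\<^esub>)"
  using assms by (auto simp: hom_module_def intro!: extensionalityI[where A = "carrier M"])

lemma quotient_module_simps:
  assumes M: "module R M" and N: "submodule N R M"
  shows "module R (quotient_module M N)"
    and "(\<lambda>x. N +>\<^bsub>M\<^esub> x) \<in> module_homs R M (quotient_module M N)"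
    and "carrier (quotient_module M N) = (\<lambda>x. N +>\<^bsub>M\<^esub> x) ` carrier M"
    and "\<And>x. x \<in> carrier M \<Longrightarrow> N +>\<^bsub>M\<^esub> x = \<zero>\<^bsub>quotient_module M N\<^esub> \<longleftrightarrow> x \<in> N"
proof -
  interpret M: module R M by fact
  let ?H = "quotient_module M N" and ?\<pi> = "\<lambda>x. N +>\<^bsub>M\<^esub> x"
  have "additive_subgroup N M" using N by (simp add: submodule_def additive_subgroup_def)
  then interpret N: abelian_subgroup N M
    by (rule abelian_subgroupI3) (rule M.abelian_group_axioms)
  show car: "carrier ?H = ?\<pi> ` carrier M"
    by (auto simp: quotient_module_def A_RCOSETS_def')
  have zer: "\<zero>\<^bsub>?H\<^esub> = ?\<pi> \<zero>\<^bsub>M\<^esub>" using N.a_subset by (simp add: quotient_module_def)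
  have add: "?\<pi> x \<oplus>\<^bsub>?H\<^esub> ?\<pi> y = ?\<pi> (x \<oplus>\<^bsub>M\<^esub> y)" if "x \<in> carrier M" "y \<in> carrier M" for x y
    using that by (simp add: quotient_module_def N.a_rcos_sum)
  have eqI: "?\<pi> x = ?\<pi> y" if "x \<in> ?\<pi> y" "y \<in> carrier M" for x y
    using that N.a_repr_independence' by blast
  have smu: "r \<odot>\<^bsub>?H\<^esub> ?\<pi> x = ?\<pi> (r \<odot>\<^bsub>M\<^esub> x)" if r: "r \<in> carrier R" and x: "x \<in> carrier M" for r x
  proof -
    \<comment> \<open>Scalar multiplication on the quotient is a union of cosets over
      representatives. They all coincide, and as there is at least one representative the union is
      that single coset.\<close>
    have *: "?\<pi> (r \<odot>\<^bsub>M\<^esub> y) = ?\<pi> (r \<odot>\<^bsub>M\<^esub> x)" if y: "y \<in> ?\<pi> x" for y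
    proof (rule eqI)
      obtain n where n: "n \<in> N" "y = n \<oplus>\<^bsub>M\<^esub> x" using y by (auto simp: a_r_coset_def')
      then have "r \<odot>\<^bsub>M\<^esub> y = r \<odot>\<^bsub>M\<^esub> n \<oplus>\<^bsub>M\<^esub> r \<odot>\<^bsub>M\<^esub> x"
        using r x N.a_subset by (simp add: M.smult_r_distr)
      then show "r \<odot>\<^bsub>M\<^esub> y \<in> ?\<pi> (r \<odot>\<^bsub>M\<^esub> x)"
        using M.submoduleE(4)[OF N r n(1)] by (auto simp: a_r_coset_def')
      show "r \<odot>\<^bsub>M\<^esub> x \<in> carrier M" using r x by simp
    qed
    have "r \<odot>\<^bsub>?H\<^esub> ?\<pi> x = (\<Union>y\<in>?\<pi> x. ?\<pi> (r \<odot>\<^bsub>M\<^esub> y))" by (simp add: quotient_module_def)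
    also have "\<dots> = (\<Union>y\<in>?\<pi> x. ?\<pi> (r \<odot>\<^bsub>M\<^esub> x))" by (intro SUP_cong refl *)
    also have "\<dots> = ?\<pi> (r \<odot>\<^bsub>M\<^esub> x)" using N.a_rcos_self[OF x] by blast
    finally show ?thesis .
  qed
  show "?\<pi> x = \<zero>\<^bsub>?H\<^esub> \<longleftrightarrow> x \<in> N" if "x \<in> carrier M" for x
    using that N.a_rcos_self[OF that] N.a_rcos_const by (auto simp: quotient_module_def)
  show "?\<pi> \<in> module_homs R M ?H"
    by (rule module_homsI) (auto simp: car add smu)
  show "module R ?H"
  proof (rule moduleI)
    show "cring R" by (rule M.R.is_cring)
    show "abelian_group ?H"
    proof (rule abelian_groupI)
      fix x assume "x \<in> carrier ?H"
      then obtain u where "u \<in> carrier M" "x = ?\<pi> u" by (auto simp: car)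
      then show "\<exists>y\<in>carrier ?H. y \<oplus>\<^bsub>?H\<^esub> x = \<zero>\<^bsub>?H\<^esub>"
        by (intro bexI[of _ "?\<pi> (\<ominus>\<^bsub>M\<^esub> u)"]) (simp_all add: add zer car M.M.l_neg)
    qed (auto simp: car add zer M.M.a_ac)
  qed (auto simp: car add smu M.smult_l_distr M.smult_r_distr M.smult_assoc1)
qed

section \<open>Matlis duality over a local ring\<close>

lemma ideal_submodule_regular:
  assumes "cring R" "ideal A R"
  shows "submodule A R (regular_module R)"
proof -
  interpret module R "regular_module R" using module_regular assms by blast
  interpret A: ideal A R by fact
  show ?thesis
    by (rule module_incl_imp_submodule)
      (use A.a_subset module_regular_submodule[OF assms] in \<open>auto simp: regular_module_def\<close>)
qed

text \<open>The element is the image of the class of one; injectivity of \<open>\<iota>\<close>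
  makes its annihilator exactly \<open>\<mm>\<close>.\<close>

lemma injective_hull_residue_field_element:
  assumes R: "cring R" and m: "ideal \<mm> R"
    and hull: "injective_hull R (quotient_module (regular_module R) \<mm>) \<iota> E"
  obtains e where "e \<in> carrier E" "\<And>r. r \<in> carrier R \<Longrightarrow> r \<odot>\<^bsub>E\<^esub> e = \<zero>\<^bsub>E\<^esub> \<longleftrightarrow> r \<in> \<mm>"
proof -
  let ?K = "quotient_module (regular_module R) \<mm>" and ?\<pi> = "\<lambda>x. \<mm> +>\<^bsub>regular_module R\<^esub> x"
  note sub = ideal_submodule_regular[OF R m]
  note K = quotient_module_simps[OF module_regular[OF R] sub]
  have E: "module R E" and i: "\<iota> \<in> module_homs R ?K E" and inj: "inj_on \<iota> (carrier ?K)"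
    using hull by (auto simp: injective_hull_def injective_module_def)
  interpret E: module R E by fact
  interpret K: module R ?K by (rule K)
  have \<pi>: "?\<pi> r \<in> carrier ?K" if "r \<in> carrier R" for r
    using that K(3) by (simp add: regular_module_def)
  have o: "r \<odot>\<^bsub>E\<^esub> \<iota> (?\<pi> \<one>\<^bsub>R\<^esub>) = \<iota> (?\<pi> r)" if r: "r \<in> carrier R" for r
    using module_homsD(3)[OF i r \<pi>] module_homsD(3)[OF K(2) r, of "\<one>\<^bsub>R\<^esub>"] r
    by (simp add: regular_module_def)
  show thesis
  proof
    show "\<iota> (?\<pi> \<one>\<^bsub>R\<^esub>) \<in> carrier E" using module_homsD(1)[OF i] \<pi> by simp
    fix r assume r: "r \<in> carrier R"
    have "\<iota> (?\<pi> r) = \<zero>\<^bsub>E\<^esub> \<longleftrightarrow> ?\<pi> r = \<zero>\<^bsub>?K\<^esub>"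
      using inj_on_eq_iff[OF inj \<pi>[OF r] K.zero_closed] module_homs_zero[OF K(1) E i] by simp
    then show "r \<odot>\<^bsub>E\<^esub> \<iota> (?\<pi> \<one>\<^bsub>R\<^esub>) = \<zero>\<^bsub>E\<^esub> \<longleftrightarrow> r \<in> \<mm>"
      using o[OF r] K(4)[of r] r by (simp add: regular_module_def)
  qed
qed

text \<open>The ideal \<open>(U : y)\<close> is proper, hence contained in \<open>\<mm>\<close>.
  With \<open>e\<close> annihilated exactly by \<open>\<mm>\<close>, sending \<open>u + r y\<close>
  to \<open>r e\<close> is therefore well defined on \<open>U + R y\<close>, and injectivity of
  \<open>E\<close> extends it to \<open>M\<close>.\<close>

lemma matlis_dual_separates:
  fixes R (structure)
  assumes noeth: "noetherian_ring R" and loc: "local_ring R \<mm>"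
    and hull: "injective_hull R (quotient_module (regular_module R) \<mm>) \<iota> E"
    and M: "module R M" and U: "submodule U R M" and y: "y \<in> carrier M" "y \<notin> U"
  shows "\<exists>\<phi>\<in>carrier (matlis_dual R E M). \<phi> y \<noteq> \<zero>\<^bsub>E\<^esub> \<and> (\<forall>u\<in>U. \<phi> u = \<zero>\<^bsub>E\<^esub>)"
proof -
  have m: "maximalideal \<mm> R" "cring R" using loc by (auto simp: local_ring_def)
  interpret cring R by fact
  interpret m: maximalideal \<mm> R by fact
  have inj: "injective_module R E" and E: "module R E"
    using hull by (auto simp: injective_hull_def injective_module_def)
  interpret E: module R E by fact
  interpret M: module R M by fact
  obtain e where e: "e \<in> carrier E" and em: "\<And>r. r \<in> carrier R \<Longrightarrow> r \<odot>\<^bsub>E\<^esub> e = \<zero>\<^bsub>E\<^esub> \<longleftrightarrow> r \<in> \<mm>"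
    using injective_hull_residue_field_element[OF m(2) m.ideal_axioms hull] by blast
  note UE = M.submoduleE[OF U] and U0 = M.submodule_zero[OF U]
  have Uc: "u \<in> carrier M" if "u \<in> U" for u using that UE by blast
  define J where "J = {r \<in> carrier R. r \<odot>\<^bsub>M\<^esub> y \<in> U}"
  have "ideal J R" unfolding J_def by (rule M.annihilator_ideal[OF U y(1)])
  moreover have "\<one> \<notin> J" using y by (simp add: J_def)
  ultimately have Jm: "J \<subseteq> \<mm>" using local_ring_proper_ideal[OF noeth loc] by force
  define S where "S = {u \<oplus>\<^bsub>M\<^esub> r \<odot>\<^bsub>M\<^esub> y | u r. u \<in> U \<and> r \<in> carrier R}"
  have SI: "u \<oplus>\<^bsub>M\<^esub> r \<odot>\<^bsub>M\<^esub> y \<in> S" if "u \<in> U" "r \<in> carrier R" for u r using that by (auto simp: S_def)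
  define g where "g z = (THE w. \<exists>u\<in>U. \<exists>r\<in>carrier R. z = u \<oplus>\<^bsub>M\<^esub> r \<odot>\<^bsub>M\<^esub> y \<and> w = r \<odot>\<^bsub>E\<^esub> e)" for z
  have wd: "r \<odot>\<^bsub>E\<^esub> e = s \<odot>\<^bsub>E\<^esub> e"
    if eq: "u \<oplus>\<^bsub>M\<^esub> r \<odot>\<^bsub>M\<^esub> y = v \<oplus>\<^bsub>M\<^esub> s \<odot>\<^bsub>M\<^esub> y" and c: "u \<in> U" "v \<in> U" "r \<in> carrier R" "s \<in> carrier R"
    for u v r s
  proof -
    have "r \<odot>\<^bsub>M\<^esub> y \<ominus>\<^bsub>M\<^esub> s \<odot>\<^bsub>M\<^esub> y = v \<ominus>\<^bsub>M\<^esub> u"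
    proof -
      have "r \<odot>\<^bsub>M\<^esub> y = (v \<oplus>\<^bsub>M\<^esub> s \<odot>\<^bsub>M\<^esub> y) \<oplus>\<^bsub>M\<^esub> \<ominus>\<^bsub>M\<^esub> u"
        using c y Uc by (simp add: eq[symmetric] M.M.a_ac M.M.r_neg2)
      then show ?thesis
        using c y Uc by (simp add: a_minus_def M.M.a_ac M.M.r_neg2 M.M.r_neg)
    qed
    then have "(r \<ominus> s) \<odot>\<^bsub>M\<^esub> y \<in> U" using c y M.submodule_diff[OF U] by (simp add: M.smult_l_diff)
    then have "r \<ominus> s \<in> \<mm>" using Jm c by (auto simp: J_def)
    then have "(r \<ominus> s) \<odot>\<^bsub>E\<^esub> e = \<zero>\<^bsub>E\<^esub>" using em c by simp
    then show ?thesis using c e by (simp add: E.smult_l_diff)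
  qed
  have g: "g (u \<oplus>\<^bsub>M\<^esub> r \<odot>\<^bsub>M\<^esub> y) = r \<odot>\<^bsub>E\<^esub> e" if "u \<in> U" "r \<in> carrier R" for u r
    unfolding g_def
  proof (rule the_equality)
    show "\<exists>u'\<in>U. \<exists>r'\<in>carrier R. u \<oplus>\<^bsub>M\<^esub> r \<odot>\<^bsub>M\<^esub> y = u' \<oplus>\<^bsub>M\<^esub> r' \<odot>\<^bsub>M\<^esub> y \<and> r \<odot>\<^bsub>E\<^esub> e = r' \<odot>\<^bsub>E\<^esub> e"
      using that by blast
  next
    fix w
    assume "\<exists>u'\<in>U. \<exists>r'\<in>carrier R. u \<oplus>\<^bsub>M\<^esub> r \<odot>\<^bsub>M\<^esub> y = u' \<oplus>\<^bsub>M\<^esub> r' \<odot>\<^bsub>M\<^esub> y \<and> w = r' \<odot>\<^bsub>E\<^esub> e"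
    then obtain u' r' where "u' \<in> U" "r' \<in> carrier R"
      "u \<oplus>\<^bsub>M\<^esub> r \<odot>\<^bsub>M\<^esub> y = u' \<oplus>\<^bsub>M\<^esub> r' \<odot>\<^bsub>M\<^esub> y" "w = r' \<odot>\<^bsub>E\<^esub> e" by blast
    then show "w = r \<odot>\<^bsub>E\<^esub> e" using wd[of u r u' r'] that by simp
  qed
  have add: "(u \<oplus>\<^bsub>M\<^esub> r \<odot>\<^bsub>M\<^esub> y) \<oplus>\<^bsub>M\<^esub> (v \<oplus>\<^bsub>M\<^esub> s \<odot>\<^bsub>M\<^esub> y) = (u \<oplus>\<^bsub>M\<^esub> v) \<oplus>\<^bsub>M\<^esub> (r \<oplus> s) \<odot>\<^bsub>M\<^esub> y"
    if "u \<in> U" "r \<in> carrier R" "v \<in> U" "s \<in> carrier R" for u r v s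
    using that y Uc by (simp add: M.smult_l_distr M.M.a_ac)
  have sm: "t \<odot>\<^bsub>M\<^esub> (u \<oplus>\<^bsub>M\<^esub> r \<odot>\<^bsub>M\<^esub> y) = t \<odot>\<^bsub>M\<^esub> u \<oplus>\<^bsub>M\<^esub> (t \<otimes> r) \<odot>\<^bsub>M\<^esub> y"
    if "u \<in> U" "r \<in> carrier R" "t \<in> carrier R" for u r t
    using that y Uc by (simp add: M.smult_r_distr M.smult_assoc1)
  have sub: "submodule S R M"
  proof (rule M.submoduleI)
    show "S \<subseteq> carrier M" using y Uc by (auto simp: S_def)
    show "\<zero>\<^bsub>M\<^esub> \<in> S" using SI[OF U0 zero_closed] y by simp
    show smS: "a \<odot>\<^bsub>M\<^esub> x \<in> S" if a: "a \<in> carrier R" and x: "x \<in> S" for a x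
    proof -
      obtain u r where "u \<in> U" "r \<in> carrier R" "x = u \<oplus>\<^bsub>M\<^esub> r \<odot>\<^bsub>M\<^esub> y" using x by (auto simp: S_def)
      then show ?thesis using a sm SI UE(4) by simp
    qed
    show "a \<oplus>\<^bsub>M\<^esub> b \<in> S" if ab: "a \<in> S" "b \<in> S" for a b
    proof -
      obtain u r v s where "u \<in> U" "r \<in> carrier R" "v \<in> U" "s \<in> carrier R"
        "a = u \<oplus>\<^bsub>M\<^esub> r \<odot>\<^bsub>M\<^esub> y" "b = v \<oplus>\<^bsub>M\<^esub> s \<odot>\<^bsub>M\<^esub> y" using ab by (auto simp: S_def)
      then show ?thesis using add SI UE(5) by simp
    qed
    show "\<ominus>\<^bsub>M\<^esub> a \<in> S" if "a \<in> S" for a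
    proof -
      have "a \<in> carrier M" using that y Uc by (auto simp: S_def)
      then have "\<ominus>\<^bsub>M\<^esub> a = (\<ominus> \<one>) \<odot>\<^bsub>M\<^esub> a" by (simp add: M.smult_l_minus)
      then show ?thesis using smS[OF _ that, of "\<ominus> \<one>"] by simp
    qed
  qed
  let ?S = "M\<lparr>carrier := S\<rparr>"
  have S: "module R ?S" by (rule M.submodule_restrict[OF sub])
  have gh: "g \<in> module_homs R ?S E"
  proof (rule module_homsI)
    show "g x \<in> carrier E" if "x \<in> carrier ?S" for x using that g e by (auto simp: S_def)
    show "g (x \<oplus>\<^bsub>?S\<^esub> z) = g x \<oplus>\<^bsub>E\<^esub> g z" if xz: "x \<in> carrier ?S" "z \<in> carrier ?S" for x z
    proof -
      obtain u r v s where "u \<in> U" "r \<in> carrier R" "v \<in> U" "s \<in> carrier R"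
        "x = u \<oplus>\<^bsub>M\<^esub> r \<odot>\<^bsub>M\<^esub> y" "z = v \<oplus>\<^bsub>M\<^esub> s \<odot>\<^bsub>M\<^esub> y" using xz by (auto simp: S_def)
      then show ?thesis using add g UE(5) e by (simp add: E.smult_l_distr)
    qed
    show "g (t \<odot>\<^bsub>?S\<^esub> x) = t \<odot>\<^bsub>E\<^esub> g x" if tx: "t \<in> carrier R" "x \<in> carrier ?S" for t x
    proof -
      obtain u r where "u \<in> U" "r \<in> carrier R" "x = u \<oplus>\<^bsub>M\<^esub> r \<odot>\<^bsub>M\<^esub> y" using tx by (auto simp: S_def)
      then show ?thesis using sm g UE(4) e tx by (simp add: E.smult_assoc1)
    qed
  qed
  have "(\<lambda>x. x) \<in> module_homs R ?S M"
    by (rule module_homsI) (use y Uc in \<open>auto simp: S_def\<close>)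
  from injective_module_extend[OF inj S M this _ gh]
  obtain h where h: "h \<in> module_homs R M E" and hg: "\<And>x. x \<in> S \<Longrightarrow> h x = g x" by auto
  show ?thesis
  proof (intro bexI[of _ "restrict h (carrier M)"] conjI ballI)
    show "restrict h (carrier M) \<in> carrier (matlis_dual R E M)"
      using module_homsD[OF h] by (auto simp: hom_module_def intro!: module_homsI)
    have "g y = e" using g[OF U0 one_closed] y e by simp
    moreover have "y \<in> S" using SI[OF U0 one_closed] y by simp
    moreover have "e \<noteq> \<zero>\<^bsub>E\<^esub>" using em[of \<one>] e m.I_notcarr m.one_imp_carrier by auto
    ultimately show "restrict h (carrier M) y \<noteq> \<zero>\<^bsub>E\<^esub>" using hg y by simp
    fix u assume u: "u \<in> U"
    then have "u \<in> S" "g u = \<zero>\<^bsub>E\<^esub>" using SI[OF u zero_closed] g[OF u zero_closed] Uc y e by auto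
    then show "restrict h (carrier M) u = \<zero>\<^bsub>E\<^esub>" using hg u Uc by simp
  qed
qed

section \<open>Koszul complexes\<close>

text \<open>The Koszul complex of \<open>a\<^sub>1, \<dots>, a\<^sub>n\<close> with coefficients in \<open>M\<close> is the iterated mapping cone of
  the multiplications by the \<open>a\<^sub>i\<close>. A subset of \<open>{1, \<dots>, n}\<close> is encoded by its characteristic list,
  whose number of entries \<open>True\<close> is the cohomological degree; \<open>cochains M n j N\<close> consists of the
  cochains in degrees below \<open>j\<close>.\<close>

fun koszul_d :: "('a, 'b, 'x) module_scheme \<Rightarrow> 'a list \<Rightarrow> (bool list \<Rightarrow> 'b) \<Rightarrow> bool list \<Rightarrow> 'b" where
  "koszul_d M [] f xs = \<zero>\<^bsub>M\<^esub>"
| "koszul_d M (a # as) f [] = \<zero>\<^bsub>M\<^esub>"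
| "koszul_d M (a # as) f (False # xs) = koszul_d M as (\<lambda>ys. f (False # ys)) xs"
| "koszul_d M (a # as) f (True # xs) =
     a \<odot>\<^bsub>M\<^esub> f (False # xs) \<ominus>\<^bsub>M\<^esub> koszul_d M as (\<lambda>ys. f (True # ys)) xs"

definition cochains :: "('a, 'b, 'x) module_scheme \<Rightarrow> nat \<Rightarrow> nat \<Rightarrow> 'b set \<Rightarrow> (bool list \<Rightarrow> 'b) set" where
  "cochains M n j N =
     {f. \<forall>xs. f xs \<in> N \<and> (length xs = n \<and> length (filter (\<lambda>b. b) xs) < j \<or> f xs = \<zero>\<^bsub>M\<^esub>)}"

lemma (in abelian_group) zero_diff_zero [simp]: "\<zero> \<ominus> \<zero> = \<zero>"
  by simp

lemma cochainsD: "f \<in> cochains M n j N \<Longrightarrow> f xs \<in> N"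
  by (simp add: cochains_def)

text \<open>Fixing the first entry gives the two components of the mapping cone; a leading
  \<open>True\<close> uses up one degree. For \<open>j = 0\<close> the truncated subtraction is
  harmless, since both components vanish.\<close>

lemma cochains_tail:
  assumes "f \<in> cochains M (Suc n) j N"
  shows "(\<lambda>xs. f (False # xs)) \<in> cochains M n j N"
    and "(\<lambda>xs. f (True # xs)) \<in> cochains M n (j - 1) N"
proof -
  have f: "f xs \<in> N" "length xs = Suc n \<and> length (filter (\<lambda>b. b) xs) < j \<or> f xs = \<zero>\<^bsub>M\<^esub>" for xs
    using assms by (auto simp: cochains_def)
  show "(\<lambda>xs. f (False # xs)) \<in> cochains M n j N"
    using f(1) f(2)[of "False # _"] by (simp add: cochains_def)
  show "(\<lambda>xs. f (True # xs)) \<in> cochains M n (j - 1) N"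
    using f(1) f(2)[of "True # _"] by (simp add: cochains_def less_diff_conv)
qed

lemma bool_list_cases [case_names Nil False True]:
  "(xs = [] \<Longrightarrow> P) \<Longrightarrow> (\<And>ys. xs = False # ys \<Longrightarrow> P) \<Longrightarrow> (\<And>ys. xs = True # ys \<Longrightarrow> P) \<Longrightarrow> P"
  by (metis (full_types) list.exhaust)

context module
begin

lemma koszul_d_mem:
  assumes "submodule N R M" "set as \<subseteq> carrier R" "\<And>xs. f xs \<in> N"
  shows "koszul_d M as f xs \<in> N"
  using assms(2,3)
proof (induction as arbitrary: f xs)
  case Nil
  then show ?case using assms(1) by (simp add: submodule_zero)
next
  case (Cons a as)
  show ?case
  proof (cases xs rule: bool_list_cases)
    case Nil
    then show ?thesis using assms(1) by (simp add: submodule_zero)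
  next
    case (False ys)
    then show ?thesis using Cons by simp
  next
    case (True ys)
    have "koszul_d M as (\<lambda>ys. f (True # ys)) ys \<in> N" using Cons by simp
    moreover have "a \<odot>\<^bsub>M\<^esub> f (False # ys) \<in> N" using Cons.prems submoduleE(4)[OF assms(1)] by simp
    ultimately show ?thesis using True submodule_diff[OF assms(1)] by simp
  qed
qed

lemma koszul_d_closed:
  "set as \<subseteq> carrier R \<Longrightarrow> (\<And>xs. f xs \<in> carrier M) \<Longrightarrow> koszul_d M as f xs \<in> carrier M"
  by (rule koszul_d_mem[OF carrier_is_submodule])

lemma koszul_d_zero [simp]: "set as \<subseteq> carrier R \<Longrightarrow> koszul_d M as (\<lambda>_. \<zero>\<^bsub>M\<^esub>) xs = \<zero>\<^bsub>M\<^esub>"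
  using koszul_d_mem[OF zero_submodule, of as "\<lambda>_. \<zero>\<^bsub>M\<^esub>"] by simp

lemma koszul_d_diff:
  assumes "set as \<subseteq> carrier R" "\<And>xs. f xs \<in> carrier M" "\<And>xs. g xs \<in> carrier M"
  shows "koszul_d M as (\<lambda>xs. f xs \<ominus>\<^bsub>M\<^esub> g xs) xs = koszul_d M as f xs \<ominus>\<^bsub>M\<^esub> koszul_d M as g xs"
  using assms
proof (induction as arbitrary: f g xs)
  case Nil
  then show ?case by (simp)
next
  case (Cons a as)
  show ?case
  proof (cases xs rule: bool_list_cases)
    case Nil
    then show ?thesis by (simp)
  next
    case (False ys)
    then show ?thesis using Cons by simp
  next
    case (True ys)
    have IH: "koszul_d M as (\<lambda>xs. f (True # xs) \<ominus>\<^bsub>M\<^esub> g (True # xs)) ys =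
        koszul_d M as (\<lambda>xs. f (True # xs)) ys \<ominus>\<^bsub>M\<^esub> koszul_d M as (\<lambda>xs. g (True # xs)) ys"
      using Cons.prems by (intro Cons.IH) auto
    have "koszul_d M as (\<lambda>xs. f (True # xs)) ys \<in> carrier M" "koszul_d M as (\<lambda>xs. g (True # xs)) ys \<in> carrier M"
      using Cons.prems by (auto intro!: koszul_d_closed)
    then show ?thesis using Cons.prems True
      by (simp add: IH smult_r_diff) (simp add: a_minus_def M.minus_add M.a_ac)
  qed
qed

lemma koszul_d_smult:
  assumes "set as \<subseteq> carrier R" "\<And>xs. f xs \<in> carrier M" "c \<in> carrier R"
  shows "koszul_d M as (\<lambda>xs. c \<odot>\<^bsub>M\<^esub> f xs) xs = c \<odot>\<^bsub>M\<^esub> koszul_d M as f xs"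
  using assms
proof (induction as arbitrary: f xs)
  case Nil
  then show ?case by simp
next
  case (Cons a as)
  show ?case
  proof (cases xs rule: bool_list_cases)
    case Nil
    then show ?thesis using assms by simp
  next
    case (False ys)
    then show ?thesis using Cons by simp
  next
    case (True ys)
    have "koszul_d M as (\<lambda>xs. f (True # xs)) ys \<in> carrier M"
      using Cons.prems by (auto intro!: koszul_d_closed)
    then show ?thesis using Cons True by (simp add: smult_r_diff smult_left_commute[of c a])
  qed
qed

lemma koszul_d_uminus:
  assumes "set as \<subseteq> carrier R" "\<And>xs. f xs \<in> carrier M"
  shows "koszul_d M as (\<lambda>xs. \<ominus>\<^bsub>M\<^esub> f xs) xs = \<ominus>\<^bsub>M\<^esub> koszul_d M as f xs"
  using koszul_d_diff[of as "\<lambda>_. \<zero>\<^bsub>M\<^esub>" f xs] assms koszul_d_closed[of as f xs] by (simp add: a_minus_def)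

lemma koszul_d_add:
  assumes "set as \<subseteq> carrier R" "\<And>xs. f xs \<in> carrier M" "\<And>xs. g xs \<in> carrier M"
  shows "koszul_d M as (\<lambda>xs. f xs \<oplus>\<^bsub>M\<^esub> g xs) xs = koszul_d M as f xs \<oplus>\<^bsub>M\<^esub> koszul_d M as g xs"
  using koszul_d_diff[of as f "\<lambda>xs. \<ominus>\<^bsub>M\<^esub> g xs" xs] koszul_d_uminus[of as g xs] assms koszul_d_closed[of as g xs]
  by (simp add: a_minus_def)

text \<open>Because of the minus sign in the cone differential, the two terms \<open>a\<close> times
  the differential of the first component cancel.\<close>

lemma koszul_d_d:
  assumes "set as \<subseteq> carrier R" "\<And>xs. f xs \<in> carrier M"
  shows "koszul_d M as (koszul_d M as f) xs = \<zero>\<^bsub>M\<^esub>"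
  using assms
proof (induction as arbitrary: f xs)
  case Nil
  then show ?case by simp
next
  case (Cons a as)
  show ?case
  proof (cases xs rule: bool_list_cases)
    case (True ys)
    let ?f0 = "\<lambda>xs. f (False # xs)" and ?f1 = "\<lambda>xs. f (True # xs)"
    have c: "koszul_d M as ?f0 xs \<in> carrier M" "koszul_d M as ?f1 xs \<in> carrier M" for xs
      using Cons.prems by (auto intro!: koszul_d_closed)
    have "koszul_d M as (\<lambda>xs. a \<odot>\<^bsub>M\<^esub> f (False # xs) \<ominus>\<^bsub>M\<^esub> koszul_d M as ?f1 xs) ys
        = a \<odot>\<^bsub>M\<^esub> koszul_d M as ?f0 ys \<ominus>\<^bsub>M\<^esub> koszul_d M as (koszul_d M as ?f1) ys"
      using Cons.prems c by (subst koszul_d_diff) (auto simp: koszul_d_smult)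
    also have "\<dots> = a \<odot>\<^bsub>M\<^esub> koszul_d M as ?f0 ys"
      using Cons c[of ys] by (simp add: a_minus_def)
    finally show ?thesis using True Cons.prems c[of ys] by simp
  qed (use Cons in auto)
qed

lemma koszul_d_cochain:
  assumes "submodule N R M" "set as \<subseteq> carrier R" "f \<in> cochains M (length as) j N"
  shows "koszul_d M as f \<in> cochains M (length as) (Suc j) N"
proof -
  have N: "N \<subseteq> carrier M" using submoduleE(1)[OF assms(1)] .
  have "length xs = length as \<and> length (filter (\<lambda>b. b) xs) < Suc j \<or> koszul_d M as f xs = \<zero>\<^bsub>M\<^esub>" for xs
    using assms(2,3)
  proof (induction as arbitrary: f xs j)
    case Nil
    then show ?case by simp
  next
    case (Cons a as)
    have c: "set as \<subseteq> carrier R" "a \<in> carrier R" and f: "f \<in> cochains M (Suc (length as)) j N"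
      using Cons.prems by auto
    have fN: "f xs \<in> carrier M" for xs using cochainsD[OF f] N by blast
    show ?case
    proof (cases xs rule: bool_list_cases)
      case Nil
      then show ?thesis by simp
    next
      case (False ys)
      then show ?thesis using Cons.IH[OF c(1) cochains_tail(1)[OF f], of ys] by auto
    next
      case (True ys)
      have 0: "length ys = length as \<and> length (filter (\<lambda>b. b) ys) < j \<or> f (False # ys) = \<zero>\<^bsub>M\<^esub>"
        using f by (auto simp: cochains_def dest!: spec[of _ "False # ys"])
      have 1: "length ys = length as \<and> length (filter (\<lambda>b. b) ys) < j \<or> koszul_d M as (\<lambda>xs. f (True # xs)) ys = \<zero>\<^bsub>M\<^esub>"
      \<comment> \<open>For \<open>j = 0\<close> the induction hypothesis would only give the bound
        \<open>Suc (0 - 1)\<close>, which is one too large; there the second component is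
        zero.\<close>
      proof (cases j)
        case 0
        then have "(\<lambda>xs. f (True # xs)) = (\<lambda>_. \<zero>\<^bsub>M\<^esub>)" using f by (auto simp: cochains_def)
        then show ?thesis using c by simp
      next
        case (Suc i)
        then show ?thesis using Cons.IH[OF c(1) cochains_tail(2)[OF f], of ys] by simp
      qed
      show ?thesis
        using 0 1 True c fN by auto
    qed
  qed
  then show ?thesis
    using koszul_d_mem[OF assms(1,2)] cochainsD[OF assms(3)] unfolding cochains_def by blast
qed

text \<open>Covers the truncated value \<open>j = 0\<close>, where the cochain and its differential
  both vanish.\<close>

lemma koszul_d_cochain_pred:
  assumes "submodule N R M" "set as \<subseteq> carrier R" "f \<in> cochains M (length as) (j - 1) N"
  shows "koszul_d M as f \<in> cochains M (length as) j N"
proof (cases j)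
  case 0
  then have "f = (\<lambda>_. \<zero>\<^bsub>M\<^esub>)" using assms(3) by (auto simp: cochains_def)
  then have "koszul_d M as f = f" using assms(2) by auto
  then show ?thesis using assms(3) 0 by simp
next
  case (Suc i)
  then show ?thesis using koszul_d_cochain[OF assms(1,2), of f i] assms(3) by simp
qed

lemma cochains_diff:
  "submodule N R M \<Longrightarrow> f \<in> cochains M n j N \<Longrightarrow> g \<in> cochains M n j N \<Longrightarrow>
    (\<lambda>xs. f xs \<ominus>\<^bsub>M\<^esub> g xs) \<in> cochains M n j N"
  unfolding cochains_def by (auto intro: submodule_diff) (metis M.diff_eq_zero_iff M.zero_closed)+

lemma cochains_smult:
  "submodule N R M \<Longrightarrow> f \<in> cochains M n j N \<Longrightarrow> c \<in> carrier R \<Longrightarrow>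
    (\<lambda>xs. c \<odot>\<^bsub>M\<^esub> f xs) \<in> cochains M n j N"
  unfolding cochains_def using submoduleE(4)[of N] by fastforce

lemma cochains_add:
  "submodule N R M \<Longrightarrow> f \<in> cochains M n j N \<Longrightarrow> g \<in> cochains M n j N \<Longrightarrow>
    (\<lambda>xs. f xs \<oplus>\<^bsub>M\<^esub> g xs) \<in> cochains M n j N"
  unfolding cochains_def by (auto intro: submoduleE(5)) (metis M.l_zero M.zero_closed)+

lemma cochains_uminus:
  "submodule N R M \<Longrightarrow> f \<in> cochains M n j N \<Longrightarrow> (\<lambda>xs. \<ominus>\<^bsub>M\<^esub> f xs) \<in> cochains M n j N"
  unfolding cochains_def using submoduleE(3)[of N] by fastforce

end

section \<open>Exactness of Koszul complexes modulo torsion\<close>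

lemma (in abelian_group) diff_diff_diff_cancel:
  assumes "x \<in> carrier G" "u \<in> carrier G" "y \<in> carrier G" "z \<in> carrier G"
  shows "(x \<ominus> y \<ominus> z) \<ominus> (x \<ominus> u) = u \<ominus> y \<ominus> z"
proof -
  have "(x \<ominus> y \<ominus> z) \<ominus> (x \<ominus> u) = (x \<oplus> \<ominus> x) \<oplus> (u \<ominus> y \<ominus> z)"
    using assms by (simp add: a_minus_def minus_add a_ac)
  then show ?thesis using assms by (simp add: r_neg)
qed

context module
begin

lemma submodule_Int: "submodule N R M \<Longrightarrow> submodule K R M \<Longrightarrow> submodule (N \<inter> K) R M"
  using submoduleE[of N] submoduleE[of K] submodule_zero[of N] submodule_zero[of K]
  by (intro submoduleI) (auto dest: subsetD)

lemma tors_smult_cancel: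
  assumes a: "a \<in> carrier R" and x: "x \<in> carrier M" and ax: "a \<odot>\<^bsub>M\<^esub> x \<in> tors R {a} M"
  shows "x \<in> tors R {a} M"
proof -
  obtain n :: nat where "a [^] n \<odot>\<^bsub>M\<^esub> (a \<odot>\<^bsub>M\<^esub> x) = \<zero>\<^bsub>M\<^esub>" using ax by (auto simp: tors_def)
  then have "a [^] Suc n \<odot>\<^bsub>M\<^esub> x = \<zero>\<^bsub>M\<^esub>" using a x by (simp add: smult_assoc1)
  then show ?thesis using x unfolding tors_def by blast
qed

text \<open>The clause on annihilators carries \<open>a^k q = 0\<close> over to the quotient
  \<open>q'\<close>, which is therefore \<open>a\<close>-torsion again.\<close>

lemma almost_divisible_Int_tors:
  assumes N: "almost_divisible R M N" and a: "a \<in> carrier R" and sub: "submodule N R M"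
  shows "almost_divisible R M (N \<inter> tors R {a} M)"
  unfolding almost_divisible_def
proof (intro ballI)
  fix q b assume q: "q \<in> N \<inter> tors R {a} M" and b: "b \<in> carrier R"
  obtain q' where q': "q' \<in> N" "\<forall>r\<in>carrier R. r \<odot>\<^bsub>M\<^esub> q = \<zero>\<^bsub>M\<^esub> \<longrightarrow> r \<odot>\<^bsub>M\<^esub> q' = \<zero>\<^bsub>M\<^esub>"
    and n: "\<exists>n::nat. b [^] n \<odot>\<^bsub>M\<^esub> (b \<odot>\<^bsub>M\<^esub> q' \<ominus>\<^bsub>M\<^esub> q) = \<zero>\<^bsub>M\<^esub>"
    using N q b unfolding almost_divisible_def by blast
  obtain k :: nat where "a [^] k \<odot>\<^bsub>M\<^esub> q = \<zero>\<^bsub>M\<^esub>" using q by (auto simp: tors_def)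
  then have "a [^] k \<odot>\<^bsub>M\<^esub> q' = \<zero>\<^bsub>M\<^esub>" using q' a by simp
  then have "q' \<in> tors R {a} M" using submoduleE(1)[OF sub] q' unfolding tors_def by blast
  then show "\<exists>q'\<in>N \<inter> tors R {a} M. (\<forall>r\<in>carrier R. r \<odot>\<^bsub>M\<^esub> q = \<zero>\<^bsub>M\<^esub> \<longrightarrow> r \<odot>\<^bsub>M\<^esub> q' = \<zero>\<^bsub>M\<^esub>) \<and>
      (\<exists>n::nat. b [^] n \<odot>\<^bsub>M\<^esub> (b \<odot>\<^bsub>M\<^esub> q' \<ominus>\<^bsub>M\<^esub> q) = \<zero>\<^bsub>M\<^esub>)"
    using q' n by blast
qed

lemma cochains_inter: "(\<And>xs. f xs \<in> K) \<Longrightarrow> f \<in> cochains M n j N \<Longrightarrow> f \<in> cochains M n j (N \<inter> K)"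
  by (simp add: cochains_def)

lemma cochains_mono: "N \<subseteq> K \<Longrightarrow> f \<in> cochains M n j N \<Longrightarrow> f \<in> cochains M n j K"
  unfolding cochains_def by blast

lemma tors_insert: "tors R (insert a A) M = tors R {a} M \<inter> tors R A M"
  by (auto simp: tors_def)

text \<open>Multiplication by \<open>a\<close> is invertible modulo \<open>a\<close>-torsion, which contracts the mapping cone of
  \<open>a\<close> onto the Koszul complex of the remaining elements on the \<open>a\<close>-torsion submodule.\<close>

lemma koszul_exact_mod_tors:
  assumes "set as \<subseteq> carrier R" "submodule N R M" "almost_divisible R M N"
    and "f \<in> cochains M (length as) j N" "\<And>xs. koszul_d M as f xs \<in> tors R (set as) M"
  shows "\<exists>g\<in>cochains M (length as) (j - 1) N. \<forall>xs. f xs \<ominus>\<^bsub>M\<^esub> koszul_d M as g xs \<in> tors R (set as) M"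
  using assms
proof (induction as arbitrary: f j N)
  case Nil
  \<comment> \<open>With no elements left, every member of \<open>M\<close> counts as torsion, so
    the zero cochain serves.\<close>
  have "(\<lambda>_. \<zero>\<^bsub>M\<^esub>) \<in> cochains M (length []) (j - 1) N"
    using submodule_zero[OF Nil.prems(2)] by (simp add: cochains_def)
  moreover have "f xs \<in> carrier M" for xs
    using cochainsD[OF Nil.prems(4)] submoduleE(1)[OF Nil.prems(2)] by blast
  ultimately show ?case by (intro bexI[of _ "\<lambda>_. \<zero>\<^bsub>M\<^esub>"]) (auto simp: tors_def)
next
  case (Cons a as)
  let ?Ta = "tors R {a} M" and ?T = "tors R (set as) M"
  let ?n = "length as" and ?d = "koszul_d M as"
  have as: "set as \<subseteq> carrier R" and a: "a \<in> carrier R" using Cons.prems(1) by auto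
  note N = Cons.prems(2)
  have Nc: "x \<in> carrier M" if "x \<in> N" for x using that submoduleE(1)[OF N] by blast
  have Ta: "submodule ?Ta R M" and T: "submodule ?T R M" using tors_submodule a as by auto
  \<comment> \<open>The induction hypothesis is used twice, for \<open>v\<close> and for
    \<open>w\<close>, both with values in the \<open>a\<close>-torsion of \<open>N\<close>; this is
    why \<open>N\<close> varies in the induction.\<close>
  define N' where "N' = N \<inter> ?Ta"
  have N': "submodule N' R M" unfolding N'_def by (rule submodule_Int[OF N Ta])
  have div': "almost_divisible R M N'"
    unfolding N'_def by (rule almost_divisible_Int_tors[OF Cons.prems(3) a N])
  define f0 f1 where "f0 = (\<lambda>xs. f (False # xs))" and "f1 = (\<lambda>xs. f (True # xs))"
  have f0: "f0 \<in> cochains M ?n j N" and f1: "f1 \<in> cochains M ?n (j - 1) N"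
    using cochains_tail[of f M ?n j N] Cons.prems(4) by (simp_all add: f0_def f1_def)
  note f0c = Nc[OF cochainsD[OF f0]] and f1c = Nc[OF cochainsD[OF f1]]
  have df0: "?d f0 xs \<in> ?Ta" "?d f0 xs \<in> ?T" for xs
    using Cons.prems(5)[of "False # xs"] by (simp_all add: tors_insert[of a "set as"] f0_def)
  have df1: "a \<odot>\<^bsub>M\<^esub> f0 xs \<ominus>\<^bsub>M\<^esub> ?d f1 xs \<in> ?Ta" "a \<odot>\<^bsub>M\<^esub> f0 xs \<ominus>\<^bsub>M\<^esub> ?d f1 xs \<in> ?T" for xs
    using Cons.prems(5)[of "True # xs"] by (simp_all add: tors_insert[of a "set as"] f0_def f1_def)
  \<comment> \<open>\<open>G\<close> will be \<open>f1\<close> divided by \<open>a\<close> modulo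
    \<open>a\<close>-torsion. It vanishes wherever \<open>f1\<close> does, so it stays within the
    same degrees.\<close>
  have "\<exists>y\<in>N. (f1 xs = \<zero>\<^bsub>M\<^esub> \<longrightarrow> y = \<zero>\<^bsub>M\<^esub>) \<and> f1 xs \<ominus>\<^bsub>M\<^esub> a \<odot>\<^bsub>M\<^esub> y \<in> ?Ta" for xs
  proof -
    obtain y and n :: nat where y: "y \<in> N"
      "\<forall>r\<in>carrier R. r \<odot>\<^bsub>M\<^esub> f1 xs = \<zero>\<^bsub>M\<^esub> \<longrightarrow> r \<odot>\<^bsub>M\<^esub> y = \<zero>\<^bsub>M\<^esub>"
      "a [^] n \<odot>\<^bsub>M\<^esub> (a \<odot>\<^bsub>M\<^esub> y \<ominus>\<^bsub>M\<^esub> f1 xs) = \<zero>\<^bsub>M\<^esub>"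
      using Cons.prems(3) cochainsD[OF f1, of xs] a unfolding almost_divisible_def by meson
    have "f1 xs = \<zero>\<^bsub>M\<^esub> \<longrightarrow> y = \<zero>\<^bsub>M\<^esub>" using y(2)[rule_format, of \<one>] f1c[of xs] Nc[OF y(1)] by simp
    moreover have "a [^] n \<odot>\<^bsub>M\<^esub> (f1 xs \<ominus>\<^bsub>M\<^esub> a \<odot>\<^bsub>M\<^esub> y) = \<zero>\<^bsub>M\<^esub>"
      using y(3) a f1c[of xs] Nc[OF y(1)] by (simp add: smult_r_diff)
    then have "f1 xs \<ominus>\<^bsub>M\<^esub> a \<odot>\<^bsub>M\<^esub> y \<in> ?Ta" using a f1c[of xs] Nc[OF y(1)] by (auto simp: tors_def)
    ultimately show ?thesis using y(1) by blast
  qed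
  then obtain G where G: "\<And>xs. G xs \<in> N" "\<And>xs. f1 xs = \<zero>\<^bsub>M\<^esub> \<Longrightarrow> G xs = \<zero>\<^bsub>M\<^esub>"
    and aG: "\<And>xs. f1 xs \<ominus>\<^bsub>M\<^esub> a \<odot>\<^bsub>M\<^esub> G xs \<in> ?Ta" by metis
  have Gco: "G \<in> cochains M ?n (j - 1) N" using f1 G unfolding cochains_def by blast
  note Gc = Nc[OF G(1)]
  note dc = koszul_d_closed[OF as]
  define v where "v = (\<lambda>xs. f0 xs \<ominus>\<^bsub>M\<^esub> ?d G xs)"
  define u where "u = (\<lambda>xs. f1 xs \<ominus>\<^bsub>M\<^esub> a \<odot>\<^bsub>M\<^esub> G xs)"
  have vN: "v \<in> cochains M ?n j N"
    unfolding v_def by (rule cochains_diff[OF N f0 koszul_d_cochain_pred[OF N as Gco]])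
  have uN: "u \<in> cochains M ?n (j - 1) N"
    unfolding u_def by (rule cochains_diff[OF N f1 cochains_smult[OF N Gco a]])
  have uN': "u \<in> cochains M ?n (j - 1) N'"
    unfolding N'_def using cochains_inter[OF _ uN] aG by (simp add: u_def)
  note vc = Nc[OF cochainsD[OF vN]] and uc = Nc[OF cochainsD[OF uN]]
  have du: "?d u xs = ?d f1 xs \<ominus>\<^bsub>M\<^esub> a \<odot>\<^bsub>M\<^esub> ?d G xs" for xs
    unfolding u_def using as a f1c Gc by (subst koszul_d_diff) (simp_all add: koszul_d_smult)
  \<comment> \<open>Up to the \<open>a\<close>-torsion cochain \<open>u\<close>, the cocycle
    condition on the second component says that \<open>a v\<close> is \<open>a\<close>-torsion; then
    so is \<open>v\<close>.\<close>
  have "v xs \<in> ?Ta" for xs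
  proof (rule tors_smult_cancel[OF a vc])
    have "a \<odot>\<^bsub>M\<^esub> v xs = (a \<odot>\<^bsub>M\<^esub> f0 xs \<ominus>\<^bsub>M\<^esub> ?d f1 xs) \<oplus>\<^bsub>M\<^esub> ?d u xs"
      unfolding du v_def using a f0c[of xs] dc[of f1, OF f1c, of xs] dc[of G, OF Gc, of xs]
      by (simp add: smult_r_diff) (simp add: a_minus_def M.a_ac M.r_neg2)
    moreover have "?d u xs \<in> ?Ta" using koszul_d_mem[OF Ta as] aG by (simp add: u_def)
    ultimately show "a \<odot>\<^bsub>M\<^esub> v xs \<in> ?Ta" using submoduleE(5)[OF Ta] df1 by simp
  qed
  then have vN': "v \<in> cochains M ?n j N'" unfolding N'_def by (rule cochains_inter[OF _ vN])
  have "?d v xs \<in> ?T" for xs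
  proof -
    have "?d v xs = ?d f0 xs"
      unfolding v_def using as f0c Gc dc[of G, OF Gc] dc[of f0, OF f0c]
      by (subst koszul_d_diff) (simp_all add: koszul_d_d a_minus_def)
    then show ?thesis using df0 by simp
  qed
  then obtain h where h: "h \<in> cochains M ?n (j - 1) N'" and vh: "\<And>xs. v xs \<ominus>\<^bsub>M\<^esub> ?d h xs \<in> ?T"
    using Cons.IH[OF as N' div' vN'] by blast
  have N'c: "x \<in> carrier M" if "x \<in> N'" for x using that Nc by (simp add: N'_def)
  note hc = N'c[OF cochainsD[OF h]]
  \<comment> \<open>Having corrected the first component by \<open>h\<close>, the error left in the
    second one is \<open>u - a h\<close>. It is again a cocycle modulo torsion, by the cocycle
    condition on \<open>f\<close> and the choice of \<open>h\<close>.\<close>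
  define w where "w = (\<lambda>xs. u xs \<ominus>\<^bsub>M\<^esub> a \<odot>\<^bsub>M\<^esub> h xs)"
  have w: "w \<in> cochains M ?n (j - 1) N'"
    unfolding w_def by (rule cochains_diff[OF N' uN' cochains_smult[OF N' h a]])
  have "?d w xs \<in> ?T" for xs
  proof -
    have "?d w xs = ?d u xs \<ominus>\<^bsub>M\<^esub> a \<odot>\<^bsub>M\<^esub> ?d h xs"
      unfolding w_def using as a uc hc by (subst koszul_d_diff) (simp_all add: koszul_d_smult)
    also have "\<dots> = a \<odot>\<^bsub>M\<^esub> (v xs \<ominus>\<^bsub>M\<^esub> ?d h xs) \<ominus>\<^bsub>M\<^esub> (a \<odot>\<^bsub>M\<^esub> f0 xs \<ominus>\<^bsub>M\<^esub> ?d f1 xs)"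
      unfolding du v_def using a f0c[of xs] dc[of f1, OF f1c, of xs] dc[of G, OF Gc, of xs] dc[of h, OF hc, of xs]
      by (simp add: smult_r_diff M.diff_diff_diff_cancel)
    finally show ?thesis using submodule_diff[OF T] submoduleE(4)[OF T a vh] df1 by simp
  qed
  then obtain k where k: "k \<in> cochains M ?n (j - 1 - 1) N'" and wk: "\<And>xs. w xs \<ominus>\<^bsub>M\<^esub> ?d k xs \<in> ?T"
    using Cons.IH[OF as N' div' w] by blast
  note kc = N'c[OF cochainsD[OF k]]
  \<comment> \<open>The components are \<open>G + h\<close> and \<open>- k\<close>; the sign
    compensates the minus in the cone differential, so that the errors become \<open>v - d h\<close>
    and \<open>w - d k\<close>.\<close>
  define g where "g xs = (case xs of [] \<Rightarrow> \<zero>\<^bsub>M\<^esub> | b # ys \<Rightarrow> if b then \<ominus>\<^bsub>M\<^esub> k ys else G ys \<oplus>\<^bsub>M\<^esub> h ys)" for xs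
  have NN': "N' \<subseteq> N" by (auto simp: N'_def)
  have g0: "(\<lambda>xs. G xs \<oplus>\<^bsub>M\<^esub> h xs) \<in> cochains M ?n (j - 1) N"
    by (rule cochains_add[OF N Gco cochains_mono[OF NN' h]])
  have g1: "(\<lambda>xs. \<ominus>\<^bsub>M\<^esub> k xs) \<in> cochains M ?n (j - 1 - 1) N"
    by (rule cochains_uminus[OF N cochains_mono[OF NN' k]])
  have "g \<in> cochains M (length (a # as)) (j - 1) N"
    unfolding cochains_def
  proof (intro CollectI allI)
    fix xs
    show "g xs \<in> N \<and> (length xs = length (a # as) \<and> length (filter (\<lambda>b. b) xs) < j - 1 \<or> g xs = \<zero>\<^bsub>M\<^esub>)"
    proof (cases xs rule: bool_list_cases)
      case Nil
      then show ?thesis using submodule_zero[OF N] by (simp add: g_def)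
    next
      case (False ys)
      then show ?thesis using g0 by (simp add: g_def cochains_def)
    next
      case (True ys)
      have "\<ominus>\<^bsub>M\<^esub> k ys \<in> N \<and> (length ys = length as \<and> length (filter (\<lambda>b. b) ys) < j - 1 - 1 \<or> \<ominus>\<^bsub>M\<^esub> k ys = \<zero>\<^bsub>M\<^esub>)"
        using g1 unfolding cochains_def by blast
      then show ?thesis using True by (simp add: g_def) linarith
    qed
  qed
  moreover have "f xs \<ominus>\<^bsub>M\<^esub> koszul_d M (a # as) g xs \<in> tors R (set (a # as)) M" for xs
  proof (cases xs rule: bool_list_cases)
    case Nil
    have "f [] = \<zero>\<^bsub>M\<^esub>" using Cons.prems(4) unfolding cochains_def by (auto dest!: spec[of _ "[]"])
    then show ?thesis using Nil submodule_zero[OF tors_submodule[OF Cons.prems(1)]] by simp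
  next
    case (False ys)
    have "f xs \<ominus>\<^bsub>M\<^esub> koszul_d M (a # as) g xs = f0 ys \<ominus>\<^bsub>M\<^esub> ?d (\<lambda>xs. G xs \<oplus>\<^bsub>M\<^esub> h xs) ys"
      using False by (simp add: f0_def g_def)
    also have "\<dots> = v ys \<ominus>\<^bsub>M\<^esub> ?d h ys"
      unfolding v_def using as f0c[of ys] Gc hc dc[of G, OF Gc, of ys] dc[of h, OF hc, of ys]
      by (simp add: koszul_d_add a_minus_def M.minus_add M.a_ac)
    finally have eq: "f xs \<ominus>\<^bsub>M\<^esub> koszul_d M (a # as) g xs = v ys \<ominus>\<^bsub>M\<^esub> ?d h ys" .
    have "v ys \<ominus>\<^bsub>M\<^esub> ?d h ys \<in> N'"
      by (intro submodule_diff[OF N'] cochainsD[OF vN'] koszul_d_mem[OF N' as] cochainsD[OF h])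
    then show ?thesis unfolding eq using vh[of ys] by (simp add: tors_insert[of a "set as"] N'_def)
  next
    case (True ys)
    have "f xs \<ominus>\<^bsub>M\<^esub> koszul_d M (a # as) g xs
        = f1 ys \<ominus>\<^bsub>M\<^esub> (a \<odot>\<^bsub>M\<^esub> (G ys \<oplus>\<^bsub>M\<^esub> h ys) \<ominus>\<^bsub>M\<^esub> ?d (\<lambda>xs. \<ominus>\<^bsub>M\<^esub> k xs) ys)"
      using True by (simp add: f1_def g_def)
    also have "\<dots> = w ys \<ominus>\<^bsub>M\<^esub> ?d k ys"
      unfolding w_def u_def using as a f1c[of ys] Gc[of ys] hc[of ys] kc dc[of k, OF kc, of ys]
      by (simp add: koszul_d_uminus smult_r_distr a_minus_def M.minus_add M.a_ac)
    finally have eq: "f xs \<ominus>\<^bsub>M\<^esub> koszul_d M (a # as) g xs = w ys \<ominus>\<^bsub>M\<^esub> ?d k ys" .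
    have "w ys \<ominus>\<^bsub>M\<^esub> ?d k ys \<in> N'"
      by (intro submodule_diff[OF N'] cochainsD[OF w] koszul_d_mem[OF N' as] cochainsD[OF k])
    then show ?thesis unfolding eq using wk[of ys] by (simp add: tors_insert[of a "set as"] N'_def)
  qed
  ultimately show ?case by blast
qed

end

section \<open>Values, top degree and functoriality of the Koszul differential\<close>

context module
begin

text \<open>Each entry of the differential is a signed sum of entries of \<open>g\<close> multiplied
  by members of \<open>as\<close>. This places Koszul coboundaries in the ideal times the
  coefficients.\<close>

lemma koszul_d_mem_of_smult:
  assumes V: "submodule V R M" and as: "set as \<subseteq> carrier R" and g: "\<And>xs. g xs \<in> carrier M"
    and "\<And>a xs. a \<in> set as \<Longrightarrow> a \<odot>\<^bsub>M\<^esub> g xs \<in> V"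
  shows "koszul_d M as g xs \<in> V"
  using assms(2-4)
proof (induction as arbitrary: g xs)
  case Nil
  then show ?case using submodule_zero[OF V] by simp
next
  case (Cons a as)
  show ?case
  proof (cases xs rule: bool_list_cases)
    case Nil
    then show ?thesis using submodule_zero[OF V] by simp
  next
    case (False ys)
    then show ?thesis using Cons by simp
  next
    case (True ys)
    have "koszul_d M as (\<lambda>ys. g (True # ys)) ys \<in> V" using Cons by simp
    then show ?thesis using True Cons.prems(3)[of a] submodule_diff[OF V] by simp
  qed
qed

text \<open>Nothing lies above the top degree: at each stage of the cone the first component of
  \<open>f\<close> is zero.\<close>

lemma koszul_d_top:
  assumes "set as \<subseteq> carrier R" "\<And>xs. xs \<noteq> replicate (length as) True \<Longrightarrow> f xs = \<zero>\<^bsub>M\<^esub>"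
  shows "koszul_d M as f xs = \<zero>\<^bsub>M\<^esub>"
  using assms
proof (induction as arbitrary: f xs)
  case Nil
  then show ?case by simp
next
  case (Cons a as)
  have f0: "f (False # ys) = \<zero>\<^bsub>M\<^esub>" for ys using Cons.prems by simp
  show ?case
  proof (cases xs rule: bool_list_cases)
    case Nil
    then show ?thesis by simp
  next
    case (False ys)
    then show ?thesis using Cons.prems by (simp add: f0)
  next
    case (True ys)
    have "koszul_d M as (\<lambda>ys. f (True # ys)) ys = \<zero>\<^bsub>M\<^esub>" using Cons by simp
    then show ?thesis using True Cons.prems by (simp add: f0)
  qed
qed

end

lemma koszul_d_hom:
  assumes M: "module R M" and N: "module R N" and h: "h \<in> module_homs R M N"
    and "set as \<subseteq> carrier R" "\<And>xs. f xs \<in> carrier M"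
  shows "koszul_d N as (\<lambda>xs. h (f xs)) xs = h (koszul_d M as f xs)"
  using assms(4,5)
proof (induction as arbitrary: f xs)
  case Nil
  then show ?case using module_homs_zero[OF M N h] by simp
next
  case (Cons a as)
  show ?case
  proof (cases xs rule: bool_list_cases)
    case Nil
    then show ?thesis using module_homs_zero[OF M N h] by simp
  next
    case (False ys)
    then show ?thesis using Cons by simp
  next
    case (True ys)
    interpret M: module R M by fact
    have "koszul_d M as (\<lambda>ys. f (True # ys)) ys \<in> carrier M"
      using Cons.prems by (intro M.koszul_d_closed) auto
    then show ?thesis
      using True Cons module_homs_diff[OF M N h] module_homsD(3)[OF h] by simp
  qed
qed

lemma module_homs_tors:
  assumes M: "module R M" and N: "module R N" and h: "h \<in> module_homs R M N" and A: "A \<subseteq> carrier R"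
    and x: "x \<in> tors R A M"
  shows "h x \<in> tors R A N"
proof -
  interpret M: module R M by fact
  have xc: "x \<in> carrier M" using x by (simp add: tors_def)
  have "\<exists>n::nat. a [^]\<^bsub>R\<^esub> n \<odot>\<^bsub>N\<^esub> h x = \<zero>\<^bsub>N\<^esub>" if a: "a \<in> A" for a
  proof -
    obtain n :: nat where n: "a [^]\<^bsub>R\<^esub> n \<odot>\<^bsub>M\<^esub> x = \<zero>\<^bsub>M\<^esub>" using x a by (auto simp: tors_def)
    have "a [^]\<^bsub>R\<^esub> n \<in> carrier R" using a A by auto
    then have "a [^]\<^bsub>R\<^esub> n \<odot>\<^bsub>N\<^esub> h x = \<zero>\<^bsub>N\<^esub>"
      using module_homsD(3)[OF h _ xc, of "a [^]\<^bsub>R\<^esub> n"] n module_homs_zero[OF M N h] by simp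
    then show ?thesis ..
  qed
  then show ?thesis using module_homsD(1)[OF h xc] by (simp add: tors_def)
qed

section \<open>The complex of torsion submodules of an injective resolution\<close>

locale ideal_and_resolution =
  fixes R (structure) and I \<epsilon> and Q :: "nat \<Rightarrow> ('a, 'q) module" and d
  assumes noeth: "noetherian_ring R" and cring: "cring R" and I: "ideal I R"
    and res: "injective_resolution R (regular_module R) \<epsilon> Q d"
begin

sublocale cring R by (rule cring)
sublocale noetherian_ring R by (rule noeth)
sublocale I: ideal I R by (rule I)

lemma Q_injective: "injective_module R (Q i)"
  using res by (simp add: injective_resolution_def)

lemma Q_module: "module R (Q i)"
  using Q_injective by (simp add: injective_module_def)

sublocale Q: module R "Q i" for i
  by (rule Q_module)

lemma d_hom: "d i \<in> module_homs R (Q i) (Q (Suc i))"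
  using res by (simp add: injective_resolution_def)

lemma eps_hom: "\<epsilon> \<in> module_homs R (regular_module R) (Q 0)"
  using res by (simp add: injective_resolution_def)

lemmas d_closed = module_homsD(1)[OF d_hom]
lemmas d_add = module_homsD(2)[OF d_hom]
lemmas d_smult = module_homsD(3)[OF d_hom]
lemmas d_zero = module_homs_zero[OF Q_module Q_module d_hom]
lemmas d_diff = module_homs_diff[OF Q_module Q_module d_hom]

lemma eps_closed: "a \<in> carrier R \<Longrightarrow> \<epsilon> a \<in> carrier (Q 0)"
  using module_homsD(1)[OF eps_hom] by (simp add: regular_module_def)

lemma eps_add: "a \<in> carrier R \<Longrightarrow> b \<in> carrier R \<Longrightarrow> \<epsilon> (a \<oplus> b) = \<epsilon> a \<oplus>\<^bsub>Q 0\<^esub> \<epsilon> b"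
  using module_homsD(2)[OF eps_hom] by (simp add: regular_module_def)

lemma eps_mult: "a \<in> carrier R \<Longrightarrow> b \<in> carrier R \<Longrightarrow> \<epsilon> (a \<otimes> b) = a \<odot>\<^bsub>Q 0\<^esub> \<epsilon> b"
  using module_homsD(3)[OF eps_hom] by (simp add: regular_module_def)

lemma eps_zero: "\<epsilon> \<zero> = \<zero>\<^bsub>Q 0\<^esub>"
  using module_homs_zero[OF module_regular[OF cring] Q_module eps_hom] by (simp add: regular_module_def)

lemma eps_diff: "a \<in> carrier R \<Longrightarrow> b \<in> carrier R \<Longrightarrow> \<epsilon> (a \<ominus> b) = \<epsilon> a \<ominus>\<^bsub>Q 0\<^esub> \<epsilon> b"
  using eps_add[of "a \<ominus> b" b] eps_closed
  by (simp add: a_minus_def a_assoc l_neg Q.M.a_assoc Q.M.r_neg)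

lemma eps_inj: "a \<in> carrier R \<Longrightarrow> b \<in> carrier R \<Longrightarrow> \<epsilon> a = \<epsilon> b \<Longrightarrow> a = b"
  using res by (auto simp: injective_resolution_def regular_module_def inj_on_def)

lemma d_eps: "a \<in> carrier R \<Longrightarrow> d 0 (\<epsilon> a) = \<zero>\<^bsub>Q 1\<^esub>"
  using res by (auto simp: injective_resolution_def regular_module_def)

lemma d_0_eq_zero: "x \<in> carrier (Q 0) \<Longrightarrow> d 0 x = \<zero>\<^bsub>Q 1\<^esub> \<Longrightarrow> \<exists>a\<in>carrier R. x = \<epsilon> a"
  using res by (auto simp: injective_resolution_def regular_module_def)

lemma kernel_eq_image: "{x \<in> carrier (Q (Suc i)). d (Suc i) x = \<zero>\<^bsub>Q (Suc (Suc i))\<^esub>} = d i ` carrier (Q i)"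
  using res by (simp add: injective_resolution_def)

lemma d_d: "x \<in> carrier (Q i) \<Longrightarrow> d (Suc i) (d i x) = \<zero>\<^bsub>Q (Suc (Suc i))\<^esub>"
  using kernel_eq_image[of i] by blast

definition T :: "nat \<Rightarrow> 'q set" where "T i = tors R I (Q i)"

lemma T_eq: "torsion_part R I (Q i) = T i"
  unfolding T_def by (rule torsion_part_eq_tors[OF noeth Q_module I])

lemma I_sub: "I \<subseteq> carrier R" by (rule I.a_subset)

lemma T_submodule: "submodule (T i) R (Q i)"
  unfolding T_def by (rule Q.tors_submodule[OF I_sub])

lemma T_carrier: "x \<in> T i \<Longrightarrow> x \<in> carrier (Q i)"
  by (simp add: T_def tors_def)

lemma d_T: "x \<in> T i \<Longrightarrow> d i x \<in> T (Suc i)"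
  unfolding T_def by (rule module_homs_tors[OF Q_module Q_module d_hom I_sub])

lemma T_pow: "x \<in> T i \<Longrightarrow> a \<in> I \<Longrightarrow> \<exists>n::nat. a [^] n \<odot>\<^bsub>Q i\<^esub> x = \<zero>\<^bsub>Q i\<^esub>"
  by (simp add: T_def tors_def)

text \<open>Exponents add, so there is no torsion left modulo \<open>T i\<close>; membership may be
  tested after multiplying by a power of each \<open>a\<close>.\<close>

lemma T_I:
  assumes x: "x \<in> carrier (Q i)" and "\<And>a. a \<in> I \<Longrightarrow> \<exists>n::nat. a [^] n \<odot>\<^bsub>Q i\<^esub> x \<in> T i"
  shows "x \<in> T i"
  unfolding T_def tors_def
proof (intro CollectI conjI ballI x)
  fix a assume a: "a \<in> I"
  then obtain n :: nat where "a [^] n \<odot>\<^bsub>Q i\<^esub> x \<in> T i" using assms(2) by blast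
  then obtain k :: nat where "a [^] k \<odot>\<^bsub>Q i\<^esub> (a [^] n \<odot>\<^bsub>Q i\<^esub> x) = \<zero>\<^bsub>Q i\<^esub>" using T_pow a by blast
  then have "a [^] (k + n) \<odot>\<^bsub>Q i\<^esub> x = \<zero>\<^bsub>Q i\<^esub>"
    using a I_sub x by (simp add: nat_pow_mult[symmetric] Q.smult_assoc1 subsetD)
  then show "\<exists>n::nat. a [^] n \<odot>\<^bsub>Q i\<^esub> x = \<zero>\<^bsub>Q i\<^esub>" ..
qed

text \<open>Modulo torsion, \<open>W\<close> is the ideal transform of \<open>R\<close> with respect to \<open>I\<close>.\<close>

definition W :: "'q set" where "W = {w \<in> carrier (Q 0). d 0 w \<in> T 1}"

lemma W_carrier: "w \<in> W \<Longrightarrow> w \<in> carrier (Q 0)"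
  by (simp add: W_def)

lemma W_submodule: "submodule W R (Q 0)"
proof (rule Q.submoduleI)
  note T = Q.submoduleE[OF T_submodule[of 1]] and T0 = Q.submodule_zero[OF T_submodule[of 1]]
  show "W \<subseteq> carrier (Q 0)" by (auto simp: W_def)
  show "\<zero>\<^bsub>Q 0\<^esub> \<in> W" using T0 d_zero[of 0] by (simp add: W_def)
  show "\<ominus>\<^bsub>Q 0\<^esub> a \<in> W" if "a \<in> W" for a
    using that T(3) module_homs_minus[OF Q_module Q_module d_hom, of a 0] by (simp add: W_def)
  show "a \<oplus>\<^bsub>Q 0\<^esub> b \<in> W" if "a \<in> W" "b \<in> W" for a b
    using that T(5) by (simp add: W_def d_add)
  show "a \<odot>\<^bsub>Q 0\<^esub> x \<in> W" if "a \<in> carrier R" "x \<in> W" for a x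
    using that T(4) by (simp add: W_def d_smult)
qed

lemma T_W: "t \<in> T 0 \<Longrightarrow> t \<in> W"
  using d_T[of t 0] by (simp add: W_def T_carrier)

lemma eps_W: "a \<in> carrier R \<Longrightarrow> \<epsilon> a \<in> W"
  using Q.submodule_zero[OF T_submodule[of 1]] by (simp add: W_def eps_closed d_eps)

text \<open>Some \<open>a^n\<close> kills \<open>d 0 w\<close>, so \<open>a^n w\<close> lies in the
  kernel of \<open>d 0\<close>, the image of \<open>R\<close>. In this sense members of
  \<open>W\<close> are fractions with denominator \<open>a^n\<close>.\<close>

lemma W_pow:
  assumes w: "w \<in> W" and a: "a \<in> I"
  shows "\<exists>n::nat. \<exists>b\<in>carrier R. a [^] n \<odot>\<^bsub>Q 0\<^esub> w = \<epsilon> b"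
proof -
  obtain n :: nat where n: "a [^] n \<odot>\<^bsub>Q 1\<^esub> d 0 w = \<zero>\<^bsub>Q 1\<^esub>" using T_pow[of "d 0 w" 1, OF _ a] w unfolding W_def by blast
  have an: "a [^] n \<in> carrier R" using a I_sub by auto
  have "d 0 (a [^] n \<odot>\<^bsub>Q 0\<^esub> w) = \<zero>\<^bsub>Q 1\<^esub>" using n d_smult[OF an W_carrier[OF w]] by simp
  then show ?thesis using d_0_eq_zero[OF Q.smult_closed[OF an W_carrier[OF w]]] by blast
qed

text \<open>Inherited along \<open>d 0\<close> from the same property of \<open>T 1\<close>.\<close>

lemma W_I:
  assumes x: "x \<in> carrier (Q 0)" and "\<And>a. a \<in> I \<Longrightarrow> \<exists>n::nat. a [^] n \<odot>\<^bsub>Q 0\<^esub> x \<in> W"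
  shows "x \<in> W"
  unfolding W_def
proof (intro CollectI conjI x T_I)
  show "d 0 x \<in> carrier (Q 1)" using d_closed[OF x] by simp
  fix a assume a: "a \<in> I"
  then obtain n :: nat where n: "a [^] n \<odot>\<^bsub>Q 0\<^esub> x \<in> W" using assms(2) by blast
  have "a [^] n \<in> carrier R" using a I_sub by auto
  then have "a [^] n \<odot>\<^bsub>Q 1\<^esub> d 0 x \<in> T 1" using n d_smult[OF _ x, of "a [^] n"] by (simp add: W_def)
  then show "\<exists>n::nat. a [^] n \<odot>\<^bsub>Q 1\<^esub> d 0 x \<in> T 1" ..
qed

end

section \<open>The resolution modulo torsion under vanishing of higher local cohomology\<close>

lemma zero_module_quotient:
  assumes "zero_module (quotient_module M N)" "\<zero>\<^bsub>M\<^esub> \<in> N" "x \<in> carrier M" "\<zero>\<^bsub>M\<^esub> \<oplus>\<^bsub>M\<^esub> x = x"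
  shows "x \<in> N"
proof -
  have "N +>\<^bsub>M\<^esub> x = N"
    using assms(1,3) by (auto simp: zero_module_def quotient_module_def A_RCOSETS_def')
  moreover have "x \<in> N +>\<^bsub>M\<^esub> x" using assms(2,4) by (force simp: a_r_coset_def')
  ultimately show ?thesis by blast
qed

context ideal_and_resolution
begin

lemma cocycle_eq_d_torsion:
  assumes "zero_module (local_cohomology R I Q d (Suc j))"
    and x: "x \<in> T (Suc j)" "d (Suc j) x = \<zero>\<^bsub>Q (Suc (Suc j))\<^esub>"
  shows "\<exists>t\<in>T j. x = d j t"
proof -
  have "x \<in> d j ` T j"
  proof (rule zero_module_quotient)
    show "zero_module (quotient_module
        ((Q (Suc j))\<lparr>carrier := {x \<in> T (Suc j). d (Suc j) x = \<zero>\<^bsub>Q (Suc (Suc j))\<^esub>}\<rparr>) (d j ` T j))"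
      using assms(1) by (simp add: local_cohomology_def T_eq)
    show "\<zero>\<^bsub>(Q (Suc j))\<lparr>carrier := {x \<in> T (Suc j). d (Suc j) x = \<zero>\<^bsub>Q (Suc (Suc j))\<^esub>}\<rparr>\<^esub> \<in> d j ` T j"
      using d_zero[of j] Q.submodule_zero[OF T_submodule[of j]] by (auto intro!: image_eqI[of _ _ "\<zero>\<^bsub>Q j\<^esub>"])
  qed (use x T_carrier in auto)
  then show ?thesis by blast
qed

text \<open>The element \<open>d (Suc i) x\<close> is a torsion cocycle of degree at least two,
  hence the image of some torsion \<open>t\<close>; then \<open>x - t\<close> is a cocycle of the
  resolution and so a coboundary. Exactness modulo torsion starts at \<open>Q 1\<close>, and in
  \<open>Q 0\<close> the kernel is \<open>W\<close>.\<close>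

lemma exact_mod_torsion:
  assumes van: "\<And>i. i \<ge> 2 \<Longrightarrow> zero_module (local_cohomology R I Q d i)"
    and x: "x \<in> carrier (Q (Suc i))" "d (Suc i) x \<in> T (Suc (Suc i))"
  shows "\<exists>y\<in>carrier (Q i). x \<ominus>\<^bsub>Q (Suc i)\<^esub> d i y \<in> T (Suc i)"
proof -
  have "zero_module (local_cohomology R I Q d (Suc (Suc i)))" by (rule van) simp
  then obtain t where t: "t \<in> T (Suc i)" "d (Suc i) x = d (Suc i) t"
    using cocycle_eq_d_torsion[of "Suc i" "d (Suc i) x"] x d_d by blast
  note tc = T_carrier[OF t(1)]
  have "x \<ominus>\<^bsub>Q (Suc i)\<^esub> t \<in> carrier (Q (Suc i))" using x tc by simp
  moreover have "d (Suc i) (x \<ominus>\<^bsub>Q (Suc i)\<^esub> t) = \<zero>\<^bsub>Q (Suc (Suc i))\<^esub>"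
    using t d_diff[OF x(1) tc] d_closed[OF tc] by simp
  ultimately obtain y where y: "y \<in> carrier (Q i)" "x \<ominus>\<^bsub>Q (Suc i)\<^esub> t = d i y"
    using kernel_eq_image[of i] by blast
  then have "x \<ominus>\<^bsub>Q (Suc i)\<^esub> d i y = x \<ominus>\<^bsub>Q (Suc i)\<^esub> (x \<ominus>\<^bsub>Q (Suc i)\<^esub> t)" by simp
  also have "\<dots> = t"
    using x tc by (simp add: a_minus_def Q.M.minus_add Q.M.r_neg2)
  finally show ?thesis using t y by auto
qed

lemma Q_almost_divisible: "almost_divisible R (Q i) (carrier (Q i))"
  by (rule injective_module_almost_divisible[OF noeth Q_injective])

text \<open>Chase through the double complex formed by the Koszul complexes of the \<open>Q\<^sub>q\<close> modulo torsion,
  whose rows are exact, and whose columns are exact except in cohomological degree \<open>0\<close>.\<close>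

lemma koszul_double_complex_chase:
  assumes van: "\<And>i. i \<ge> 2 \<Longrightarrow> zero_module (local_cohomology R I Q d i)"
    and as: "set as \<subseteq> carrier R" "I = genideal R (set as)"
  shows "f \<in> cochains (Q q) (length as) j (carrier (Q q)) \<Longrightarrow> (\<And>xs. d q (f xs) \<in> T (Suc q)) \<Longrightarrow>
    (\<And>xs. koszul_d (Q q) as f xs \<in> T q) \<Longrightarrow>
    \<exists>g\<in>cochains (Q q) (length as) (j - 1) (carrier (Q q)).
      (\<forall>xs. d q (g xs) \<in> T (Suc q)) \<and> (\<forall>xs. f xs \<ominus>\<^bsub>Q q\<^esub> koszul_d (Q q) as g xs \<in> T q)"
proof (induction j arbitrary: q f)
  case 0
  then have f0: "f xs = \<zero>\<^bsub>Q q\<^esub>" for xs by (simp add: cochains_def)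
  have "f = (\<lambda>_. \<zero>\<^bsub>Q q\<^esub>)" using f0 by auto
  then have "f xs \<ominus>\<^bsub>Q q\<^esub> koszul_d (Q q) as f xs \<in> T q" for xs
    using as Q.submodule_zero[OF T_submodule[of q]] by simp
  then show ?case using 0 by auto
next
  case (Suc j)
  let ?n = "length as" and ?C = "\<lambda>q. carrier (Q q)" and ?D = "\<lambda>q. koszul_d (Q q) as"
  have Teq: "T i = tors R (set as) (Q i)" for i
    using Q.tors_genideal[OF as(1), of i] unfolding as(2)[symmetric] T_def .
  note fc = cochainsD[OF Suc.prems(1)]
  note kc = Q.koszul_d_closed[OF as(1)]
  note sub = Q.carrier_is_submodule
  have "\<exists>g\<in>cochains (Q q) ?n (Suc j - 1) (?C q). \<forall>xs. f xs \<ominus>\<^bsub>Q q\<^esub> ?D q g xs \<in> T q"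
    unfolding Teq
    by (rule Q.koszul_exact_mod_tors[OF as(1) sub Q_almost_divisible Suc.prems(1)])
      (use Suc.prems(3) in \<open>simp add: Teq\<close>)
  then obtain g' where g': "g' \<in> cochains (Q q) ?n j (?C q)"
    and fg': "\<And>xs. f xs \<ominus>\<^bsub>Q q\<^esub> ?D q g' xs \<in> T q" by auto
  note g'c = cochainsD[OF g']
  have Dg'c: "?D q g' xs \<in> ?C q" for xs by (rule kc[OF g'c])
  \<comment> \<open>The primitive \<open>g'\<close> need not satisfy the condition on
    \<open>d q\<close>; \<open>F\<close> is the defect. It lives at \<open>Suc q\<close> with the
    bound lowered by one and is a cocycle modulo torsion in both directions, so the induction
    hypothesis applies to it.\<close>
  define F where "F = (\<lambda>xs. d q (g' xs))"
  have Fc: "F xs \<in> ?C (Suc q)" for xs unfolding F_def using d_closed[OF g'c] by simp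
  have F: "F \<in> cochains (Q (Suc q)) ?n j (?C (Suc q))"
    using g' Fc d_zero[of q] unfolding cochains_def F_def by force
  have "d (Suc q) (F xs) \<in> T (Suc (Suc q))" for xs
    unfolding F_def using d_d[OF g'c] Q.submodule_zero[OF T_submodule] by simp
  moreover have "?D (Suc q) F xs \<in> T (Suc q)" for xs
  proof -
    have "?D (Suc q) F xs = d q (?D q g' xs)"
      unfolding F_def by (rule koszul_d_hom[OF Q_module Q_module d_hom as(1) g'c])
    also have "\<dots> = d q (f xs) \<ominus>\<^bsub>Q (Suc q)\<^esub> d q (f xs \<ominus>\<^bsub>Q q\<^esub> ?D q g' xs)"
      using d_diff[OF fc[of xs] Dg'c[of xs]] d_closed[OF fc[of xs]] d_closed[OF Dg'c[of xs]]
      by (simp add: a_minus_def Q.M.minus_add Q.M.r_neg2)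
    finally show ?thesis
      using Q.submodule_diff[OF T_submodule Suc.prems(2) d_T[OF fg']] by simp
  qed
  ultimately obtain h where h: "h \<in> cochains (Q (Suc q)) ?n (j - 1) (?C (Suc q))"
    and dh: "\<And>xs. d (Suc q) (h xs) \<in> T (Suc (Suc q))"
    and Fh: "\<And>xs. F xs \<ominus>\<^bsub>Q (Suc q)\<^esub> ?D (Suc q) h xs \<in> T (Suc q)"
    using Suc.IH[OF F] by blast
  note hc = cochainsD[OF h]
  have Dhc: "?D (Suc q) h xs \<in> ?C (Suc q)" for xs by (rule kc[OF hc])
  \<comment> \<open>Lift \<open>h\<close> through \<open>d q\<close> modulo torsion, choosing zero
    where \<open>h\<close> vanishes in order to keep the degree bound.\<close>
  have "\<exists>y\<in>?C q. (h xs = \<zero>\<^bsub>Q (Suc q)\<^esub> \<longrightarrow> y = \<zero>\<^bsub>Q q\<^esub>) \<and> h xs \<ominus>\<^bsub>Q (Suc q)\<^esub> d q y \<in> T (Suc q)" for xs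
  proof (cases "h xs = \<zero>\<^bsub>Q (Suc q)\<^esub>")
    case True
    then show ?thesis using d_zero[of q] Q.submodule_zero[OF T_submodule[of "Suc q"]]
      by (intro bexI[of _ "\<zero>\<^bsub>Q q\<^esub>"]) simp_all
  next
    case False
    then show ?thesis using exact_mod_torsion[OF van hc dh] by blast
  qed
  then obtain k where kC: "\<And>xs. k xs \<in> ?C q" and k0: "\<And>xs. h xs = \<zero>\<^bsub>Q (Suc q)\<^esub> \<Longrightarrow> k xs = \<zero>\<^bsub>Q q\<^esub>"
    and hk: "\<And>xs. h xs \<ominus>\<^bsub>Q (Suc q)\<^esub> d q (k xs) \<in> T (Suc q)" by metis
  have k: "k \<in> cochains (Q q) ?n (j - 1) (?C q)" using h kC k0 unfolding cochains_def by blast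
  \<comment> \<open>Subtracting a Koszul coboundary does not change the Koszul differential, while
    up to torsion it removes the defect \<open>F\<close>.\<close>
  define g where "g = (\<lambda>xs. g' xs \<ominus>\<^bsub>Q q\<^esub> ?D q k xs)"
  have g: "g \<in> cochains (Q q) ?n j (?C q)"
    unfolding g_def by (rule Q.cochains_diff[OF sub g' Q.koszul_d_cochain_pred[OF sub as(1) k]])
  have Dkc: "?D q k xs \<in> ?C q" for xs by (rule kc[OF kC])
  have DDk: "?D q (?D q k) xs = \<zero>\<^bsub>Q q\<^esub>" for xs by (rule Q.koszul_d_d[OF as(1) kC])
  have dkc: "d q (k xs) \<in> ?C (Suc q)" for xs by (rule d_closed[OF kC])
  have "d q (g xs) \<in> T (Suc q)" for xs
  proof -
    have "?D (Suc q) (\<lambda>xs. h xs \<ominus>\<^bsub>Q (Suc q)\<^esub> d q (k xs)) xs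
        = ?D (Suc q) h xs \<ominus>\<^bsub>Q (Suc q)\<^esub> ?D (Suc q) (\<lambda>xs. d q (k xs)) xs"
      by (rule Q.koszul_d_diff[OF as(1) hc dkc])
    also have "?D (Suc q) (\<lambda>xs. d q (k xs)) xs = d q (?D q k xs)"
      by (rule koszul_d_hom[OF Q_module Q_module d_hom as(1) kC])
    finally have 1: "?D (Suc q) h xs \<ominus>\<^bsub>Q (Suc q)\<^esub> d q (?D q k xs) \<in> T (Suc q)"
      using Q.koszul_d_mem[OF T_submodule[of "Suc q"] as(1), of "\<lambda>xs. h xs \<ominus>\<^bsub>Q (Suc q)\<^esub> d q (k xs)" xs] hk by simp
    have "d q (g xs) = F xs \<ominus>\<^bsub>Q (Suc q)\<^esub> d q (?D q k xs)"
      unfolding g_def F_def by (rule d_diff[OF g'c Dkc])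
    also have "\<dots> = (F xs \<ominus>\<^bsub>Q (Suc q)\<^esub> ?D (Suc q) h xs) \<oplus>\<^bsub>Q (Suc q)\<^esub> (?D (Suc q) h xs \<ominus>\<^bsub>Q (Suc q)\<^esub> d q (?D q k xs))"
      using Fc[of xs] Dhc[of xs] d_closed[OF Dkc[of xs]]
      by (simp add: a_minus_def Q.M.a_assoc Q.M.r_neg1)
    finally show ?thesis using Q.submoduleE(5)[OF T_submodule Fh 1] by simp
  qed
  moreover have "f xs \<ominus>\<^bsub>Q q\<^esub> ?D q g xs \<in> T q" for xs
  proof -
    have "?D q g xs = ?D q g' xs \<ominus>\<^bsub>Q q\<^esub> ?D q (?D q k) xs"
      unfolding g_def by (rule Q.koszul_d_diff[OF as(1) g'c Dkc])
    also have "\<dots> = ?D q g' xs"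
      using DDk[of xs] Dg'c[of xs] by (simp add: a_minus_def)
    finally show ?thesis using fg' by simp
  qed
  ultimately show ?case using g by auto
qed

text \<open>The least such \<open>V\<close> is \<open>I W + T 0\<close>; quantifying over
  \<open>V\<close> avoids finite sums. The chase, started at the top-degree cochain with value
  \<open>\<epsilon> \<one>\<close>, returns \<open>g\<close> with values in \<open>W\<close> whose
  Koszul differential agrees with \<open>\<epsilon> \<one>\<close> modulo
  \<open>T 0\<close>.\<close>

lemma eps_one_mem:
  assumes van: "\<And>i. i \<ge> 2 \<Longrightarrow> zero_module (local_cohomology R I Q d i)"
    and V: "submodule V R (Q 0)" "\<And>t. t \<in> T 0 \<Longrightarrow> t \<in> V" "\<And>a w. a \<in> I \<Longrightarrow> w \<in> W \<Longrightarrow> a \<odot>\<^bsub>Q 0\<^esub> w \<in> V"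
  shows "\<epsilon> \<one> \<in> V"
proof -
  obtain A where "A \<subseteq> carrier R" "finite A" "I = genideal R A" using finetely_gen[OF I] by blast
  then obtain as where as: "set as \<subseteq> carrier R" "I = genideal R (set as)" by (metis finite_list)
  let ?top = "replicate (length as) True"
  define f where "f xs = (if xs = ?top then \<epsilon> \<one> else \<zero>\<^bsub>Q 0\<^esub>)" for xs
  \<comment> \<open>The bound is \<open>Suc (length as)\<close> because \<open>cochains\<close> only
    admits degrees strictly below its bound.\<close>
  have f: "f \<in> cochains (Q 0) (length as) (Suc (length as)) (carrier (Q 0))"
    by (auto simp: cochains_def f_def eps_closed)
  have "\<exists>g\<in>cochains (Q 0) (length as) (Suc (length as) - 1) (carrier (Q 0)).
      (\<forall>xs. d 0 (g xs) \<in> T (Suc 0)) \<and> (\<forall>xs. f xs \<ominus>\<^bsub>Q 0\<^esub> koszul_d (Q 0) as g xs \<in> T 0)"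
  proof (rule koszul_double_complex_chase[OF van as f])
    show "d 0 (f xs) \<in> T (Suc 0)" for xs
      using d_eps[of \<one>] d_zero[of 0] Q.submodule_zero[OF T_submodule[of "Suc 0"]] by (simp add: f_def)
    show "koszul_d (Q 0) as f xs \<in> T 0" for xs
      using Q.koszul_d_top[OF as(1), of f 0 xs] Q.submodule_zero[OF T_submodule[of 0]] by (simp add: f_def)
  qed
  then obtain g where g: "g \<in> cochains (Q 0) (length as) (length as) (carrier (Q 0))"
    "\<And>xs. d 0 (g xs) \<in> T (Suc 0)" "\<And>xs. f xs \<ominus>\<^bsub>Q 0\<^esub> koszul_d (Q 0) as g xs \<in> T 0" by auto
  have gW: "g xs \<in> W" for xs using g(2) cochainsD[OF g(1)] by (simp add: W_def)
  have kV: "koszul_d (Q 0) as g ?top \<in> V"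
  proof (rule Q.koszul_d_mem_of_smult[OF V(1) as(1) cochainsD[OF g(1)]])
    fix a xs assume "a \<in> set as"
    then have "a \<in> I" using genideal_self[OF as(1)] as(2) by blast
    then show "a \<odot>\<^bsub>Q 0\<^esub> g xs \<in> V" using V(3) gW by blast
  qed
  have "\<epsilon> \<one> \<ominus>\<^bsub>Q 0\<^esub> koszul_d (Q 0) as g ?top \<in> V" using V(2)[OF g(3), of ?top] by (simp add: f_def)
  then have "(\<epsilon> \<one> \<ominus>\<^bsub>Q 0\<^esub> koszul_d (Q 0) as g ?top) \<oplus>\<^bsub>Q 0\<^esub> koszul_d (Q 0) as g ?top \<in> V"
    using Q.submoduleE(5)[OF V(1)] kV by blast
  moreover have "koszul_d (Q 0) as g ?top \<in> carrier (Q 0)" using kV Q.submoduleE(1)[OF V(1)] by blast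
  ultimately show ?thesis by (simp add: a_minus_def Q.M.a_assoc Q.M.l_neg eps_closed)
qed

end

section \<open>The first local cohomology module\<close>

context ideal_and_resolution
begin

lemma I_pow_carrier: "a \<in> I \<Longrightarrow> a [^] (n::nat) \<in> carrier R"
  using I_sub by auto

text \<open>Multiplication in the ideal transform: \<open>u\<close> represents the product of \<open>v\<close> and \<open>w\<close>.\<close>

lemma exists_product:
  assumes v: "v \<in> W" and w: "w \<in> W"
  shows "\<exists>u\<in>W. \<forall>c\<in>carrier R. \<forall>b\<in>carrier R. c \<odot>\<^bsub>Q 0\<^esub> v = \<epsilon> b \<longrightarrow> c \<odot>\<^bsub>Q 0\<^esub> u = b \<odot>\<^bsub>Q 0\<^esub> w"
proof -
  note vc = W_carrier[OF v] and wc = W_carrier[OF w]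
  have E: "submodule (\<epsilon> ` carrier R) R (Q 0)"
  proof (rule Q.submoduleI)
    show "\<epsilon> ` carrier R \<subseteq> carrier (Q 0)" using eps_closed by blast
    show "\<zero>\<^bsub>Q 0\<^esub> \<in> \<epsilon> ` carrier R" using imageI[OF zero_closed, of \<epsilon>] eps_zero by simp
    show sm: "a \<odot>\<^bsub>Q 0\<^esub> x \<in> \<epsilon> ` carrier R" if a: "a \<in> carrier R" and x: "x \<in> \<epsilon> ` carrier R" for a x
    proof -
      obtain b where b: "b \<in> carrier R" "x = \<epsilon> b" using x by blast
      then have "a \<odot>\<^bsub>Q 0\<^esub> x = \<epsilon> (a \<otimes> b)" using a by (simp add: eps_mult)
      then show ?thesis using a b by simp
    qed
    show "\<ominus>\<^bsub>Q 0\<^esub> x \<in> \<epsilon> ` carrier R" if "x \<in> \<epsilon> ` carrier R" for x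
      using sm[OF _ that, of "\<ominus> \<one>"] that by (auto simp: Q.smult_l_minus eps_closed)
    show "x \<oplus>\<^bsub>Q 0\<^esub> y \<in> \<epsilon> ` carrier R" if xy: "x \<in> \<epsilon> ` carrier R" "y \<in> \<epsilon> ` carrier R" for x y
    proof -
      obtain b b' where b: "b \<in> carrier R" "x = \<epsilon> b" "b' \<in> carrier R" "y = \<epsilon> b'" using xy by blast
      then have "x \<oplus>\<^bsub>Q 0\<^esub> y = \<epsilon> (b \<oplus> b')" by (simp add: eps_add)
      then show ?thesis using b by simp
    qed
  qed
  \<comment> \<open>\<open>C\<close> consists of the denominators of \<open>v\<close>, and
    \<open>\<beta> c\<close> is the numerator belonging to \<open>c\<close>. Baer's criterion for
    the map \<open>c\<close> to \<open>\<beta> c\<close> times \<open>w\<close> produces the product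
    \<open>u\<close>.\<close>
  define C where "C = {c \<in> carrier R. c \<odot>\<^bsub>Q 0\<^esub> v \<in> \<epsilon> ` carrier R}"
  have C: "ideal C R" unfolding C_def by (rule Q.annihilator_ideal[OF E vc])
  define \<beta> where "\<beta> c = (SOME b. b \<in> carrier R \<and> c \<odot>\<^bsub>Q 0\<^esub> v = \<epsilon> b)" for c
  have \<beta>: "\<beta> c \<in> carrier R" "c \<odot>\<^bsub>Q 0\<^esub> v = \<epsilon> (\<beta> c)" if c: "c \<in> C" for c
  proof -
    have "\<exists>b. b \<in> carrier R \<and> c \<odot>\<^bsub>Q 0\<^esub> v = \<epsilon> b" using c by (auto simp: C_def)
    from someI_ex[OF this] show "\<beta> c \<in> carrier R" "c \<odot>\<^bsub>Q 0\<^esub> v = \<epsilon> (\<beta> c)"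
      unfolding \<beta>_def by blast+
  qed
  have \<beta>_eq: "\<beta> c = b" if "c \<in> carrier R" "b \<in> carrier R" "c \<odot>\<^bsub>Q 0\<^esub> v = \<epsilon> b" for c b
  proof -
    have "c \<in> C" using that by (auto simp: C_def)
    then show ?thesis using \<beta>[of c] that eps_inj by simp
  qed
  have Cc: "c \<in> carrier R" if "c \<in> C" for c using that by (simp add: C_def)
  have "\<exists>u\<in>carrier (Q 0). \<forall>c\<in>C. \<beta> c \<odot>\<^bsub>Q 0\<^esub> w = c \<odot>\<^bsub>Q 0\<^esub> u"
  proof (rule injective_module_baer[OF Q_injective C])
    show "\<beta> c \<odot>\<^bsub>Q 0\<^esub> w \<in> carrier (Q 0)" if "c \<in> C" for c using \<beta>[OF that] wc by simp
    show "\<beta> (a \<oplus> b) \<odot>\<^bsub>Q 0\<^esub> w = \<beta> a \<odot>\<^bsub>Q 0\<^esub> w \<oplus>\<^bsub>Q 0\<^esub> \<beta> b \<odot>\<^bsub>Q 0\<^esub> w" if ab: "a \<in> C" "b \<in> C" for a b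
    proof -
      have "\<beta> (a \<oplus> b) = \<beta> a \<oplus> \<beta> b"
        by (rule \<beta>_eq) (use ab Cc \<beta> vc in \<open>simp_all add: Q.smult_l_distr eps_add\<close>)
      then show ?thesis using ab \<beta> wc by (simp add: Q.smult_l_distr)
    qed
    show "\<beta> (r \<otimes> a) \<odot>\<^bsub>Q 0\<^esub> w = r \<odot>\<^bsub>Q 0\<^esub> (\<beta> a \<odot>\<^bsub>Q 0\<^esub> w)" if ra: "r \<in> carrier R" "a \<in> C" for r a
    proof -
      have "\<beta> (r \<otimes> a) = r \<otimes> \<beta> a"
        by (rule \<beta>_eq) (use ra Cc \<beta> vc in \<open>simp_all add: Q.smult_assoc1 eps_mult\<close>)
      then show ?thesis using ra \<beta> wc by (simp add: Q.smult_assoc1)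
    qed
  qed
  then obtain u where u: "u \<in> carrier (Q 0)" and uC: "\<And>c. c \<in> C \<Longrightarrow> c \<odot>\<^bsub>Q 0\<^esub> u = \<beta> c \<odot>\<^bsub>Q 0\<^esub> w" by force
  have ub: "c \<odot>\<^bsub>Q 0\<^esub> u = b \<odot>\<^bsub>Q 0\<^esub> w" if "c \<in> carrier R" "b \<in> carrier R" "c \<odot>\<^bsub>Q 0\<^esub> v = \<epsilon> b" for c b
  proof -
    have "c \<in> C" using that by (auto simp: C_def)
    then show ?thesis using uC \<beta>_eq[OF that] by simp
  qed
  \<comment> \<open>A power of each \<open>a\<close> in \<open>I\<close> is a denominator of
    \<open>v\<close>, and it sends \<open>u\<close> to a multiple of \<open>w\<close>; saturation of
    \<open>W\<close> does the rest.\<close>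
  have "u \<in> W"
  proof (rule W_I[OF u])
    fix a assume a: "a \<in> I"
    obtain n :: nat and b where n: "b \<in> carrier R" "a [^] n \<odot>\<^bsub>Q 0\<^esub> v = \<epsilon> b" using W_pow[OF v a] by blast
    then have "a [^] n \<odot>\<^bsub>Q 0\<^esub> u = b \<odot>\<^bsub>Q 0\<^esub> w" using ub I_pow_carrier[OF a] by blast
    then have "a [^] n \<odot>\<^bsub>Q 0\<^esub> u \<in> W" using Q.submoduleE(4)[OF W_submodule n(1) w] by simp
    then show "\<exists>n::nat. a [^] n \<odot>\<^bsub>Q 0\<^esub> u \<in> W" ..
  qed
  then show ?thesis using ub by blast
qed

text \<open>As one lies in \<open>I S\<close>, so does \<open>w\<close>. Here \<open>V\<close>
  collects those \<open>v\<close> that have a product with \<open>w\<close>, modulo torsion, on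
  which \<open>\<psi>\<close> vanishes. It contains \<open>T 0\<close> and all \<open>a v\<close>,
  hence \<open>\<epsilon> \<one>\<close>, whose product with \<open>w\<close> is \<open>w\<close>
  itself.\<close>

lemma vanish_on_W:
  assumes van: "\<And>i. i \<ge> 2 \<Longrightarrow> zero_module (local_cohomology R I Q d i)"
    and N: "module R N" and \<psi>: "\<psi> \<in> module_homs R ((Q 0)\<lparr>carrier := W\<rparr>) N"
    and \<psi>T: "\<And>t. t \<in> T 0 \<Longrightarrow> \<psi> t = \<zero>\<^bsub>N\<^esub>"
    and \<psi>I: "\<And>a w. a \<in> I \<Longrightarrow> w \<in> W \<Longrightarrow> a \<odot>\<^bsub>N\<^esub> \<psi> w = \<zero>\<^bsub>N\<^esub>"
    and w: "w \<in> W"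
  shows "\<psi> w = \<zero>\<^bsub>N\<^esub>"
proof -
  interpret N: module R N by fact
  note WE = Q.submoduleE[OF W_submodule] and W0 = Q.submodule_zero[OF W_submodule]
  note TE = Q.submoduleE[OF T_submodule[of 0]] and T0 = Q.submodule_zero[OF T_submodule[of 0]]
  have \<psi>add: "\<psi> (x \<oplus>\<^bsub>Q 0\<^esub> y) = \<psi> x \<oplus>\<^bsub>N\<^esub> \<psi> y" if "x \<in> W" "y \<in> W" for x y
    using module_homsD(2)[OF \<psi>] that by simp
  have \<psi>sm: "\<psi> (r \<odot>\<^bsub>Q 0\<^esub> x) = r \<odot>\<^bsub>N\<^esub> \<psi> x" if "r \<in> carrier R" "x \<in> W" for r x
    using module_homsD(3)[OF \<psi>] that by simp
  have \<psi>c: "\<psi> x \<in> carrier N" if "x \<in> W" for x using module_homsD(1)[OF \<psi>] that by simp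
  note wc = W_carrier[OF w]
  \<comment> \<open>\<open>u\<close> represents the product of \<open>v\<close> with the fixed
    \<open>w\<close> only up to torsion; this slack is used for members of \<open>T 0\<close> and
    for sums.\<close>
  define prod where "prod v u \<longleftrightarrow> (\<forall>c\<in>carrier R. \<forall>b\<in>carrier R. c \<odot>\<^bsub>Q 0\<^esub> v = \<epsilon> b \<longrightarrow>
    c \<odot>\<^bsub>Q 0\<^esub> u \<ominus>\<^bsub>Q 0\<^esub> b \<odot>\<^bsub>Q 0\<^esub> w \<in> T 0)" for v u
  define V where "V = {v \<in> W. \<exists>u\<in>W. \<psi> u = \<zero>\<^bsub>N\<^esub> \<and> prod v u}"
  have VI: "v \<in> V" if "v \<in> W" "u \<in> W" "\<psi> u = \<zero>\<^bsub>N\<^esub>" "prod v u" for v u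
    using that unfolding V_def by blast
  have VT: "t \<in> V" if t: "t \<in> T 0" for t
  proof (rule VI[OF T_W[OF t] W0])
    show "\<psi> \<zero>\<^bsub>Q 0\<^esub> = \<zero>\<^bsub>N\<^esub>" by (rule \<psi>T[OF T0])
    show "prod t \<zero>\<^bsub>Q 0\<^esub>"
      unfolding prod_def
    proof (intro ballI impI)
      fix c b assume c: "c \<in> carrier R" "b \<in> carrier R" "c \<odot>\<^bsub>Q 0\<^esub> t = \<epsilon> b"
      \<comment> \<open>Since \<open>\<epsilon> b = c t\<close> is torsion and
        \<open>\<epsilon>\<close> is injective, a power of each \<open>a\<close> kills
        \<open>b\<close> and with it \<open>b w\<close>; thus zero is a product of \<open>t\<close>
        with \<open>w\<close>.\<close>
      have "b \<odot>\<^bsub>Q 0\<^esub> w \<in> T 0"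
      proof (rule T_I)
        show "b \<odot>\<^bsub>Q 0\<^esub> w \<in> carrier (Q 0)" using c wc by simp
        fix a assume a: "a \<in> I"
        have "\<epsilon> b \<in> T 0" using TE(4)[OF c(1) t] c(3) by simp
        then obtain n :: nat where n: "a [^] n \<odot>\<^bsub>Q 0\<^esub> \<epsilon> b = \<zero>\<^bsub>Q 0\<^esub>" using T_pow a by blast
        have an: "a [^] n \<in> carrier R" by (rule I_pow_carrier[OF a])
        then have "\<epsilon> (a [^] n \<otimes> b) = \<epsilon> \<zero>" using n c by (simp add: eps_mult eps_zero)
        then have "a [^] n \<otimes> b = \<zero>" by (rule eps_inj[rotated 2]) (use an c in simp_all)
        then have "a [^] n \<odot>\<^bsub>Q 0\<^esub> (b \<odot>\<^bsub>Q 0\<^esub> w) = \<zero>\<^bsub>Q 0\<^esub>"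
          using an c wc by (simp add: Q.smult_assoc1[symmetric])
        then show "\<exists>n::nat. a [^] n \<odot>\<^bsub>Q 0\<^esub> (b \<odot>\<^bsub>Q 0\<^esub> w) \<in> T 0" using T0 by (intro exI[of _ n]) simp
      qed
      moreover have "c \<odot>\<^bsub>Q 0\<^esub> \<zero>\<^bsub>Q 0\<^esub> = \<zero>\<^bsub>Q 0\<^esub>" using c by simp
      ultimately show "c \<odot>\<^bsub>Q 0\<^esub> \<zero>\<^bsub>Q 0\<^esub> \<ominus>\<^bsub>Q 0\<^esub> b \<odot>\<^bsub>Q 0\<^esub> w \<in> T 0"
        using Q.submodule_diff[OF T_submodule[of 0] T0] by simp
    qed
  qed
  have Vsm: "r \<odot>\<^bsub>Q 0\<^esub> v \<in> V" if r: "r \<in> carrier R" and v: "v \<in> V" for r v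
  proof -
    obtain u where u: "v \<in> W" "u \<in> W" "\<psi> u = \<zero>\<^bsub>N\<^esub>" "prod v u" using v by (auto simp: V_def)
    show ?thesis
    proof (rule VI[OF WE(4)[OF r u(1)] WE(4)[OF r u(2)]])
      show "\<psi> (r \<odot>\<^bsub>Q 0\<^esub> u) = \<zero>\<^bsub>N\<^esub>" using \<psi>sm r u by simp
      show "prod (r \<odot>\<^bsub>Q 0\<^esub> v) (r \<odot>\<^bsub>Q 0\<^esub> u)"
        unfolding prod_def
      proof (intro ballI impI)
        fix c b assume c: "c \<in> carrier R" "b \<in> carrier R" "c \<odot>\<^bsub>Q 0\<^esub> (r \<odot>\<^bsub>Q 0\<^esub> v) = \<epsilon> b"
        then have "(c \<otimes> r) \<odot>\<^bsub>Q 0\<^esub> v = \<epsilon> b" using r W_carrier[OF u(1)] by (simp add: Q.smult_assoc1)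
        then have "(c \<otimes> r) \<odot>\<^bsub>Q 0\<^esub> u \<ominus>\<^bsub>Q 0\<^esub> b \<odot>\<^bsub>Q 0\<^esub> w \<in> T 0"
          using u(4) c r unfolding prod_def by blast
        then show "c \<odot>\<^bsub>Q 0\<^esub> (r \<odot>\<^bsub>Q 0\<^esub> u) \<ominus>\<^bsub>Q 0\<^esub> b \<odot>\<^bsub>Q 0\<^esub> w \<in> T 0"
          using c r W_carrier[OF u(2)] by (simp add: Q.smult_assoc1)
      qed
    qed
  qed
  have "\<epsilon> \<one> \<in> V"
  proof (rule eps_one_mem[OF van _ VT])
    show "submodule V R (Q 0)"
    proof (rule Q.submoduleI)
      show "V \<subseteq> carrier (Q 0)" using W_carrier by (auto simp: V_def)
      show "\<zero>\<^bsub>Q 0\<^esub> \<in> V" by (rule VT[OF T0])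
      show "a \<odot>\<^bsub>Q 0\<^esub> x \<in> V" if "a \<in> carrier R" "x \<in> V" for a x by (rule Vsm[OF that])
      show "\<ominus>\<^bsub>Q 0\<^esub> v \<in> V" if v: "v \<in> V" for v
      proof -
        have "v \<in> carrier (Q 0)" using v W_carrier by (auto simp: V_def)
        then have "\<ominus>\<^bsub>Q 0\<^esub> v = (\<ominus> \<one>) \<odot>\<^bsub>Q 0\<^esub> v" by (simp add: Q.smult_l_minus)
        then show ?thesis using Vsm[OF _ v, of "\<ominus> \<one>"] by simp
      qed
      fix v v' assume v: "v \<in> V" and v': "v' \<in> V"
      obtain u where u: "v \<in> W" "u \<in> W" "\<psi> u = \<zero>\<^bsub>N\<^esub>" "prod v u" using v by (auto simp: V_def)
      obtain u' where u': "v' \<in> W" "u' \<in> W" "\<psi> u' = \<zero>\<^bsub>N\<^esub>" "prod v' u'" using v' by (auto simp: V_def)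
      note cc = W_carrier[OF u(1)] W_carrier[OF u(2)] W_carrier[OF u'(1)] W_carrier[OF u'(2)]
      show "v \<oplus>\<^bsub>Q 0\<^esub> v' \<in> V"
      proof (rule VI[OF WE(5)[OF u(1) u'(1)] WE(5)[OF u(2) u'(2)]])
        show "\<psi> (u \<oplus>\<^bsub>Q 0\<^esub> u') = \<zero>\<^bsub>N\<^esub>" using \<psi>add u u' by simp
        show "prod (v \<oplus>\<^bsub>Q 0\<^esub> v') (u \<oplus>\<^bsub>Q 0\<^esub> u')"
          unfolding prod_def
        proof (intro ballI impI)
          fix c b assume c: "c \<in> carrier R" "b \<in> carrier R" and cb: "c \<odot>\<^bsub>Q 0\<^esub> (v \<oplus>\<^bsub>Q 0\<^esub> v') = \<epsilon> b"
          show "c \<odot>\<^bsub>Q 0\<^esub> (u \<oplus>\<^bsub>Q 0\<^esub> u') \<ominus>\<^bsub>Q 0\<^esub> b \<odot>\<^bsub>Q 0\<^esub> w \<in> T 0" (is "?x \<in> _")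
          proof (rule T_I)
            show "?x \<in> carrier (Q 0)" using c cc wc by simp
            fix a assume a: "a \<in> I"
            \<comment> \<open>That \<open>c (v + v')\<close> comes from \<open>R\<close> does not
              imply the same for \<open>c v\<close>. After multiplication by \<open>e = a^n\<close>
              both summands come from \<open>R\<close>, and saturation of \<open>T 0\<close> removes
              \<open>e\<close> again.\<close>
            obtain n :: nat and b1 where n: "b1 \<in> carrier R" "a [^] n \<odot>\<^bsub>Q 0\<^esub> (c \<odot>\<^bsub>Q 0\<^esub> v) = \<epsilon> b1"
              using W_pow[OF WE(4)[OF c(1) u(1)] a] by blast
            define e where "e = a [^] n"
            have e: "e \<in> carrier R" unfolding e_def by (rule I_pow_carrier[OF a])
            have n: "(e \<otimes> c) \<odot>\<^bsub>Q 0\<^esub> v = \<epsilon> b1" using n e c cc by (simp add: e_def Q.smult_assoc1)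
            have "(e \<otimes> c) \<odot>\<^bsub>Q 0\<^esub> v' = \<epsilon> (e \<otimes> b \<ominus> b1)"
            proof -
              have "\<epsilon> (e \<otimes> b) = (e \<otimes> c) \<odot>\<^bsub>Q 0\<^esub> (v \<oplus>\<^bsub>Q 0\<^esub> v')"
                using e c cc cb by (simp add: eps_mult Q.smult_assoc1)
              also have "\<dots> = (e \<otimes> c) \<odot>\<^bsub>Q 0\<^esub> v' \<oplus>\<^bsub>Q 0\<^esub> \<epsilon> b1"
                using e c cc n by (simp add: Q.smult_r_distr Q.M.a_comm)
              finally show ?thesis
                using e c cc \<open>b1 \<in> carrier R\<close> by (simp add: eps_diff) (simp add: eps_closed a_minus_def Q.M.a_assoc Q.M.r_neg)
            qed
            then have 2: "(e \<otimes> c) \<odot>\<^bsub>Q 0\<^esub> u' \<ominus>\<^bsub>Q 0\<^esub> (e \<otimes> b \<ominus> b1) \<odot>\<^bsub>Q 0\<^esub> w \<in> T 0"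
              using u'(4) e c \<open>b1 \<in> carrier R\<close> unfolding prod_def by simp
            have 1: "(e \<otimes> c) \<odot>\<^bsub>Q 0\<^esub> u \<ominus>\<^bsub>Q 0\<^esub> b1 \<odot>\<^bsub>Q 0\<^esub> w \<in> T 0"
              using n u(4) e c \<open>b1 \<in> carrier R\<close> unfolding prod_def by simp
            have "e \<odot>\<^bsub>Q 0\<^esub> ?x = ((e \<otimes> c) \<odot>\<^bsub>Q 0\<^esub> u \<ominus>\<^bsub>Q 0\<^esub> b1 \<odot>\<^bsub>Q 0\<^esub> w) \<oplus>\<^bsub>Q 0\<^esub>
                ((e \<otimes> c) \<odot>\<^bsub>Q 0\<^esub> u' \<ominus>\<^bsub>Q 0\<^esub> (e \<otimes> b \<ominus> b1) \<odot>\<^bsub>Q 0\<^esub> w)"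
            proof -
              define A B D F where "A = e \<odot>\<^bsub>Q 0\<^esub> (c \<odot>\<^bsub>Q 0\<^esub> u)" and "B = e \<odot>\<^bsub>Q 0\<^esub> (c \<odot>\<^bsub>Q 0\<^esub> u')"
                and "D = e \<odot>\<^bsub>Q 0\<^esub> (b \<odot>\<^bsub>Q 0\<^esub> w)" and "F = b1 \<odot>\<^bsub>Q 0\<^esub> w"
              have m: "A \<in> carrier (Q 0)" "B \<in> carrier (Q 0)" "D \<in> carrier (Q 0)" "F \<in> carrier (Q 0)"
                using e c cc wc \<open>b1 \<in> carrier R\<close> by (simp_all add: A_def B_def D_def F_def)
              have "e \<odot>\<^bsub>Q 0\<^esub> ?x = (A \<oplus>\<^bsub>Q 0\<^esub> B) \<ominus>\<^bsub>Q 0\<^esub> D"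
                using e c cc wc by (simp add: A_def B_def D_def Q.smult_r_diff Q.smult_r_distr)
              also have "\<dots> = (A \<ominus>\<^bsub>Q 0\<^esub> F) \<oplus>\<^bsub>Q 0\<^esub> (B \<ominus>\<^bsub>Q 0\<^esub> (D \<ominus>\<^bsub>Q 0\<^esub> F))"
              proof -
                have "(A \<ominus>\<^bsub>Q 0\<^esub> F) \<oplus>\<^bsub>Q 0\<^esub> (B \<ominus>\<^bsub>Q 0\<^esub> (D \<ominus>\<^bsub>Q 0\<^esub> F)) =
                    (F \<oplus>\<^bsub>Q 0\<^esub> \<ominus>\<^bsub>Q 0\<^esub> F) \<oplus>\<^bsub>Q 0\<^esub> ((A \<oplus>\<^bsub>Q 0\<^esub> B) \<ominus>\<^bsub>Q 0\<^esub> D)"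
                  using m by (simp add: a_minus_def Q.M.minus_add Q.M.a_ac)
                then show ?thesis using m by (simp add: Q.M.r_neg)
              qed
              finally show ?thesis
                using e c cc wc \<open>b1 \<in> carrier R\<close>
                by (simp add: A_def B_def D_def F_def Q.smult_assoc1 Q.smult_l_diff)
            qed
            then have "e \<odot>\<^bsub>Q 0\<^esub> ?x \<in> T 0" using TE(5)[OF 1 2] by simp
            then show "\<exists>n::nat. a [^] n \<odot>\<^bsub>Q 0\<^esub> ?x \<in> T 0" unfolding e_def ..
          qed
        qed
      qed
    qed
  next
    fix a v assume a: "a \<in> I" and v: "v \<in> W"
    have ac: "a \<in> carrier R" using a I_sub by blast
    \<comment> \<open>As \<open>u\<close> represents the product of \<open>v\<close> and
      \<open>w\<close>, the element \<open>a u\<close> represents that of \<open>a v\<close> and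
      \<open>w\<close>; and \<open>\<psi>\<close> kills it because \<open>a\<close> kills the values
      of \<open>\<psi>\<close>.\<close>
    obtain u where u: "u \<in> W" and uv: "\<And>c b. c \<in> carrier R \<Longrightarrow> b \<in> carrier R \<Longrightarrow> c \<odot>\<^bsub>Q 0\<^esub> v = \<epsilon> b \<Longrightarrow> c \<odot>\<^bsub>Q 0\<^esub> u = b \<odot>\<^bsub>Q 0\<^esub> w"
      using exists_product[OF v w] by blast
    show "a \<odot>\<^bsub>Q 0\<^esub> v \<in> V"
    proof (rule VI[OF WE(4)[OF ac v] WE(4)[OF ac u]])
      show "\<psi> (a \<odot>\<^bsub>Q 0\<^esub> u) = \<zero>\<^bsub>N\<^esub>" using \<psi>sm[OF ac u] \<psi>I[OF a u] by simp
      show "prod (a \<odot>\<^bsub>Q 0\<^esub> v) (a \<odot>\<^bsub>Q 0\<^esub> u)"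
        unfolding prod_def
      proof (intro ballI impI)
        fix c b assume c: "c \<in> carrier R" "b \<in> carrier R" "c \<odot>\<^bsub>Q 0\<^esub> (a \<odot>\<^bsub>Q 0\<^esub> v) = \<epsilon> b"
        then have "(c \<otimes> a) \<odot>\<^bsub>Q 0\<^esub> v = \<epsilon> b" using ac W_carrier[OF v] by (simp add: Q.smult_assoc1)
        then have "(c \<otimes> a) \<odot>\<^bsub>Q 0\<^esub> u = b \<odot>\<^bsub>Q 0\<^esub> w" using uv c ac by simp
        then have "c \<odot>\<^bsub>Q 0\<^esub> (a \<odot>\<^bsub>Q 0\<^esub> u) = b \<odot>\<^bsub>Q 0\<^esub> w" using c ac W_carrier[OF u] by (simp add: Q.smult_assoc1)
        then have "c \<odot>\<^bsub>Q 0\<^esub> (a \<odot>\<^bsub>Q 0\<^esub> u) \<ominus>\<^bsub>Q 0\<^esub> b \<odot>\<^bsub>Q 0\<^esub> w = \<zero>\<^bsub>Q 0\<^esub>" using c wc by simp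
        then show "c \<odot>\<^bsub>Q 0\<^esub> (a \<odot>\<^bsub>Q 0\<^esub> u) \<ominus>\<^bsub>Q 0\<^esub> b \<odot>\<^bsub>Q 0\<^esub> w \<in> T 0" using T0 by simp
      qed
    qed
  qed
  then obtain u where u: "u \<in> W" "\<psi> u = \<zero>\<^bsub>N\<^esub>" "prod (\<epsilon> \<one>) u" by (auto simp: V_def)
  \<comment> \<open>Taking both scalars equal to one shows that a product of
    \<open>\<epsilon> \<one>\<close> with \<open>w\<close> is \<open>w\<close> modulo
    torsion.\<close>
  have "\<one> \<odot>\<^bsub>Q 0\<^esub> u \<ominus>\<^bsub>Q 0\<^esub> \<one> \<odot>\<^bsub>Q 0\<^esub> w \<in> T 0"
    using u(3) eps_closed[of \<one>] unfolding prod_def by simp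
  then have uw: "u \<ominus>\<^bsub>Q 0\<^esub> w \<in> T 0" using W_carrier[OF u(1)] wc by simp
  have "u \<ominus>\<^bsub>Q 0\<^esub> w \<oplus>\<^bsub>Q 0\<^esub> w = u"
    using W_carrier[OF u(1)] wc by (simp add: a_minus_def Q.M.a_assoc Q.M.l_neg)
  then have "\<psi> u = \<psi> (u \<ominus>\<^bsub>Q 0\<^esub> w) \<oplus>\<^bsub>N\<^esub> \<psi> w" using \<psi>add[OF T_W[OF uw] w] by simp
  then show ?thesis using \<psi>T[OF uw] \<psi>c[OF w] u(2) by simp
qed

text \<open>Assumption \<open>div\<close> says that \<open>r\<close> is surjective on the first
  local cohomology. Apply \<open>eps_one_mem\<close> to \<open>V\<close>, the sum of
  \<open>r W\<close>, \<open>T 0\<close> and the image of \<open>I\<close>: multiplying a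
  decomposition of \<open>w\<close> by \<open>a\<close> in \<open>I\<close> moves its coefficient
  \<open>c\<close> into \<open>I\<close>. So \<open>1 - c\<close> is \<open>r s\<close> up to
  torsion for some \<open>c\<close> in \<open>I\<close>.\<close>

lemma pow_mem_of_divisible:
  assumes van: "\<And>i. i \<ge> 2 \<Longrightarrow> zero_module (local_cohomology R I Q d i)"
    and r: "r \<in> carrier R" and unit: "\<And>c. c \<in> I \<Longrightarrow> \<one> \<ominus> c \<in> Units R"
    and div: "\<And>w. w \<in> W \<Longrightarrow> \<exists>s\<in>W. \<exists>t\<in>T 0. \<exists>c\<in>carrier R. w = r \<odot>\<^bsub>Q 0\<^esub> s \<oplus>\<^bsub>Q 0\<^esub> t \<oplus>\<^bsub>Q 0\<^esub> \<epsilon> c"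
    and a: "a \<in> I"
  shows "\<exists>n::nat. \<exists>b\<in>carrier R. a [^] n = r \<otimes> b"
proof -
  note WE = Q.submoduleE[OF W_submodule] and W0 = Q.submodule_zero[OF W_submodule]
  note TE = Q.submoduleE[OF T_submodule[of 0]] and T0 = Q.submodule_zero[OF T_submodule[of 0]]
  define V where "V = {r \<odot>\<^bsub>Q 0\<^esub> s \<oplus>\<^bsub>Q 0\<^esub> t \<oplus>\<^bsub>Q 0\<^esub> \<epsilon> c | s t c. s \<in> W \<and> t \<in> T 0 \<and> c \<in> I}"
  have VI: "r \<odot>\<^bsub>Q 0\<^esub> s \<oplus>\<^bsub>Q 0\<^esub> t \<oplus>\<^bsub>Q 0\<^esub> \<epsilon> c \<in> V" if "s \<in> W" "t \<in> T 0" "c \<in> I" for s t c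
    using that unfolding V_def by blast
  have Ic: "c \<in> carrier R" if "c \<in> I" for c using that I_sub by blast
  have sm: "e \<odot>\<^bsub>Q 0\<^esub> (r \<odot>\<^bsub>Q 0\<^esub> s \<oplus>\<^bsub>Q 0\<^esub> t \<oplus>\<^bsub>Q 0\<^esub> \<epsilon> c) =
      r \<odot>\<^bsub>Q 0\<^esub> (e \<odot>\<^bsub>Q 0\<^esub> s) \<oplus>\<^bsub>Q 0\<^esub> e \<odot>\<^bsub>Q 0\<^esub> t \<oplus>\<^bsub>Q 0\<^esub> \<epsilon> (e \<otimes> c)"
    if "s \<in> W" "t \<in> T 0" "c \<in> carrier R" "e \<in> carrier R" for s t c e
    using that W_carrier[OF that(1)] T_carrier[OF that(2)] r
    by (simp add: Q.smult_r_distr eps_closed eps_mult Q.smult_left_commute[of e r])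
  have Vsm: "e \<odot>\<^bsub>Q 0\<^esub> v \<in> V" if e: "e \<in> carrier R" and v: "v \<in> V" for e v
  proof -
    obtain s t c where "s \<in> W" "t \<in> T 0" "c \<in> I" "v = r \<odot>\<^bsub>Q 0\<^esub> s \<oplus>\<^bsub>Q 0\<^esub> t \<oplus>\<^bsub>Q 0\<^esub> \<epsilon> c" using v by (auto simp: V_def)
    then show ?thesis using sm e Ic WE(4)[OF e] TE(4)[OF e] VI I.I_l_closed by simp
  qed
  have Vc: "V \<subseteq> carrier (Q 0)" using r W_carrier T_carrier eps_closed Ic by (auto simp: V_def)
  have I0: "\<zero> \<in> I" by simp
  have "\<epsilon> \<one> \<in> V"
  proof (rule eps_one_mem[OF van])
    show "submodule V R (Q 0)"
    proof (rule Q.submoduleI[OF Vc])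
      show "\<zero>\<^bsub>Q 0\<^esub> \<in> V" using VI[OF W0 T0 I0] r eps_zero by simp
      show "a \<odot>\<^bsub>Q 0\<^esub> x \<in> V" if "a \<in> carrier R" "x \<in> V" for a x by (rule Vsm[OF that])
      show "\<ominus>\<^bsub>Q 0\<^esub> v \<in> V" if v: "v \<in> V" for v
      proof -
        have "\<ominus>\<^bsub>Q 0\<^esub> v = (\<ominus> \<one>) \<odot>\<^bsub>Q 0\<^esub> v" using v Vc by (auto simp: Q.smult_l_minus)
        then show ?thesis using Vsm[OF _ v, of "\<ominus> \<one>"] by simp
      qed
      fix v v' assume v: "v \<in> V" and v': "v' \<in> V"
      obtain s t c where 1: "s \<in> W" "t \<in> T 0" "c \<in> I" "v = r \<odot>\<^bsub>Q 0\<^esub> s \<oplus>\<^bsub>Q 0\<^esub> t \<oplus>\<^bsub>Q 0\<^esub> \<epsilon> c" using v by (auto simp: V_def)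
      obtain s' t' c' where 2: "s' \<in> W" "t' \<in> T 0" "c' \<in> I" "v' = r \<odot>\<^bsub>Q 0\<^esub> s' \<oplus>\<^bsub>Q 0\<^esub> t' \<oplus>\<^bsub>Q 0\<^esub> \<epsilon> c'" using v' by (auto simp: V_def)
      have "v \<oplus>\<^bsub>Q 0\<^esub> v' = r \<odot>\<^bsub>Q 0\<^esub> (s \<oplus>\<^bsub>Q 0\<^esub> s') \<oplus>\<^bsub>Q 0\<^esub> (t \<oplus>\<^bsub>Q 0\<^esub> t') \<oplus>\<^bsub>Q 0\<^esub> \<epsilon> (c \<oplus> c')"
        using 1 2 r W_carrier[OF 1(1)] W_carrier[OF 2(1)] T_carrier[OF 1(2)] T_carrier[OF 2(2)] Ic[OF 1(3)] Ic[OF 2(3)]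
        by (simp add: Q.smult_r_distr eps_add eps_closed Q.M.a_ac)
      then show "v \<oplus>\<^bsub>Q 0\<^esub> v' \<in> V"
        using VI WE(5)[OF 1(1) 2(1)] TE(5)[OF 1(2) 2(2)] I.a_closed[OF 1(3) 2(3)] by simp
    qed
    show "t \<in> V" if t: "t \<in> T 0" for t
      using VI[OF W0 t I0] T_carrier[OF t] r eps_zero by simp
    fix a w assume a: "a \<in> I" and w: "w \<in> W"
    obtain s t c where 1: "s \<in> W" "t \<in> T 0" "c \<in> carrier R" "w = r \<odot>\<^bsub>Q 0\<^esub> s \<oplus>\<^bsub>Q 0\<^esub> t \<oplus>\<^bsub>Q 0\<^esub> \<epsilon> c"
      using div[OF w] by blast
    have "a \<otimes> c \<in> I" using I.I_r_closed a 1 by simp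
    then show "a \<odot>\<^bsub>Q 0\<^esub> w \<in> V"
      using sm[OF 1(1-3) Ic[OF a]] 1(4) VI WE(4)[OF Ic[OF a] 1(1)] TE(4)[OF Ic[OF a] 1(2)] by simp
  qed
  then obtain s t c where s: "s \<in> W" and t: "t \<in> T 0" and c: "c \<in> I"
    and eq: "\<epsilon> \<one> = r \<odot>\<^bsub>Q 0\<^esub> s \<oplus>\<^bsub>Q 0\<^esub> t \<oplus>\<^bsub>Q 0\<^esub> \<epsilon> c" by (auto simp: V_def)
  note sc = W_carrier[OF s] and tc = T_carrier[OF t] and cc = Ic[OF c] and ac = Ic[OF a]
  have eq2: "\<epsilon> (\<one> \<ominus> c) = r \<odot>\<^bsub>Q 0\<^esub> s \<oplus>\<^bsub>Q 0\<^esub> t"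
    using eq sc tc cc r by (simp add: eps_diff) (simp add: eps_closed a_minus_def Q.M.a_assoc Q.M.r_neg)
  obtain n :: nat and b where n: "b \<in> carrier R" "a [^] n \<odot>\<^bsub>Q 0\<^esub> s = \<epsilon> b" using W_pow[OF s a] by blast
  \<comment> \<open>The exponent \<open>k + n\<close> serves both purposes: it clears the
    denominator of \<open>s\<close> and kills \<open>t\<close>.\<close>
  obtain k :: nat where k: "a [^] k \<odot>\<^bsub>Q 0\<^esub> t = \<zero>\<^bsub>Q 0\<^esub>" using T_pow[OF t a] by blast
  have s': "a [^] (k + n) \<odot>\<^bsub>Q 0\<^esub> s = \<epsilon> (a [^] k \<otimes> b)"
    using n ac sc by (simp add: nat_pow_mult[symmetric] Q.smult_assoc1 eps_mult)
  have t': "a [^] (k + n) \<odot>\<^bsub>Q 0\<^esub> t = \<zero>\<^bsub>Q 0\<^esub>"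
    by (rule Q.pow_smult_mono[OF ac tc k]) simp
  define e where "e = a [^] (k + n)"
  define b' where "b' = a [^] k \<otimes> b"
  have e: "e \<in> carrier R" and b': "b' \<in> carrier R" using ac n by (simp_all add: e_def b'_def)
  have "\<epsilon> (e \<otimes> (\<one> \<ominus> c)) = \<epsilon> (r \<otimes> b')"
  proof -
    have "\<epsilon> (e \<otimes> (\<one> \<ominus> c)) = e \<odot>\<^bsub>Q 0\<^esub> (r \<odot>\<^bsub>Q 0\<^esub> s \<oplus>\<^bsub>Q 0\<^esub> t)"
      using e cc eq2 by (simp add: eps_mult)
    also have "\<dots> = r \<odot>\<^bsub>Q 0\<^esub> (e \<odot>\<^bsub>Q 0\<^esub> s) \<oplus>\<^bsub>Q 0\<^esub> e \<odot>\<^bsub>Q 0\<^esub> t"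
      using e r sc tc by (simp add: Q.smult_r_distr Q.smult_left_commute[of e r])
    also have "\<dots> = \<epsilon> (r \<otimes> b')"
      using s' t' r b' by (simp add: e_def[symmetric] b'_def[symmetric] eps_mult eps_closed)
    finally show ?thesis .
  qed
  then have ee: "e \<otimes> (\<one> \<ominus> c) = r \<otimes> b'" by (rule eps_inj[rotated 2]) (use e cc r b' in simp_all)
  have U: "\<one> \<ominus> c \<in> Units R" by (rule unit[OF c])
  have "e = r \<otimes> (b' \<otimes> inv (\<one> \<ominus> c))"
  proof -
    have "e = e \<otimes> (\<one> \<ominus> c) \<otimes> inv (\<one> \<ominus> c)" using U e by (simp add: m_assoc Units_closed)
    also have "\<dots> = r \<otimes> b' \<otimes> inv (\<one> \<ominus> c)" using ee by simp
    finally show ?thesis using U r b' by (simp add: m_assoc)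
  qed
  then show ?thesis using U b' unfolding e_def by blast
qed

end

section \<open>The first local cohomology as a quotient of the ideal transform\<close>

lemma (in abelian_group) add_diff_eq:
  assumes "x \<in> carrier G" "y \<in> carrier G"
  shows "y \<oplus> (x \<ominus> y) = x"
  using assms by (simp add: a_minus_def a_lcomm[of y x] r_neg)

lemma (in abelian_group) add_diff_cancel_left:
  assumes "x \<in> carrier G" "y \<in> carrier G"
  shows "(x \<oplus> y) \<ominus> x = y"
  using assms by (simp add: a_minus_def a_comm[of x y] a_assoc r_neg)

lemma module_homs_image_submodule:
  assumes M: "module R M" and N: "module R N" and h: "h \<in> module_homs R M N" and U: "submodule U R M"
  shows "submodule (h ` U) R N"
proof -
  interpret M: module R M by fact
  interpret N: module R N by fact
  note UE = M.submoduleE[OF U]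
  have Uc: "u \<in> carrier M" if "u \<in> U" for u using that UE(1) by blast
  show ?thesis
  proof (rule N.submoduleI)
    show "h ` U \<subseteq> carrier N" using module_homsD(1)[OF h] Uc by blast
    show "\<zero>\<^bsub>N\<^esub> \<in> h ` U"
      using module_homs_zero[OF M N h] M.submodule_zero[OF U] by (intro image_eqI[of _ _ "\<zero>\<^bsub>M\<^esub>"]) simp_all
    show "\<ominus>\<^bsub>N\<^esub> y \<in> h ` U" if y: "y \<in> h ` U" for y
    proof -
      obtain u where u: "u \<in> U" "y = h u" using y by blast
      then show ?thesis using module_homs_minus[OF M N h Uc[OF u(1)]] UE(3)
        by (intro image_eqI[of _ _ "\<ominus>\<^bsub>M\<^esub> u"]) simp_all
    qed
    show "y \<oplus>\<^bsub>N\<^esub> z \<in> h ` U" if yz: "y \<in> h ` U" "z \<in> h ` U" for y z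
    proof -
      obtain u v where u: "u \<in> U" "y = h u" "v \<in> U" "z = h v" using yz by blast
      then show ?thesis using module_homsD(2)[OF h Uc[OF u(1)] Uc[OF u(3)]] UE(5)
        by (intro image_eqI[of _ _ "u \<oplus>\<^bsub>M\<^esub> v"]) simp_all
    qed
    show "a \<odot>\<^bsub>N\<^esub> y \<in> h ` U" if a: "a \<in> carrier R" and y: "y \<in> h ` U" for a y
    proof -
      obtain u where u: "u \<in> U" "y = h u" using y by blast
      then show ?thesis using module_homsD(3)[OF h a Uc[OF u(1)]] UE(4) a
        by (intro image_eqI[of _ _ "a \<odot>\<^bsub>M\<^esub> u"]) simp_all
    qed
  qed
qed

lemma (in module) submodule_of_submodule:
  assumes "submodule U R M" "submodule N R M" "U \<subseteq> N"
  shows "submodule U R (M\<lparr>carrier := N\<rparr>)"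
proof -
  interpret N: module R "M\<lparr>carrier := N\<rparr>" by (rule submodule_restrict[OF assms(2)])
  show ?thesis
    by (rule N.module_incl_imp_submodule) (use assms submodule_restrict[OF assms(1)] in simp_all)
qed

context ideal_and_resolution
begin

definition H1 :: "('a, 'q set) module" where
  "H1 = local_cohomology R I Q d 1"

text \<open>On the ideal transform this is the connecting map onto \<open>H1\<close>.\<close>

definition cls :: "'q \<Rightarrow> 'q set" where
  "cls w = (d 0 ` T 0) +>\<^bsub>(Q 1)\<lparr>carrier := d 0 ` W\<rparr>\<^esub> d 0 w"

text \<open>A cocycle in \<open>T 1\<close> is by exactness some \<open>d 0 y\<close>, and
  \<open>d 0 y\<close> being torsion means that \<open>y\<close> lies in \<open>W\<close>.\<close>

lemma H1_eq: "H1 = quotient_module ((Q 1)\<lparr>carrier := d 0 ` W\<rparr>) (d 0 ` T 0)"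
proof -
  have "{x \<in> T 1. d 1 x = \<zero>\<^bsub>Q (Suc 1)\<^esub>} = d 0 ` W"
    using kernel_eq_image[of 0] T_carrier[of _ 1] by (auto simp: W_def)
  then show ?thesis by (simp add: H1_def local_cohomology_def T_eq)
qed

lemma d_W_submodule: "submodule (d 0 ` W) R (Q 1)"
  using module_homs_image_submodule[OF Q_module Q_module d_hom W_submodule] by simp

lemma d_T_submodule: "submodule (d 0 ` T 0) R ((Q 1)\<lparr>carrier := d 0 ` W\<rparr>)"
proof (rule Q.submodule_of_submodule[OF _ d_W_submodule])
  show "submodule (d 0 ` T 0) R (Q 1)"
    using module_homs_image_submodule[OF Q_module Q_module d_hom T_submodule] by simp
  show "d 0 ` T 0 \<subseteq> d 0 ` W" using T_W by blast
qed

lemmas H1_simps = quotient_module_simps[OF Q.submodule_restrict[OF d_W_submodule] d_T_submodule, folded H1_eq]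

lemma H1_module: "module R H1"
  by (rule H1_simps(1))

lemma cls_hom: "cls \<in> module_homs R ((Q 0)\<lparr>carrier := W\<rparr>) H1"
proof (rule module_homsI)
  note h = module_homsD[OF H1_simps(2)]
  show "cls x \<in> carrier H1" if "x \<in> carrier ((Q 0)\<lparr>carrier := W\<rparr>)" for x
    using h(1)[of "d 0 x"] that by (simp add: cls_def)
  show "cls (x \<oplus>\<^bsub>(Q 0)\<lparr>carrier := W\<rparr>\<^esub> y) = cls x \<oplus>\<^bsub>H1\<^esub> cls y"
    if "x \<in> carrier ((Q 0)\<lparr>carrier := W\<rparr>)" "y \<in> carrier ((Q 0)\<lparr>carrier := W\<rparr>)" for x y
    using h(2)[of "d 0 x" "d 0 y"] that d_add[of x 0 y] W_carrier by (simp add: cls_def)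
  show "cls (r \<odot>\<^bsub>(Q 0)\<lparr>carrier := W\<rparr>\<^esub> x) = r \<odot>\<^bsub>H1\<^esub> cls x"
    if "r \<in> carrier R" "x \<in> carrier ((Q 0)\<lparr>carrier := W\<rparr>)" for r x
    using h(3)[of r "d 0 x"] that d_smult[of r x 0] W_carrier by (simp add: cls_def)
qed

lemma H1_carrier: "carrier H1 = cls ` W"
  using H1_simps(3) by (auto simp: cls_def)

text \<open>Identifies \<open>H1\<close> with the ideal transform modulo \<open>R\<close>: elements
  with the same image under \<open>d 0\<close> differ by an element of \<open>R\<close>.\<close>

lemma cls_eq_zero:
  assumes w: "w \<in> W"
  shows "cls w = \<zero>\<^bsub>H1\<^esub> \<longleftrightarrow> (\<exists>t\<in>T 0. \<exists>c\<in>carrier R. w = t \<oplus>\<^bsub>Q 0\<^esub> \<epsilon> c)"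
proof -
  have "cls w = \<zero>\<^bsub>H1\<^esub> \<longleftrightarrow> d 0 w \<in> d 0 ` T 0"
    using H1_simps(4)[of "d 0 w"] w by (simp add: cls_def)
  also have "\<dots> \<longleftrightarrow> (\<exists>t\<in>T 0. \<exists>c\<in>carrier R. w = t \<oplus>\<^bsub>Q 0\<^esub> \<epsilon> c)"
  proof
    assume "d 0 w \<in> d 0 ` T 0"
    then obtain t where t: "t \<in> T 0" "d 0 w = d 0 t" by blast
    note wc = W_carrier[OF w] and tc = T_carrier[OF t(1)]
    have "d 0 (w \<ominus>\<^bsub>Q 0\<^esub> t) = \<zero>\<^bsub>Q 1\<^esub>" using d_diff[OF wc tc] t d_closed[OF tc] by simp
    then obtain c where c: "c \<in> carrier R" "w \<ominus>\<^bsub>Q 0\<^esub> t = \<epsilon> c" using d_0_eq_zero wc tc by blast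
    have "w = t \<oplus>\<^bsub>Q 0\<^esub> (w \<ominus>\<^bsub>Q 0\<^esub> t)"
      using wc tc by (simp add: Q.M.add_diff_eq)
    then have "w = t \<oplus>\<^bsub>Q 0\<^esub> \<epsilon> c" using c by simp
    then show "\<exists>t\<in>T 0. \<exists>c\<in>carrier R. w = t \<oplus>\<^bsub>Q 0\<^esub> \<epsilon> c" using c t by blast
  next
    assume "\<exists>t\<in>T 0. \<exists>c\<in>carrier R. w = t \<oplus>\<^bsub>Q 0\<^esub> \<epsilon> c"
    then obtain t c where t: "t \<in> T 0" "c \<in> carrier R" "w = t \<oplus>\<^bsub>Q 0\<^esub> \<epsilon> c" by blast
    have "d 0 w = d 0 t"
      using t d_add[OF T_carrier[OF t(1)] eps_closed[OF t(2)]] d_eps[OF t(2)] d_closed[OF T_carrier[OF t(1)]] by simp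
    then show "d 0 w \<in> d 0 ` T 0" using t by blast
  qed
  finally show ?thesis .
qed

lemma cls_smult: "r \<in> carrier R \<Longrightarrow> w \<in> W \<Longrightarrow> cls (r \<odot>\<^bsub>Q 0\<^esub> w) = r \<odot>\<^bsub>H1\<^esub> cls w"
  using module_homsD(3)[OF cls_hom] by simp

lemma cls_eq:
  assumes v: "v \<in> W" and w: "w \<in> W"
  shows "cls v = cls w \<longleftrightarrow> (\<exists>t\<in>T 0. \<exists>c\<in>carrier R. v = w \<oplus>\<^bsub>Q 0\<^esub> t \<oplus>\<^bsub>Q 0\<^esub> \<epsilon> c)"
proof -
  interpret H1: module R H1 by (rule H1_module)
  note WE = Q.submoduleE[OF W_submodule]
  note vc = W_carrier[OF v] and wc = W_carrier[OF w]
  have cc: "cls v \<in> carrier H1" "cls w \<in> carrier H1" using v w by (auto simp: H1_carrier)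
  have nw: "(\<ominus> \<one>) \<odot>\<^bsub>Q 0\<^esub> w \<in> W" using WE(4)[OF _ w] by simp
  have "cls (v \<oplus>\<^bsub>Q 0\<^esub> (\<ominus> \<one>) \<odot>\<^bsub>Q 0\<^esub> w) = cls v \<oplus>\<^bsub>H1\<^esub> (\<ominus> \<one>) \<odot>\<^bsub>H1\<^esub> cls w"
    using module_homsD(2)[OF cls_hom, of v "(\<ominus> \<one>) \<odot>\<^bsub>Q 0\<^esub> w"] cls_smult[OF _ w, of "\<ominus> \<one>"] v nw by simp
  then have eq: "cls (v \<ominus>\<^bsub>Q 0\<^esub> w) = cls v \<ominus>\<^bsub>H1\<^esub> cls w"
    using wc cc by (simp add: Q.smult_l_minus H1.smult_l_minus a_minus_def)
  have "cls v = cls w \<longleftrightarrow> cls (v \<ominus>\<^bsub>Q 0\<^esub> w) = \<zero>\<^bsub>H1\<^esub>" using cc by (simp add: eq)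
  also have "\<dots> \<longleftrightarrow> (\<exists>t\<in>T 0. \<exists>c\<in>carrier R. v \<ominus>\<^bsub>Q 0\<^esub> w = t \<oplus>\<^bsub>Q 0\<^esub> \<epsilon> c)"
    by (rule cls_eq_zero) (rule Q.submodule_diff[OF W_submodule v w])
  also have "\<dots> \<longleftrightarrow> (\<exists>t\<in>T 0. \<exists>c\<in>carrier R. v = w \<oplus>\<^bsub>Q 0\<^esub> t \<oplus>\<^bsub>Q 0\<^esub> \<epsilon> c)"
  proof (intro bex_cong refl)
    fix t c assume "t \<in> T 0" "c \<in> carrier R"
    then have m: "t \<in> carrier (Q 0)" "\<epsilon> c \<in> carrier (Q 0)" using T_carrier eps_closed by auto
    show "v \<ominus>\<^bsub>Q 0\<^esub> w = t \<oplus>\<^bsub>Q 0\<^esub> \<epsilon> c \<longleftrightarrow> v = w \<oplus>\<^bsub>Q 0\<^esub> t \<oplus>\<^bsub>Q 0\<^esub> \<epsilon> c"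
    proof
      assume "v \<ominus>\<^bsub>Q 0\<^esub> w = t \<oplus>\<^bsub>Q 0\<^esub> \<epsilon> c"
      moreover have "v = w \<oplus>\<^bsub>Q 0\<^esub> (v \<ominus>\<^bsub>Q 0\<^esub> w)"
        using vc wc by (simp add: Q.M.add_diff_eq)
      ultimately show "v = w \<oplus>\<^bsub>Q 0\<^esub> t \<oplus>\<^bsub>Q 0\<^esub> \<epsilon> c" using m wc by (simp add: Q.M.a_assoc)
    next
      assume "v = w \<oplus>\<^bsub>Q 0\<^esub> t \<oplus>\<^bsub>Q 0\<^esub> \<epsilon> c"
      then show "v \<ominus>\<^bsub>Q 0\<^esub> w = t \<oplus>\<^bsub>Q 0\<^esub> \<epsilon> c"
        using m wc by (simp add: Q.M.a_assoc Q.M.add_diff_cancel_left)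
    qed
  qed
  finally show ?thesis .
qed

end

section \<open>Ideals of arithmetic rank at most one\<close>

text \<open>The assumptions unfold the equality of the radicals of \<open>I\<close> and
  \<open>(x)\<close>; \<open>x\<close> itself may lie outside \<open>I\<close>.\<close>

locale radical_of_principal = ideal_and_resolution +
  fixes x
  assumes x: "x \<in> carrier R" and pow_x: "\<exists>k::nat. x [^] k \<in> I"
    and pow_I: "\<And>a. a \<in> I \<Longrightarrow> \<exists>l::nat. \<exists>b\<in>carrier R. a [^] l = b \<otimes> x"
begin

text \<open>Raising \<open>a^l = b x\<close> to the power \<open>n\<close> makes \<open>x^n\<close>
  divide a power of \<open>a\<close>. Hence torsion and membership in \<open>W\<close> can be tested
  on powers of \<open>x\<close> alone.\<close>

lemma pow_I_smult:
  assumes a: "a \<in> I" and y: "y \<in> carrier (Q i)"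
  shows "\<exists>l::nat. \<exists>b\<in>carrier R. a [^] l \<odot>\<^bsub>Q i\<^esub> y = b \<odot>\<^bsub>Q i\<^esub> (x [^] (n::nat) \<odot>\<^bsub>Q i\<^esub> y)"
proof -
  obtain l :: nat and b where b: "b \<in> carrier R" "a [^] l = b \<otimes> x" using pow_I[OF a] by blast
  have ac: "a \<in> carrier R" using a I_sub by blast
  have "a [^] (l * n) = b [^] n \<otimes> x [^] n"
    using b x ac by (simp add: nat_pow_pow[symmetric] nat_pow_distrib)
  then have "a [^] (l * n) \<odot>\<^bsub>Q i\<^esub> y = b [^] n \<odot>\<^bsub>Q i\<^esub> (x [^] n \<odot>\<^bsub>Q i\<^esub> y)"
    using b x y by (simp add: Q.smult_assoc1)
  then show ?thesis using b by blast
qed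

lemma mem_T: "y \<in> carrier (Q i) \<Longrightarrow> x [^] (n::nat) \<odot>\<^bsub>Q i\<^esub> y = \<zero>\<^bsub>Q i\<^esub> \<Longrightarrow> y \<in> T i"
proof (rule T_I)
  fix a assume y: "y \<in> carrier (Q i)" "x [^] (n::nat) \<odot>\<^bsub>Q i\<^esub> y = \<zero>\<^bsub>Q i\<^esub>" and a: "a \<in> I"
  obtain l :: nat and b where "b \<in> carrier R" "a [^] l \<odot>\<^bsub>Q i\<^esub> y = b \<odot>\<^bsub>Q i\<^esub> (x [^] n \<odot>\<^bsub>Q i\<^esub> y)"
    using pow_I_smult[OF a y(1)] by blast
  then have "a [^] l \<odot>\<^bsub>Q i\<^esub> y \<in> T i" using y(2) Q.submodule_zero[OF T_submodule[of i]] by simp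
  then show "\<exists>l::nat. a [^] l \<odot>\<^bsub>Q i\<^esub> y \<in> T i" ..
qed

lemma mem_W:
  assumes y: "y \<in> carrier (Q 0)" "x [^] (n::nat) \<odot>\<^bsub>Q 0\<^esub> y \<in> W"
  shows "y \<in> W"
proof (rule W_I[OF y(1)])
  fix a assume a: "a \<in> I"
  obtain l :: nat and b where b: "b \<in> carrier R" "a [^] l \<odot>\<^bsub>Q 0\<^esub> y = b \<odot>\<^bsub>Q 0\<^esub> (x [^] n \<odot>\<^bsub>Q 0\<^esub> y)"
    using pow_I_smult[OF a y(1)] by blast
  then have "a [^] l \<odot>\<^bsub>Q 0\<^esub> y \<in> W" using Q.submoduleE(4)[OF W_submodule b(1) y(2)] by simp
  then show "\<exists>l::nat. a [^] l \<odot>\<^bsub>Q 0\<^esub> y \<in> W" ..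
qed

lemma T_pow_x: "t \<in> T i \<Longrightarrow> \<exists>n::nat. x [^] n \<odot>\<^bsub>Q i\<^esub> t = \<zero>\<^bsub>Q i\<^esub>"
proof -
  assume t: "t \<in> T i"
  obtain k :: nat where "x [^] k \<in> I" using pow_x by blast
  then obtain n :: nat where "(x [^] k) [^] n \<odot>\<^bsub>Q i\<^esub> t = \<zero>\<^bsub>Q i\<^esub>" using T_pow[OF t] by blast
  then show ?thesis using x by (auto simp: nat_pow_pow)
qed

lemma W_pow_x: "w \<in> W \<Longrightarrow> \<exists>n::nat. \<exists>b\<in>carrier R. x [^] n \<odot>\<^bsub>Q 0\<^esub> w = \<epsilon> b"
proof -
  assume w: "w \<in> W"
  obtain k :: nat where "x [^] k \<in> I" using pow_x by blast
  then obtain n :: nat and b where "b \<in> carrier R" "(x [^] k) [^] n \<odot>\<^bsub>Q 0\<^esub> w = \<epsilon> b"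
    using W_pow[OF w] by blast
  then show ?thesis using x by (auto simp: nat_pow_pow)
qed

text \<open>Almost divisibility supplies \<open>v\<close> in \<open>Q 0\<close>; the error is
  \<open>x\<close>-power torsion and so in \<open>T 0\<close>, hence \<open>x v\<close> lies in
  \<open>W\<close>, and saturation puts \<open>v\<close> there too.\<close>

lemma divide_mod_torsion:
  assumes w: "w \<in> W"
  shows "\<exists>v\<in>W. \<exists>n::nat. x [^] n \<odot>\<^bsub>Q 0\<^esub> (x \<odot>\<^bsub>Q 0\<^esub> v \<ominus>\<^bsub>Q 0\<^esub> w) = \<zero>\<^bsub>Q 0\<^esub>"
proof -
  note wc = W_carrier[OF w]
  obtain v and n :: nat where v: "v \<in> carrier (Q 0)" and n: "x [^] n \<odot>\<^bsub>Q 0\<^esub> (x \<odot>\<^bsub>Q 0\<^esub> v \<ominus>\<^bsub>Q 0\<^esub> w) = \<zero>\<^bsub>Q 0\<^esub>"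
    using Q_almost_divisible[of 0] wc x unfolding almost_divisible_def by meson
  have "x \<odot>\<^bsub>Q 0\<^esub> v \<ominus>\<^bsub>Q 0\<^esub> w \<in> T 0" by (rule mem_T[OF _ n]) (use x v wc in simp)
  then have "(x \<odot>\<^bsub>Q 0\<^esub> v \<ominus>\<^bsub>Q 0\<^esub> w) \<oplus>\<^bsub>Q 0\<^esub> w \<in> W" using Q.submoduleE(5)[OF W_submodule T_W w] by simp
  then have "x \<odot>\<^bsub>Q 0\<^esub> v \<in> W" using x v wc by (simp add: a_minus_def Q.M.a_assoc Q.M.l_neg)
  then have "v \<in> W" using mem_W[OF v, of 1] x by simp
  then show ?thesis using n by blast
qed

lemma H1_divisible:
  assumes "y \<in> carrier H1"
  shows "\<exists>z\<in>carrier H1. y = x [^] (n::nat) \<odot>\<^bsub>H1\<^esub> z"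
proof (induction n)
  interpret H1: module R H1 by (rule H1_module)
  case 0
  then show ?case using assms by (intro bexI[of _ y]) simp_all
next
  interpret H1: module R H1 by (rule H1_module)
  case (Suc n)
  then obtain z where z: "z \<in> carrier H1" "y = x [^] n \<odot>\<^bsub>H1\<^esub> z" by blast
  then obtain w where w: "w \<in> W" "z = cls w" by (auto simp: H1_carrier)
  note wc = W_carrier[OF w(1)]
  obtain v and m :: nat where v: "v \<in> W" "x [^] m \<odot>\<^bsub>Q 0\<^esub> (x \<odot>\<^bsub>Q 0\<^esub> v \<ominus>\<^bsub>Q 0\<^esub> w) = \<zero>\<^bsub>Q 0\<^esub>"
    using divide_mod_torsion[OF w(1)] by blast
  note vc = W_carrier[OF v(1)]
  have t: "x \<odot>\<^bsub>Q 0\<^esub> v \<ominus>\<^bsub>Q 0\<^esub> w \<in> T 0" by (rule mem_T[OF _ v(2)]) (use x vc wc in simp)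
  have xv: "x \<odot>\<^bsub>Q 0\<^esub> v \<in> W" by (rule Q.submoduleE(4)[OF W_submodule x v(1)])
  have "x \<odot>\<^bsub>Q 0\<^esub> v = w \<oplus>\<^bsub>Q 0\<^esub> (x \<odot>\<^bsub>Q 0\<^esub> v \<ominus>\<^bsub>Q 0\<^esub> w) \<oplus>\<^bsub>Q 0\<^esub> \<epsilon> \<zero>"
    using x vc wc by (simp add: eps_zero Q.M.add_diff_eq)
  then have "cls (x \<odot>\<^bsub>Q 0\<^esub> v) = cls w" using cls_eq[OF xv w(1)] t by blast
  then have "z = x \<odot>\<^bsub>H1\<^esub> cls v" using cls_smult[OF x v(1)] w by simp
  moreover have "cls v \<in> carrier H1" using v by (simp add: H1_carrier)
  ultimately have "y = x [^] Suc n \<odot>\<^bsub>H1\<^esub> cls v" using z x by (simp add: H1.smult_assoc1)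
  then show ?case using \<open>cls v \<in> carrier H1\<close> by blast
qed

text \<open>Fractions whose denominators are powers of an invertible \<open>x\<close> already lie in
  \<open>R\<close>.\<close>

lemma H1_trivial_if_Units:
  assumes "x \<in> Units R" "y \<in> carrier H1"
  shows "y = \<zero>\<^bsub>H1\<^esub>"
proof -
  obtain w where w: "w \<in> W" "y = cls w" using assms by (auto simp: H1_carrier)
  note wc = W_carrier[OF w(1)]
  obtain n :: nat and b where b: "b \<in> carrier R" "x [^] n \<odot>\<^bsub>Q 0\<^esub> w = \<epsilon> b" using W_pow_x[OF w(1)] by blast
  have U: "x [^] n \<in> Units R" using assms(1) by (rule Units_pow_closed)
  then have "w = inv (x [^] n) \<odot>\<^bsub>Q 0\<^esub> (x [^] n \<odot>\<^bsub>Q 0\<^esub> w)"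
    using wc x by (simp add: Q.smult_assoc1[symmetric])
  also have "\<dots> = \<epsilon> (inv (x [^] n) \<otimes> b)" using b U by (simp add: eps_mult)
  finally have "w = \<zero>\<^bsub>Q 0\<^esub> \<oplus>\<^bsub>Q 0\<^esub> \<epsilon> (inv (x [^] n) \<otimes> b)" using b U by (simp add: eps_closed)
  moreover have "inv (x [^] n) \<otimes> b \<in> carrier R" using U b by simp
  ultimately show ?thesis using cls_eq_zero[OF w(1)] w Q.submodule_zero[OF T_submodule[of 0]] by blast
qed

text \<open>Modulo torsion \<open>W\<close> is the localization at \<open>x\<close>, and
  \<open>V\<close> is the submodule of fractions \<open>j / x^n + a\<close>, the sum of
  \<open>R\<close> and the extension of \<open>J\<close>. Its image contains \<open>J\<close> times
  \<open>H1\<close>, while \<open>1 / x\<close> escapes it as long as no power of \<open>x\<close>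
  is in \<open>J\<close>.\<close>

lemma exists_proper_submodule:
  assumes J: "ideal J R" and xJ: "\<And>n::nat. x [^] n \<notin> J"
    and unit: "\<And>a. a \<in> carrier R \<Longrightarrow> \<one> \<ominus> x \<otimes> a \<in> Units R"
  shows "\<exists>U y. submodule U R H1 \<and> y \<in> carrier H1 \<and> y \<notin> U \<and> (\<forall>j\<in>J. \<forall>z\<in>carrier H1. j \<odot>\<^bsub>H1\<^esub> z \<in> U)"
proof -
  interpret J: ideal J R by (rule J)
  have Jc: "j \<in> carrier R" if "j \<in> J" for j using that by (rule J.a_Hcarr)
  note WE = Q.submoduleE[OF W_submodule]
  have Wm: "module R ((Q 0)\<lparr>carrier := W\<rparr>)" by (rule Q.submodule_restrict[OF W_submodule])
  define V where "V = {w \<in> W. \<exists>n::nat. \<exists>a\<in>carrier R. \<exists>j\<in>J. x [^] n \<odot>\<^bsub>Q 0\<^esub> w = \<epsilon> (j \<oplus> x [^] n \<otimes> a)}"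
  have VI: "w \<in> V" if "w \<in> W" "a \<in> carrier R" "j \<in> J" "x [^] (n::nat) \<odot>\<^bsub>Q 0\<^esub> w = \<epsilon> (j \<oplus> x [^] n \<otimes> a)" for w a j n
    using that unfolding V_def by blast
  have xn: "x [^] n \<in> carrier R" for n :: nat using x by simp
  have VT: "t \<in> V" if t: "t \<in> T 0" for t
  proof -
    obtain n :: nat where "x [^] n \<odot>\<^bsub>Q 0\<^esub> t = \<zero>\<^bsub>Q 0\<^esub>" using T_pow_x[OF t] by blast
    then show ?thesis using VI[OF T_W[OF t], of "\<zero>" "\<zero>" n] xn by (simp add: eps_zero)
  qed
  have Ve: "\<epsilon> c \<in> V" if c: "c \<in> carrier R" for c
    using VI[OF eps_W[OF c] c, of "\<zero>" 0] c eps_closed by simp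
  have Vsm: "r \<odot>\<^bsub>Q 0\<^esub> v \<in> V" if r: "r \<in> carrier R" and v: "v \<in> V" for r v
  proof -
    obtain n :: nat and a j where *: "v \<in> W" "a \<in> carrier R" "j \<in> J" "x [^] n \<odot>\<^bsub>Q 0\<^esub> v = \<epsilon> (j \<oplus> x [^] n \<otimes> a)"
      using v by (auto simp: V_def)
    have "x [^] n \<odot>\<^bsub>Q 0\<^esub> (r \<odot>\<^bsub>Q 0\<^esub> v) = r \<odot>\<^bsub>Q 0\<^esub> \<epsilon> (j \<oplus> x [^] n \<otimes> a)"
      using *(4) Q.smult_left_commute[OF xn r W_carrier[OF *(1)]] by simp
    also have "\<dots> = \<epsilon> (r \<otimes> (j \<oplus> x [^] n \<otimes> a))" using r * xn Jc by (simp add: eps_mult)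
    also have "r \<otimes> (j \<oplus> x [^] n \<otimes> a) = r \<otimes> j \<oplus> x [^] n \<otimes> (r \<otimes> a)"
      using r * xn Jc by (simp add: r_distr m_lcomm)
    finally show ?thesis
      using VI[OF WE(4)[OF r *(1)], of "r \<otimes> a" "r \<otimes> j" n] r *(2) J.I_l_closed[OF *(3) r] by simp
  qed
  have Vadd: "v \<oplus>\<^bsub>Q 0\<^esub> v' \<in> V" if v: "v \<in> V" and v': "v' \<in> V" for v v'
  proof -
    obtain n :: nat and a j where 1: "v \<in> W" "a \<in> carrier R" "j \<in> J" "x [^] n \<odot>\<^bsub>Q 0\<^esub> v = \<epsilon> (j \<oplus> x [^] n \<otimes> a)"
      using v by (auto simp: V_def)
    obtain m :: nat and a' j' where 2: "v' \<in> W" "a' \<in> carrier R" "j' \<in> J" "x [^] m \<odot>\<^bsub>Q 0\<^esub> v' = \<epsilon> (j' \<oplus> x [^] m \<otimes> a')"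
      using v' by (auto simp: V_def)
    note vc = W_carrier[OF 1(1)] W_carrier[OF 2(1)] and jc = Jc[OF 1(3)] Jc[OF 2(3)]
    define p q where "p = x [^] n" and "q = x [^] m"
    have pq: "p \<in> carrier R" "q \<in> carrier R" by (simp_all add: p_def q_def xn)
    have xnm: "x [^] (n + m) = p \<otimes> q" using x by (simp add: p_def q_def nat_pow_mult)
    have "(p \<otimes> q) \<odot>\<^bsub>Q 0\<^esub> (v \<oplus>\<^bsub>Q 0\<^esub> v') = q \<odot>\<^bsub>Q 0\<^esub> (p \<odot>\<^bsub>Q 0\<^esub> v) \<oplus>\<^bsub>Q 0\<^esub> p \<odot>\<^bsub>Q 0\<^esub> (q \<odot>\<^bsub>Q 0\<^esub> v')"
      using pq vc by (simp add: Q.smult_r_distr Q.smult_assoc1 Q.smult_left_commute[of q p])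
    also have "\<dots> = \<epsilon> (q \<otimes> (j \<oplus> p \<otimes> a) \<oplus> p \<otimes> (j' \<oplus> q \<otimes> a'))"
      using 1 2 jc pq by (simp add: p_def[symmetric] q_def[symmetric] eps_mult eps_add)
    also have "q \<otimes> (j \<oplus> p \<otimes> a) \<oplus> p \<otimes> (j' \<oplus> q \<otimes> a') = (q \<otimes> j \<oplus> p \<otimes> j') \<oplus> (p \<otimes> q) \<otimes> (a \<oplus> a')"
      using 1 2 jc pq by (simp add: r_distr m_ac a_ac)
    finally have "x [^] (n + m) \<odot>\<^bsub>Q 0\<^esub> (v \<oplus>\<^bsub>Q 0\<^esub> v') = \<epsilon> ((q \<otimes> j \<oplus> p \<otimes> j') \<oplus> x [^] (n + m) \<otimes> (a \<oplus> a'))"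
      by (simp add: xnm)
    moreover have "q \<otimes> j \<oplus> p \<otimes> j' \<in> J" using 1 2 pq by (intro J.a_closed J.I_l_closed)
    ultimately show ?thesis using VI WE(5)[OF 1(1) 2(1)] 1(2) 2(2) by blast
  qed
  have V: "submodule V R (Q 0)"
  proof (rule Q.submoduleI)
    show "V \<subseteq> carrier (Q 0)" using W_carrier by (auto simp: V_def)
    show "\<zero>\<^bsub>Q 0\<^esub> \<in> V" by (rule VT[OF Q.submodule_zero[OF T_submodule[of 0]]])
    show "\<ominus>\<^bsub>Q 0\<^esub> v \<in> V" if v: "v \<in> V" for v
    proof -
      have "v \<in> carrier (Q 0)" using v W_carrier by (auto simp: V_def)
      then have "\<ominus>\<^bsub>Q 0\<^esub> v = (\<ominus> \<one>) \<odot>\<^bsub>Q 0\<^esub> v" by (simp add: Q.smult_l_minus)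
      then show ?thesis using Vsm[OF _ v, of "\<ominus> \<one>"] by simp
    qed
  qed (use Vsm Vadd in auto)
  have VW: "V \<subseteq> W" by (auto simp: V_def)
  have U: "submodule (cls ` V) R H1"
    by (rule module_homs_image_submodule[OF Wm H1_module cls_hom Q.submodule_of_submodule[OF V W_submodule VW]])
  have "j \<odot>\<^bsub>H1\<^esub> z \<in> cls ` V" if j: "j \<in> J" and z: "z \<in> carrier H1" for j z
  proof -
    obtain w where w: "w \<in> W" "z = cls w" using z by (auto simp: H1_carrier)
    obtain n :: nat and b where b: "b \<in> carrier R" "x [^] n \<odot>\<^bsub>Q 0\<^esub> w = \<epsilon> b" using W_pow_x[OF w(1)] by blast
    note jc = Jc[OF j]
    have "x [^] n \<odot>\<^bsub>Q 0\<^esub> (j \<odot>\<^bsub>Q 0\<^esub> w) = j \<odot>\<^bsub>Q 0\<^esub> \<epsilon> b"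
      using b(2) Q.smult_left_commute[OF xn jc W_carrier[OF w(1)]] by simp
    also have "\<dots> = \<epsilon> (j \<otimes> b \<oplus> x [^] n \<otimes> \<zero>)" using b jc xn by (simp add: eps_mult)
    finally have "j \<odot>\<^bsub>Q 0\<^esub> w \<in> V" using VI[OF WE(4)[OF jc w(1)]] J.I_r_closed[OF j b(1)] by blast
    then show ?thesis using cls_smult[OF jc w(1)] w(2) by (metis imageI)
  qed
  \<comment> \<open>\<open>v\<close> plays the role of \<open>1 / x\<close>; the exponent
    \<open>N\<close> absorbs the torsion error.\<close>
  moreover obtain v and N :: nat where v: "v \<in> W" "x [^] N \<odot>\<^bsub>Q 0\<^esub> (x \<odot>\<^bsub>Q 0\<^esub> v \<ominus>\<^bsub>Q 0\<^esub> \<epsilon> \<one>) = \<zero>\<^bsub>Q 0\<^esub>"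
    using divide_mod_torsion[OF eps_W[OF one_closed]] by blast
  have "cls v \<notin> cls ` V"
  proof
    note vc = W_carrier[OF v(1)]
    assume "cls v \<in> cls ` V"
    then obtain u where u: "u \<in> V" "cls v = cls u" by blast
    \<comment> \<open>\<open>V\<close> contains \<open>T 0\<close> and the image of
      \<open>R\<close>, that is, the kernel of \<open>cls\<close>; so membership of the class gives
      membership of \<open>v\<close>.\<close>
    then obtain t c where "t \<in> T 0" "c \<in> carrier R" "v = u \<oplus>\<^bsub>Q 0\<^esub> t \<oplus>\<^bsub>Q 0\<^esub> \<epsilon> c"
      using cls_eq[OF v(1), of u] VW by blast
    then have "v \<in> V" using Vadd u VT Ve by simp
    then obtain n :: nat and a j where a: "a \<in> carrier R" and j: "j \<in> J"
      and eq: "x [^] n \<odot>\<^bsub>Q 0\<^esub> v = \<epsilon> (j \<oplus> x [^] n \<otimes> a)" by (auto simp: V_def)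
    note jc = Jc[OF j]
    define p q where "p = x [^] n" and "q = x [^] N"
    have pq: "p \<in> carrier R" "q \<in> carrier R" by (simp_all add: p_def q_def xn)
    have "q \<odot>\<^bsub>Q 0\<^esub> (x \<odot>\<^bsub>Q 0\<^esub> v) = q \<odot>\<^bsub>Q 0\<^esub> \<epsilon> \<one>"
      using v(2) pq x vc eps_closed[OF one_closed] by (simp add: q_def[symmetric] Q.smult_r_diff)
    then have qx: "q \<odot>\<^bsub>Q 0\<^esub> (x \<odot>\<^bsub>Q 0\<^esub> v) = \<epsilon> q" using eps_mult[OF pq(2) one_closed] pq by simp
    have "\<epsilon> (p \<otimes> q) = p \<odot>\<^bsub>Q 0\<^esub> (q \<odot>\<^bsub>Q 0\<^esub> (x \<odot>\<^bsub>Q 0\<^esub> v))" using qx pq by (simp add: eps_mult)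
    also have "\<dots> = (q \<otimes> x) \<odot>\<^bsub>Q 0\<^esub> (p \<odot>\<^bsub>Q 0\<^esub> v)"
      using pq x vc by (simp add: Q.smult_assoc1 Q.smult_left_commute[of p])
    also have "\<dots> = \<epsilon> (q \<otimes> x \<otimes> (j \<oplus> p \<otimes> a))"
      using eq pq x a jc by (simp add: p_def[symmetric] eps_mult[of "q \<otimes> x"])
    finally have e1: "p \<otimes> q = q \<otimes> x \<otimes> (j \<oplus> p \<otimes> a)"
      by (rule eps_inj[rotated 2]) (use pq x a jc in simp_all)
    \<comment> \<open>This is \<open>1 / x = j / p + a\<close> with denominators cleared. Dividing
      by the unit \<open>1 - x a\<close> leaves a power of \<open>x\<close> in
      \<open>J\<close>.\<close>
    have "p \<otimes> q \<otimes> (\<one> \<ominus> x \<otimes> a) = q \<otimes> x \<otimes> j"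
    proof -
      have "p \<otimes> q \<otimes> (\<one> \<ominus> x \<otimes> a) = p \<otimes> q \<ominus> p \<otimes> q \<otimes> (x \<otimes> a)"
        using pq x a by (simp add: a_minus_def r_distr r_minus)
      also have "\<dots> = (q \<otimes> x \<otimes> j \<oplus> p \<otimes> q \<otimes> (x \<otimes> a)) \<ominus> p \<otimes> q \<otimes> (x \<otimes> a)"
      proof -
        have "q \<otimes> x \<otimes> (j \<oplus> p \<otimes> a) = q \<otimes> x \<otimes> j \<oplus> p \<otimes> q \<otimes> (x \<otimes> a)"
          using pq x a jc by (simp add: r_distr m_ac)
        then show ?thesis using e1 by simp
      qed
      also have "\<dots> = q \<otimes> x \<otimes> j" using pq x a jc by (simp add: a_minus_def a_assoc r_neg)
      finally show ?thesis .
    qed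
    moreover have "q \<otimes> x \<otimes> j \<in> J" using pq x by (intro J.I_l_closed j) simp
    ultimately have "p \<otimes> q \<otimes> (\<one> \<ominus> x \<otimes> a) \<otimes> inv (\<one> \<ominus> x \<otimes> a) \<in> J"
      using J.I_r_closed unit[OF a] by simp
    then have "p \<otimes> q \<in> J" using pq unit[OF a] by (simp add: m_assoc Units_closed)
    then have "x [^] (n + N) \<in> J" using x by (simp add: p_def q_def nat_pow_mult)
    then show False using xJ by blast
  qed
  moreover have "cls v \<in> carrier H1" using v by (simp add: H1_carrier)
  ultimately show ?thesis using U by blast
qed

end

section \<open>Principal ideals up to radical, and the two implications\<close>

lemma genideal_empty: "ring R \<Longrightarrow> genideal R {} = {\<zero>\<^bsub>R\<^esub>}"
proof -
  assume "ring R"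
  then interpret ring R .
  have "genideal R {} \<subseteq> {\<zero>\<^bsub>R\<^esub>}" by (rule genideal_minimal) (auto intro: zeroideal)
  moreover have "\<zero>\<^bsub>R\<^esub> \<in> genideal R {}"
    using genideal_ideal[of "{}"] by (simp add: additive_subgroup.zero_closed ideal.axioms(1))
  ultimately show ?thesis by blast
qed

lemma ideal_radical_eq_principal:
  fixes R (structure)
  assumes "cring R" "ideal I R" "r \<in> I"
    and "\<And>a. a \<in> I \<Longrightarrow> \<exists>n::nat. \<exists>b\<in>carrier R. a [^] n = r \<otimes> b"
  shows "ideal_radical R I = ideal_radical R (genideal R {r})"
proof -
  interpret cring R by fact
  interpret I: ideal I R by fact
  have r: "r \<in> carrier R" using assms(3) by (rule I.a_Hcarr)
  have P: "genideal R {r} = PIdl r" by (rule cgenideal_eq_genideal[symmetric, OF r])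
  have "genideal R {r} \<subseteq> I" by (rule genideal_minimal[OF assms(2)]) (use assms(3) in simp)
  then have "ideal_radical R (genideal R {r}) \<subseteq> ideal_radical R I" by (auto simp: ideal_radical_def)
  moreover have "ideal_radical R I \<subseteq> ideal_radical R (genideal R {r})"
  proof
    fix y assume "y \<in> ideal_radical R I"
    then obtain k :: nat where y: "y \<in> carrier R" "y [^] k \<in> I" by (auto simp: ideal_radical_def)
    obtain n :: nat and b where b: "b \<in> carrier R" "(y [^] k) [^] n = r \<otimes> b" using assms(4)[OF y(2)] by blast
    then have "y [^] (k * n) = b \<otimes> r" using y r by (simp add: nat_pow_pow m_comm)
    then have "y [^] (k * n) \<in> genideal R {r}" using b unfolding P cgenideal_def by blast
    then show "y \<in> ideal_radical R (genideal R {r})" using y by (auto simp: ideal_radical_def)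
  qed
  ultimately show ?thesis by blast
qed

text \<open>Finite generation makes the set of admissible lengths nonempty, so the least length is
  attained; length zero is covered by \<open>x = 0\<close>.\<close>

lemma arithmetic_rank_le_1_imp_principal:
  assumes noeth: "noetherian_ring R" and R: "cring R" and I: "ideal I R" and ara: "arithmetic_rank R I \<le> 1"
  obtains x where "x \<in> carrier R" "ideal_radical R I = ideal_radical R (genideal R {x})"
proof -
  interpret cring R by fact
  interpret noetherian_ring R by fact
  let ?P = "\<lambda>l. \<exists>rs. length rs = l \<and> set rs \<subseteq> carrier R
        \<and> ideal_radical R I = ideal_radical R (genideal R (set rs))"
  obtain A where "A \<subseteq> carrier R" "finite A" "I = genideal R A" using finetely_gen[OF I] by blast
  then obtain as where "set as \<subseteq> carrier R" "I = genideal R (set as)" by (metis finite_list)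
  then have "?P (length as)" by blast
  then have "?P (arithmetic_rank R I)" unfolding arithmetic_rank_def by (rule LeastI)
  then obtain rs where rs': "length rs = arithmetic_rank R I" and rs: "set rs \<subseteq> carrier R"
    "ideal_radical R I = ideal_radical R (genideal R (set rs))" by blast
  have len: "length rs \<le> 1" using rs' ara by simp
  show thesis
  proof (cases rs)
    case Nil
    have "genideal R {} = genideal R {\<zero>\<^bsub>R\<^esub>}" by (simp add: genideal_empty ring_axioms genideal_zero)
    then show thesis using that[of "\<zero>\<^bsub>R\<^esub>"] rs Nil by simp
  next
    case (Cons r rs')
    then show thesis using that[of r] rs len by simp
  qed
qed

lemma matlis_dual_annihilator:
  assumes "module R E" "r \<in> carrier R" "\<phi> \<in> carrier (hom_module R M E)"
  shows "r \<in> annihilator R (hom_module R M E) \<phi> \<longleftrightarrow> (\<forall>y\<in>carrier M. r \<odot>\<^bsub>E\<^esub> \<phi> y = \<zero>\<^bsub>E\<^esub>)"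
proof -
  have "r \<in> annihilator R (hom_module R M E) \<phi> \<longleftrightarrow>
      (\<lambda>y\<in>carrier M. r \<odot>\<^bsub>E\<^esub> \<phi> y) = (\<lambda>y\<in>carrier M. \<zero>\<^bsub>E\<^esub>)"
    using assms(2) by (simp add: annihilator_def hom_module_def)
  also have "\<dots> \<longleftrightarrow> (\<forall>y\<in>carrier M. r \<odot>\<^bsub>E\<^esub> \<phi> y = \<zero>\<^bsub>E\<^esub>)"
    by (auto simp: fun_eq_iff restrict_def)
  finally show ?thesis .
qed

lemma associated_prime_of_dual:
  assumes M: "module R M" and E: "module R E" and p: "\<pp> \<in> associated_primes R (hom_module R M E)"
  obtains \<phi> y where "\<phi> \<in> carrier (hom_module R M E)" "\<pp> = annihilator R (hom_module R M E) \<phi>"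
    "y \<in> carrier M" "\<phi> y \<noteq> \<zero>\<^bsub>E\<^esub>"
proof -
  interpret E: module R E by fact
  obtain \<phi> where \<phi>: "\<phi> \<in> carrier (hom_module R M E)" "\<pp> = annihilator R (hom_module R M E) \<phi>"
    and pr: "primeideal \<pp> R" using p by (auto simp: associated_primes_def)
  have "\<one>\<^bsub>R\<^esub> \<notin> \<pp>"
    using primeideal.I_notcarr[OF pr] ideal.one_imp_carrier[of \<pp> R] primeideal.axioms(1)[OF pr] by blast
  then obtain y where "y \<in> carrier M" "\<one>\<^bsub>R\<^esub> \<odot>\<^bsub>E\<^esub> \<phi> y \<noteq> \<zero>\<^bsub>E\<^esub>"
    using matlis_dual_annihilator[OF E _ \<phi>(1), of "\<one>\<^bsub>R\<^esub>"] \<phi>(2) by auto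
  moreover then have "\<phi> y \<noteq> \<zero>\<^bsub>E\<^esub>" by auto
  ultimately show thesis using that \<phi> by blast
qed

theorem theorem1:
  fixes R :: "('a, 'k) ring_scheme"
    and \<mm> I :: "'a set"
    and \<epsilon> :: "'a \<Rightarrow> 'q"
    and Q :: "nat \<Rightarrow> ('a, 'q) module"
    and d :: "nat \<Rightarrow> 'q \<Rightarrow> 'q"
    and \<iota> :: "'a set \<Rightarrow> 'e"
    and E :: "('a, 'e) module"
  assumes "noetherian_ring R"
    and "local_ring R \<mm>"
    and "ideal I R"
    and "injective_resolution R (regular_module R) \<epsilon> Q d"
    and "injective_hull R (quotient_module (regular_module R) \<mm>) \<iota> E"
    and "\<forall>i\<ge>2. zero_module (local_cohomology R I Q d i)"
  shows "arithmetic_rank R I \<le> 1 \<longleftrightarrow>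
    satisfies_prime_avoidance R (associated_primes R (matlis_dual R E (local_cohomology R I Q d 1)))"
proof -
  have m: "maximalideal \<mm> R" and R: "cring R" using assms(2) by (auto simp: local_ring_def)
  interpret ideal_and_resolution R I \<epsilon> Q d
    using assms R by (simp add: ideal_and_resolution_def)
  interpret m: maximalideal \<mm> R by (rule m)
  have E: "module R E" using assms(5) by (simp add: injective_hull_def injective_module_def)
  interpret E: module R E by (rule E)
  interpret H1: module R H1 by (rule H1_module)
  let ?D = "hom_module R H1 E"
  have D: "module R ?D" by (rule module_hom_module[OF H1_module E])
  note sep = matlis_dual_separates[OF assms(1,2,5) H1_module]
  note annI = matlis_dual_annihilator[OF E]
  have van: "zero_module (local_cohomology R I Q d i)" if "i \<ge> 2" for i using assms(6) that by blast
  have unit: "\<one>\<^bsub>R\<^esub> \<ominus>\<^bsub>R\<^esub> a \<in> Units R" if a: "a \<in> \<mm>" for a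
  proof (rule local_ring_Units[OF assms(1,2)])
    have ac: "a \<in> carrier R" using a by (rule m.a_Hcarr)
    then show "\<one>\<^bsub>R\<^esub> \<ominus>\<^bsub>R\<^esub> a \<in> carrier R" by simp
    show "\<one>\<^bsub>R\<^esub> \<ominus>\<^bsub>R\<^esub> a \<notin> \<mm>"
    proof
      assume "\<one>\<^bsub>R\<^esub> \<ominus>\<^bsub>R\<^esub> a \<in> \<mm>"
      then have "(\<one>\<^bsub>R\<^esub> \<ominus>\<^bsub>R\<^esub> a) \<oplus>\<^bsub>R\<^esub> a \<in> \<mm>" using a by (rule m.a_closed)
      then have "\<one>\<^bsub>R\<^esub> \<in> \<mm>" using ac by (simp add: a_minus_def a_assoc l_neg)
      then show False using m.I_notcarr m.one_imp_carrier by blast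
    qed
  qed
  have Iff: "arithmetic_rank R I \<le> 1 \<longleftrightarrow> satisfies_prime_avoidance R (associated_primes R ?D)"
  proof
    assume PA: "satisfies_prime_avoidance R (associated_primes R ?D)"
    have "\<exists>r\<in>I. \<forall>a\<in>I. \<exists>n::nat. \<exists>b\<in>carrier R. a [^]\<^bsub>R\<^esub> n = r \<otimes>\<^bsub>R\<^esub> b"
    \<comment> \<open>The unit ideal is treated apart because the elements \<open>1 - c\<close> with
      \<open>c\<close> in \<open>I\<close> are known to be units only for \<open>I\<close> inside
      \<open>\<mm>\<close>; here \<open>r = 1\<close> works.\<close>
    proof (cases "I = carrier R")
      case True
      show ?thesis
      proof (rule bexI, rule ballI)
        fix a assume "a \<in> I"
        then have a: "a \<in> carrier R" using True by simp
        then have "a [^]\<^bsub>R\<^esub> (1::nat) = \<one>\<^bsub>R\<^esub> \<otimes>\<^bsub>R\<^esub> a" by simp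
        then show "\<exists>n::nat. \<exists>b\<in>carrier R. a [^]\<^bsub>R\<^esub> n = \<one>\<^bsub>R\<^esub> \<otimes>\<^bsub>R\<^esub> b" using a by blast
      qed (simp add: True)
    next
      case False
      have Im: "I \<subseteq> \<mm>" by (rule local_ring_proper_ideal[OF assms(1-3) False])
      have "\<not> I \<subseteq> \<Union>(associated_primes R ?D)"
      proof
        assume "I \<subseteq> \<Union>(associated_primes R ?D)"
        then obtain \<pp> where p: "\<pp> \<in> associated_primes R ?D" "I \<subseteq> \<pp>"
          using PA I unfolding satisfies_prime_avoidance_def by blast
        obtain \<phi> y where \<phi>: "\<phi> \<in> carrier ?D" "\<pp> = annihilator R ?D \<phi>" and y: "y \<in> carrier H1" "\<phi> y \<noteq> \<zero>\<^bsub>E\<^esub>"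
          by (rule associated_prime_of_dual[OF H1_module E p(1)])
        have \<phi>h: "\<phi> \<in> module_homs R H1 E" using \<phi>(1) by (simp add: hom_module_def)
        obtain w where w: "w \<in> W" "y = cls w" using y by (auto simp: H1_carrier)
        note ch = module_homsD[OF cls_hom] and ph = module_homsD[OF \<phi>h]
        have clsc: "cls v \<in> carrier H1" if "v \<in> W" for v using that by (simp add: H1_carrier)
        \<comment> \<open>The functional \<open>\<phi>\<close> is killed by \<open>I\<close>, so its
          pullback to \<open>W\<close> satisfies the assumptions of
          \<open>vanish_on_W\<close>.\<close>
        have "\<phi> (cls w) = \<zero>\<^bsub>E\<^esub>"
        proof (rule vanish_on_W[OF van E _ _ _ w(1), where \<psi> = "\<lambda>v. \<phi> (cls v)"])
          show "(\<lambda>v. \<phi> (cls v)) \<in> module_homs R ((Q 0)\<lparr>carrier := W\<rparr>) E"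
            by (rule module_homsI) (use ch ph clsc in simp_all)
          show "\<phi> (cls t) = \<zero>\<^bsub>E\<^esub>" if t: "t \<in> T 0" for t
          proof -
            have "t = t \<oplus>\<^bsub>Q 0\<^esub> \<epsilon> \<zero>\<^bsub>R\<^esub>" using T_carrier[OF t] by (simp add: eps_zero)
            then have "cls t = \<zero>\<^bsub>H1\<^esub>" using cls_eq_zero[OF T_W[OF t]] t by blast
            then show ?thesis using module_homs_zero[OF H1_module E \<phi>h] by simp
          qed
          show "a \<odot>\<^bsub>E\<^esub> \<phi> (cls v) = \<zero>\<^bsub>E\<^esub>" if a: "a \<in> I" and v: "v \<in> W" for a v
            using annI[OF _ \<phi>(1), of a] a p(2) \<phi>(2) I_sub clsc[OF v] by blast
        qed
        then show False using y w by simp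
      qed
      then obtain r where rI: "r \<in> I" and r: "r \<notin> \<Union>(associated_primes R ?D)" by blast
      have rc: "r \<in> carrier R" using rI I_sub by blast
      define U where "U = (\<lambda>y. r \<odot>\<^bsub>H1\<^esub> y) ` carrier H1"
      have U: "submodule U R H1"
        unfolding U_def
        by (rule module_homs_image_submodule[OF H1_module H1_module _ H1.carrier_is_submodule])
          (rule module_homsI, use rc in \<open>simp_all add: H1.smult_r_distr H1.smult_left_commute[of r]\<close>)
      \<comment> \<open>A functional vanishing on \<open>r H1\<close> but not at \<open>y\<close>
        would be annihilated by \<open>r\<close>, which would then lie in an associated
        prime.\<close>
      have surj: "y \<in> U" if y: "y \<in> carrier H1" for y
      proof (rule ccontr)
        assume yU: "y \<notin> U"
        obtain \<phi> where \<phi>: "\<phi> \<in> carrier ?D" "\<phi> y \<noteq> \<zero>\<^bsub>E\<^esub>" "\<And>u. u \<in> U \<Longrightarrow> \<phi> u = \<zero>\<^bsub>E\<^esub>"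
          using sep[OF U y yU] by blast
        have \<phi>h: "\<phi> \<in> module_homs R H1 E" using \<phi>(1) by (simp add: hom_module_def)
        have "r \<in> annihilator R ?D \<phi>"
          unfolding annI[OF rc \<phi>(1)]
          using \<phi>(3) module_homsD(3)[OF \<phi>h rc] unfolding U_def by fastforce
        moreover have "\<phi> \<noteq> \<zero>\<^bsub>?D\<^esub>" using hom_module_zero_iff[OF \<phi>(1)] \<phi>(2) y by blast
        then obtain \<pp> where "\<pp> \<in> associated_primes R ?D" "annihilator R ?D \<phi> \<subseteq> \<pp>"
          using exists_associated_prime[OF assms(1) D \<phi>(1)] by blast
        ultimately show False using r by blast
      qed
      have div: "\<exists>s\<in>W. \<exists>t\<in>T 0. \<exists>c\<in>carrier R. w = r \<odot>\<^bsub>Q 0\<^esub> s \<oplus>\<^bsub>Q 0\<^esub> t \<oplus>\<^bsub>Q 0\<^esub> \<epsilon> c" if w: "w \<in> W" for w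
      proof -
        have "cls w \<in> U" by (rule surj) (use w in \<open>simp add: H1_carrier\<close>)
        then obtain s where s: "s \<in> W" "cls w = r \<odot>\<^bsub>H1\<^esub> cls s" by (auto simp: U_def H1_carrier)
        then have "cls w = cls (r \<odot>\<^bsub>Q 0\<^esub> s)" using cls_smult[OF rc s(1)] by simp
        then show ?thesis
          using cls_eq[OF w Q.submoduleE(4)[OF W_submodule rc s(1)]] s(1) by blast
      qed
      have unitI: "\<one>\<^bsub>R\<^esub> \<ominus>\<^bsub>R\<^esub> c \<in> Units R" if "c \<in> I" for c using unit Im that by blast
      show ?thesis
        using pow_mem_of_divisible[OF van rc unitI div] rI by blast
    qed
    then obtain r where r: "r \<in> I" "\<And>a. a \<in> I \<Longrightarrow> \<exists>n::nat. \<exists>b\<in>carrier R. a [^]\<^bsub>R\<^esub> n = r \<otimes>\<^bsub>R\<^esub> b" by blast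
    have "ideal_radical R I = ideal_radical R (genideal R {r})"
      by (rule ideal_radical_eq_principal[OF R I r])
    then have "\<exists>rs. length rs = 1 \<and> set rs \<subseteq> carrier R \<and> ideal_radical R I = ideal_radical R (genideal R (set rs))"
      using r(1) I_sub by (intro exI[of _ "[r]"]) auto
    then show "arithmetic_rank R I \<le> 1" unfolding arithmetic_rank_def by (rule Least_le)
  next
    assume "arithmetic_rank R I \<le> 1"
    then obtain x where xc: "x \<in> carrier R" and rad: "ideal_radical R I = ideal_radical R (genideal R {x})"
      by (rule arithmetic_rank_le_1_imp_principal[OF assms(1) R I])
    have P: "genideal R {x} = PIdl\<^bsub>R\<^esub> x" by (rule cgenideal_eq_genideal[symmetric, OF xc])
    interpret radical_of_principal R I \<epsilon> Q d x
    proof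
      show "x \<in> carrier R" by (rule xc)
      have "x [^]\<^bsub>R\<^esub> (1::nat) \<in> genideal R {x}" using genideal_self'[OF xc] xc by simp
      then have "x \<in> ideal_radical R (genideal R {x})" unfolding ideal_radical_def using xc by blast
      then have "x \<in> ideal_radical R I" by (simp only: rad)
      then show "\<exists>k::nat. x [^]\<^bsub>R\<^esub> k \<in> I" by (simp add: ideal_radical_def)
      fix a assume a: "a \<in> I"
      have "a [^]\<^bsub>R\<^esub> (1::nat) \<in> I" using a I_sub by auto
      then have "a \<in> ideal_radical R I" unfolding ideal_radical_def using a I_sub by blast
      then have "a \<in> ideal_radical R (genideal R {x})" by (simp only: rad)
      then show "\<exists>l::nat. \<exists>b\<in>carrier R. a [^]\<^bsub>R\<^esub> l = b \<otimes>\<^bsub>R\<^esub> x"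
        unfolding P by (auto simp: ideal_radical_def cgenideal_def)
    qed
    show "satisfies_prime_avoidance R (associated_primes R ?D)"
      unfolding satisfies_prime_avoidance_def
    proof (intro allI impI)
      fix J assume J: "ideal J R" and JU: "J \<subseteq> \<Union>(associated_primes R ?D)"
      interpret J: ideal J R by (rule J)
      \<comment> \<open>As zero lies in \<open>J\<close>, there is an associated prime and
        \<open>H1\<close> is nonzero. This rules out an invertible \<open>x\<close>, so
        \<open>x\<close> is in \<open>\<mm>\<close> and all \<open>1 - x a\<close> are
        units.\<close>
      have "x \<notin> Units R"
      proof
        assume xU: "x \<in> Units R"
        obtain \<pp> where p: "\<pp> \<in> associated_primes R ?D" using JU J.zero_closed by blast
        obtain \<phi> y where \<phi>: "\<phi> \<in> carrier ?D" and y: "y \<in> carrier H1" "\<phi> y \<noteq> \<zero>\<^bsub>E\<^esub>"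
          by (rule associated_prime_of_dual[OF H1_module E p])
        have "\<phi> \<in> module_homs R H1 E" using \<phi> by (simp add: hom_module_def)
        then show False using H1_trivial_if_Units[OF xU y(1)] module_homs_zero[OF H1_module E] y(2) by blast
      qed
      then have xm: "x \<in> \<mm>" using local_ring_Units[OF assms(1,2) xc] by blast
      have units: "\<one>\<^bsub>R\<^esub> \<ominus>\<^bsub>R\<^esub> x \<otimes>\<^bsub>R\<^esub> a \<in> Units R" if "a \<in> carrier R" for a
        by (rule unit[OF m.I_r_closed[OF xm that]])
      \<comment> \<open>Otherwise \<open>x^n\<close> would annihilate some nonzero
        \<open>\<phi>\<close>; but by divisibility of \<open>H1\<close> every value of
        \<open>\<phi>\<close> has the form \<open>x^n\<close> times \<open>\<phi> z\<close>.\<close>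
      have "x [^]\<^bsub>R\<^esub> n \<notin> J" for n :: nat
      proof
        assume "x [^]\<^bsub>R\<^esub> n \<in> J"
        then obtain \<pp> where p: "\<pp> \<in> associated_primes R ?D" "x [^]\<^bsub>R\<^esub> n \<in> \<pp>" using JU by blast
        obtain \<phi> y where \<phi>: "\<phi> \<in> carrier ?D" "\<pp> = annihilator R ?D \<phi>" and y: "y \<in> carrier H1" "\<phi> y \<noteq> \<zero>\<^bsub>E\<^esub>"
          by (rule associated_prime_of_dual[OF H1_module E p(1)])
        have xn: "x [^]\<^bsub>R\<^esub> n \<in> carrier R" using xc by simp
        obtain z where z: "z \<in> carrier H1" "y = x [^]\<^bsub>R\<^esub> n \<odot>\<^bsub>H1\<^esub> z" using H1_divisible[OF y(1)] by blast
        have "\<phi> \<in> module_homs R H1 E" using \<phi> by (simp add: hom_module_def)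
        then have "\<phi> y = x [^]\<^bsub>R\<^esub> n \<odot>\<^bsub>E\<^esub> \<phi> z" using z module_homsD(3)[OF _ xn z(1)] by blast
        also have "\<dots> = \<zero>\<^bsub>E\<^esub>" using annI[OF xn \<phi>(1)] p(2) \<phi>(2) z(1) by blast
        finally show False using y(2) by blast
      qed
      then obtain U y where U: "submodule U R H1" and y: "y \<in> carrier H1" "y \<notin> U"
        and JU: "\<And>j z. j \<in> J \<Longrightarrow> z \<in> carrier H1 \<Longrightarrow> j \<odot>\<^bsub>H1\<^esub> z \<in> U"
        using exists_proper_submodule[OF J _ units] by blast
      obtain \<phi> where \<phi>: "\<phi> \<in> carrier ?D" "\<phi> y \<noteq> \<zero>\<^bsub>E\<^esub>" "\<And>u. u \<in> U \<Longrightarrow> \<phi> u = \<zero>\<^bsub>E\<^esub>"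
        using sep[OF U y] by blast
      have \<phi>h: "\<phi> \<in> module_homs R H1 E" using \<phi>(1) by (simp add: hom_module_def)
      \<comment> \<open>\<open>\<phi>\<close> vanishes on \<open>U\<close>, which contains
        \<open>J\<close> times \<open>H1\<close>. Any associated prime above the annihilator of
        \<open>\<phi>\<close> is the one sought.\<close>
      have "J \<subseteq> annihilator R ?D \<phi>"
      proof
        fix j assume j: "j \<in> J"
        have jc: "j \<in> carrier R" using j by (rule J.a_Hcarr)
        have "j \<odot>\<^bsub>E\<^esub> \<phi> z = \<zero>\<^bsub>E\<^esub>" if z: "z \<in> carrier H1" for z
          using module_homsD(3)[OF \<phi>h jc z] \<phi>(3)[OF JU[OF j z]] by simp
        then show "j \<in> annihilator R ?D \<phi>" using annI[OF jc \<phi>(1)] by blast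
      qed
      moreover have "\<phi> \<noteq> \<zero>\<^bsub>?D\<^esub>" using hom_module_zero_iff[OF \<phi>(1)] \<phi>(2) y by blast
      then obtain \<pp> where "\<pp> \<in> associated_primes R ?D" "annihilator R ?D \<phi> \<subseteq> \<pp>"
        using exists_associated_prime[OF assms(1) D \<phi>(1)] by blast
      ultimately show "\<exists>\<pp>\<in>associated_primes R ?D. J \<subseteq> \<pp>" by blast
    qed
  qed
  then show ?thesis by (simp only: H1_def)
qed

end
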